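(* Let $\mathfrak{g}$ be a complex simple Lie algebra, and let $V$ be a minuscule $\mathfrak{g}$-representation with minuscule weight $\lambda$ and minuscule heap $P_\lambda$. Suppose that $\mathfrak{g}$ is simply laced, and let $\Omega$ denote the common length of the roots of $\mathfrak{g}$. Let $g\colon J(P_\lambda)\to\mathbb{R}$ be defined by $$I\mapsto \bigl|\{p\in P_\lambda : t_p(I)=I\setminus\{p\}\text{ with } p\in I\}\bigr|,$$ i.e. $g(I)$ is the number of maximal elements of $I$. Then, with respect to the Fon-Der-Flaass action $\Psi$ on $J(P_\lambda)$, $g$ is $c$-mesic with $$c = 2\,\frac{(\lambda,\lambda)}{\Omega^2}.$$
   Context: **Lie-theoretic setting.** $\mathfrak{g}$ is a complex simple Lie algebra with a fixed Cartan subalgebra $\mathfrak{h}$, root system $R$, and real span $\mathfrak{h}_{\mathbb{R}}^*$ of $R$ in $\mathfrak{h}^*$; $(\cdot,\cdot)$ is the inner product on $\mathfrak{h}_{\mathbb{R}}^*$ induced by the Killing form. The length of a root $\alpha$ is $\sqrt{(\alpha,\alpha)}$. For $\alpha\in R$, $\alpha^\vee := 2\alpha/(\alpha,\alpha)$. Fix simple roots $\alpha_1,\dots,\alpha_t$. The weight lattice is $\Lambda=\{\mu\in\mathfrak{h}_{\mathbb{R}}^* : (\mu,\alpha_i^\vee)\in\mathbb{Z}\ \forall i\}$, and $\mu\in\Lambda$ is dominant if $(\mu,\alpha_i^\vee)\ge 0$ for all $i$. $W$ is the Weyl group, generated by the simple reflections $s_i(\mu)=\mu-(\mu,\alpha_i^\vee)\alpha_i$,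 with longest element $w_0$. **Minuscule representations.** For dominant $\lambda$, $V^\lambda$ is the irreducible representation of highest weight $\lambda$ and $\Lambda_\lambda$ is its set of weights. An irreducible finite-dimensional representation $V\cong V^\lambda$ is minuscule, with minuscule weight $\lambda$, if $W$ acts transitively on $\Lambda_\lambda$. In that case $\Lambda_\lambda$ is partially ordered by the order opposite to the root order: covering relations are $\mu\lessdot\mu-\alpha_i$ (with $\mu,\mu-\alpha_i\in\Lambda_\lambda$), so $\lambda$ is the unique minimal element and $w_0\lambda$ the unique maximal element. It is a known fact that $\Lambda_\lambda$ is a distributive lattice; the minuscule poset for $V$ is its poset of join-irreducible elements. **Minuscule heap.** An element $w\in W$ is $\lambda$-minuscule if it has a reduced word $w=s_{i_\ell}\cdots s_{i_1}$ such that $\lambda\lessdot s_{i_1}\lambda\lessdot\cdots\lessdot (s_{i_\ell}\cdots s_{i_1})\lambda=w\lambda$ is a saturated chain in $\Lambda_\lambda$. There is a unique $\lambda$-minuscule $w$ with $w\lambda=w_0\lambda$. Take any reduced word $w=s_{i_\ell}\cdots s_{i_1}$ of it. The minuscule heap $P_\lambda$ is the labeled set $\{1,\dots,\ell\}$, where element $j$ is labeled by $i_j$ (equivalently, by the simple root $\alpha_{i_j}$), with the partial order that is the transitive closure of the relations $j<j'$ for all $1\le j<j'\le\ell$ such that $s_{i_j}$ and $s_{i_{j'}}$ do not commute. Up to isomorphism of labeled posets this does not depend on the reduced word, and as a poset $P_\lambda$ is isomorphic to the minuscule poset for $V$. **Order ideals, toggles and the Fon-Der-Flaass action.** For a finite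 poset $P$, $J(P)$ is the set of order ideals (down-closed subsets) of $P$. For $p\in P$, the toggle $t_p\colon J(P)\to J(P)$ sends $I$ to the symmetric difference $I\triangle\{p\}$ if this is an order ideal, and to $I$ otherwise. The Fon-Der-Flaass action $\Psi\colon J(P)\to J(P)$ is the bijection sending $I$ to the order ideal generated by the minimal elements of $P\setminus I$. **Homomesy.** Let $\mathcal{S}$ be a finite set and $\tau\colon\mathcal{S}\to\mathcal{S}$ a bijection of order $m$ (the least positive integer with $\tau^m=\mathrm{id}$). A function $f\colon\mathcal{S}\to\mathbb{R}$ is $c$-mesic with respect to $\tau$ if $\frac1m\sum_{k=0}^{m-1}f(\tau^k(x))=c$ for all $x\in\mathcal{S}$. *)

theory Defs
  imports
    Complex_Main
    "HOL-Library.Function_Algebras"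
    "HOL-Algebra.Bij"
    "HOL-Algebra.Generated_Groups"
begin

section \<open>Complex vector spaces and the trace\<close>

class complex_vector = ab_group_add +
  fixes scaleC :: "complex \<Rightarrow> 'a \<Rightarrow> 'a"  (infixr \<open>*\<^sub>C\<close> 75)
  assumes scaleC_add_right: "a *\<^sub>C (x + y) = a *\<^sub>C x + a *\<^sub>C y"
    and scaleC_add_left: "(a + b) *\<^sub>C x = a *\<^sub>C x + b *\<^sub>C x"
    and scaleC_scaleC: "a *\<^sub>C b *\<^sub>C x = (a * b) *\<^sub>C x"
    and scaleC_one: "1 *\<^sub>C x = x"

global_interpretation cv: vector_space "scaleC :: complex \<Rightarrow> 'a \<Rightarrow> 'a::complex_vector"
  by unfold_locales (simp_all add: scaleC_add_right scaleC_add_left scaleC_scaleC scaleC_one)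

abbreviation clinear :: "('a::complex_vector \<Rightarrow> 'b::complex_vector) \<Rightarrow> bool" where
  "clinear \<equiv> Vector_Spaces.linear scaleC scaleC"

definition finite_dim :: "'a::complex_vector itself \<Rightarrow> bool" where
  "finite_dim _ \<longleftrightarrow> (\<exists>B :: 'a set. finite B \<and> cv.span B = UNIV)"

text \<open>The diagonal sum does not depend on the basis; this is meant for linear maps of a
  finite-dimensional space.\<close>

definition trace :: "('a::complex_vector \<Rightarrow> 'a) \<Rightarrow> complex" where
  "trace f = (let B = (SOME B. cv.independent B \<and> cv.span B = UNIV)
              in \<Sum>b\<in>B. cv.representation B (f b) b)"

definition diagonalizable :: "('a::complex_vector \<Rightarrow> 'a) \<Rightarrow> bool" where
  "diagonalizable f \<longleftrightarrow> cv.span {v. \<exists>c. f v = c *\<^sub>C v} = UNIV"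


section \<open>Complex simple Lie algebras, Cartan subalgebras and roots\<close>

class complex_lie_algebra = complex_vector +
  fixes lie_bracket :: "'a \<Rightarrow> 'a \<Rightarrow> 'a"
  assumes lie_add_left: "lie_bracket (x + y) z = lie_bracket x z + lie_bracket y z"
    and lie_add_right: "lie_bracket x (y + z) = lie_bracket x y + lie_bracket x z"
    and lie_scaleC_left: "lie_bracket (c *\<^sub>C x) y = c *\<^sub>C lie_bracket x y"
    and lie_scaleC_right: "lie_bracket x (c *\<^sub>C y) = c *\<^sub>C lie_bracket x y"
    and lie_self: "lie_bracket x x = 0"
    and lie_jacobi: "lie_bracket x (lie_bracket y z) + lie_bracket y (lie_bracket z x)
                     + lie_bracket z (lie_bracket x y) = 0"

definition lie_ideal :: "'g::complex_lie_algebra set \<Rightarrow> bool" where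
  "lie_ideal I \<longleftrightarrow> cv.subspace I \<and> (\<forall>x. \<forall>y\<in>I. lie_bracket x y \<in> I)"

definition simple_lie_algebra :: "'g::complex_lie_algebra itself \<Rightarrow> bool" where
  "simple_lie_algebra _ \<longleftrightarrow>
     finite_dim TYPE('g) \<and>
     (\<exists>x y :: 'g. lie_bracket x y \<noteq> 0) \<and>
     (\<forall>I :: 'g set. lie_ideal I \<longrightarrow> I = {0} \<or> I = UNIV)"

definition killing :: "'g::complex_lie_algebra \<Rightarrow> 'g \<Rightarrow> complex" where
  "killing x y = trace (\<lambda>z. lie_bracket x (lie_bracket y z))"

text \<open>The textbook definition for complex semisimple Lie algebras (as in Hall,
  \<^emph>\<open>Lie Groups, Lie Algebras, and Representations\<close>): a commutative subalgebra
  that is its own centralizer and acts diagonalizably.\<close>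

definition cartan_subalgebra :: "'g::complex_lie_algebra set \<Rightarrow> bool" where
  "cartan_subalgebra H \<longleftrightarrow>
     cv.subspace H \<and>
     (\<forall>x\<in>H. \<forall>y\<in>H. lie_bracket x y = 0) \<and>
     (\<forall>x. (\<forall>h\<in>H. lie_bracket h x = 0) \<longrightarrow> x \<in> H) \<and>
     (\<forall>h\<in>H. diagonalizable (lie_bracket h))"

text \<open>A linear functional on the subspace \<open>H\<close> is represented by its extension by zero to the whole
  Lie algebra, so that equality of functionals is equality of functions, and the vector space
  operations are the pointwise ones.\<close>

definition dual :: "'g::complex_lie_algebra set \<Rightarrow> ('g \<Rightarrow> complex) set" where
  "dual H = {\<phi>. (\<forall>x\<in>H. \<forall>y\<in>H. \<phi> (x + y) = \<phi> x + \<phi> y) \<and>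
                (\<forall>c. \<forall>x\<in>H. \<phi> (c *\<^sub>C x) = c * \<phi> x) \<and>
                (\<forall>x. x \<notin> H \<longrightarrow> \<phi> x = 0)}"

definition root_space :: "'g::complex_lie_algebra set \<Rightarrow> ('g \<Rightarrow> complex) \<Rightarrow> 'g set" where
  "root_space H \<beta> = {x. \<forall>h\<in>H. lie_bracket h x = \<beta> h *\<^sub>C x}"

definition roots :: "'g::complex_lie_algebra set \<Rightarrow> ('g \<Rightarrow> complex) set" where
  "roots H = {\<beta> \<in> dual H. \<beta> \<noteq> 0 \<and> root_space H \<beta> \<noteq> {0}}"

definition scale_fun :: "real \<Rightarrow> ('g \<Rightarrow> complex) \<Rightarrow> 'g \<Rightarrow> complex"  (infixr \<open>*\<^sub>F\<close> 75) where
  "r *\<^sub>F \<phi> = (\<lambda>x. complex_of_real r * \<phi> x)"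

global_interpretation rf: vector_space "scale_fun :: real \<Rightarrow> ('g \<Rightarrow> complex) \<Rightarrow> 'g \<Rightarrow> complex"
  by unfold_locales (simp_all add: scale_fun_def fun_eq_iff algebra_simps)

definition real_dual :: "'g::complex_lie_algebra set \<Rightarrow> ('g \<Rightarrow> complex) set" where
  "real_dual H = rf.span (roots H)"

text \<open>The element of \<open>H\<close> corresponding to a functional under the isomorphism between \<open>H\<close> and its
  dual given by the Killing form, and the form transported to the dual along it. The transported
  form is real-valued on the real span of the roots, the only place where \<open>ip\<close> is used.\<close>

definition killing_dual :: "'g::complex_lie_algebra set \<Rightarrow> ('g \<Rightarrow> complex) \<Rightarrow> 'g" where
  "killing_dual H \<phi> = (THE t. t \<in> H \<and> (\<forall>h\<in>H. killing t h = \<phi> h))"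

definition ip :: "'g::complex_lie_algebra set \<Rightarrow> ('g \<Rightarrow> complex) \<Rightarrow> ('g \<Rightarrow> complex) \<Rightarrow> real" where
  "ip H \<phi> \<psi> = Re (killing (killing_dual H \<phi>) (killing_dual H \<psi>))"

definition root_length :: "'g::complex_lie_algebra set \<Rightarrow> ('g \<Rightarrow> complex) \<Rightarrow> real" where
  "root_length H \<beta> = sqrt (ip H \<beta> \<beta>)"

definition simply_laced :: "'g::complex_lie_algebra set \<Rightarrow> bool" where
  "simply_laced H \<longleftrightarrow> (\<forall>\<beta>\<in>roots H. \<forall>\<gamma>\<in>roots H. root_length H \<beta> = root_length H \<gamma>)"

definition coroot :: "'g::complex_lie_algebra set \<Rightarrow> ('g \<Rightarrow> complex) \<Rightarrow> 'g \<Rightarrow> complex" where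
  "coroot H \<beta> = (2 / ip H \<beta> \<beta>) *\<^sub>F \<beta>"


section \<open>Simple roots, weights and the Weyl group\<close>

text \<open>Throughout, \<open>\<alpha> 1, \<dots>, \<alpha> t\<close> are the simple roots; the values of \<open>\<alpha>\<close> outside \<open>{1..t}\<close> are
  irrelevant.\<close>

definition simple_roots ::
  "'g::complex_lie_algebra set \<Rightarrow> nat \<Rightarrow> (nat \<Rightarrow> 'g \<Rightarrow> complex) \<Rightarrow> bool" where
  "simple_roots H t \<alpha> \<longleftrightarrow>
     inj_on \<alpha> {1..t} \<and> \<alpha> ` {1..t} \<subseteq> roots H \<and>
     rf.independent (\<alpha> ` {1..t}) \<and> rf.span (\<alpha> ` {1..t}) = real_dual H \<and>
     (\<forall>\<beta>\<in>roots H. \<exists>n :: nat \<Rightarrow> nat.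
        \<beta> = (\<Sum>i=1..t. real (n i) *\<^sub>F \<alpha> i) \<or> \<beta> = - (\<Sum>i=1..t. real (n i) *\<^sub>F \<alpha> i))"

definition positive_roots ::
  "'g::complex_lie_algebra set \<Rightarrow> nat \<Rightarrow> (nat \<Rightarrow> 'g \<Rightarrow> complex) \<Rightarrow> ('g \<Rightarrow> complex) set" where
  "positive_roots H t \<alpha> =
     {\<beta> \<in> roots H. \<exists>n :: nat \<Rightarrow> nat. \<beta> = (\<Sum>i=1..t. real (n i) *\<^sub>F \<alpha> i)}"

definition weight_lattice ::
  "'g::complex_lie_algebra set \<Rightarrow> nat \<Rightarrow> (nat \<Rightarrow> 'g \<Rightarrow> complex) \<Rightarrow> ('g \<Rightarrow> complex) set" where
  "weight_lattice H t \<alpha> = {\<mu> \<in> real_dual H. \<forall>i\<in>{1..t}. ip H \<mu> (coroot H (\<alpha> i)) \<in> \<int>}"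

definition dominant ::
  "'g::complex_lie_algebra set \<Rightarrow> nat \<Rightarrow> (nat \<Rightarrow> 'g \<Rightarrow> complex) \<Rightarrow> ('g \<Rightarrow> complex) \<Rightarrow> bool" where
  "dominant H t \<alpha> \<mu> \<longleftrightarrow>
     \<mu> \<in> weight_lattice H t \<alpha> \<and> (\<forall>i\<in>{1..t}. ip H \<mu> (coroot H (\<alpha> i)) \<ge> 0)"

text \<open>Members of \<open>BijGroup S\<close> are functions that are \<open>undefined\<close> outside \<open>S\<close>, so that equality in the
  Weyl group is equality of maps on the real span of the roots.\<close>

definition simple_reflection ::
  "'g::complex_lie_algebra set \<Rightarrow> ('g \<Rightarrow> complex) \<Rightarrow> ('g \<Rightarrow> complex) \<Rightarrow> 'g \<Rightarrow> complex" where
  "simple_reflection H \<beta> = (\<lambda>\<mu>\<in>real_dual H. \<mu> - ip H \<mu> (coroot H \<beta>) *\<^sub>F \<beta>)"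

definition weyl_group ::
  "'g::complex_lie_algebra set \<Rightarrow> nat \<Rightarrow> (nat \<Rightarrow> 'g \<Rightarrow> complex)
     \<Rightarrow> (('g \<Rightarrow> complex) \<Rightarrow> 'g \<Rightarrow> complex) set" where
  "weyl_group H t \<alpha> =
     generate (BijGroup (real_dual H)) ((\<lambda>i. simple_reflection H (\<alpha> i)) ` {1..t})"

text \<open>The word \<open>s\<^sub>i\<^sub>l \<cdots> s\<^sub>i\<^sub>1\<close> is encoded by the list \<open>[i\<^sub>1, \<dots>, i\<^sub>l]\<close> of its indices
  in order of application: the head of the list is the rightmost letter.\<close>

definition word_elt ::
  "'g::complex_lie_algebra set \<Rightarrow> (nat \<Rightarrow> 'g \<Rightarrow> complex) \<Rightarrow> nat list
     \<Rightarrow> ('g \<Rightarrow> complex) \<Rightarrow> 'g \<Rightarrow> complex" where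
  "word_elt H \<alpha> js =
     fold (\<lambda>i w. simple_reflection H (\<alpha> i) \<otimes>\<^bsub>BijGroup (real_dual H)\<^esub> w) js
       \<one>\<^bsub>BijGroup (real_dual H)\<^esub>"

definition weyl_length ::
  "'g::complex_lie_algebra set \<Rightarrow> nat \<Rightarrow> (nat \<Rightarrow> 'g \<Rightarrow> complex)
     \<Rightarrow> (('g \<Rightarrow> complex) \<Rightarrow> 'g \<Rightarrow> complex) \<Rightarrow> nat" where
  "weyl_length H t \<alpha> w =
     (LEAST n. \<exists>js. set js \<subseteq> {1..t} \<and> length js = n \<and> word_elt H \<alpha> js = w)"

definition reduced_word ::
  "'g::complex_lie_algebra set \<Rightarrow> nat \<Rightarrow> (nat \<Rightarrow> 'g \<Rightarrow> complex)
     \<Rightarrow> (('g \<Rightarrow> complex) \<Rightarrow> 'g \<Rightarrow> complex) \<Rightarrow> nat list \<Rightarrow> bool" where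
  "reduced_word H t \<alpha> w js \<longleftrightarrow>
     set js \<subseteq> {1..t} \<and> word_elt H \<alpha> js = w \<and> length js = weyl_length H t \<alpha> w"

definition longest_element ::
  "'g::complex_lie_algebra set \<Rightarrow> nat \<Rightarrow> (nat \<Rightarrow> 'g \<Rightarrow> complex)
     \<Rightarrow> (('g \<Rightarrow> complex) \<Rightarrow> 'g \<Rightarrow> complex) \<Rightarrow> bool" where
  "longest_element H t \<alpha> w\<^sub>0 \<longleftrightarrow>
     w\<^sub>0 \<in> weyl_group H t \<alpha> \<and>
     (\<forall>w\<in>weyl_group H t \<alpha>. weyl_length H t \<alpha> w \<le> weyl_length H t \<alpha> w\<^sub>0)"


section \<open>Minuscule representations\<close>

definition lie_representation ::
  "('g::complex_lie_algebra \<Rightarrow> 'v::complex_vector \<Rightarrow> 'v) \<Rightarrow> bool" where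
  "lie_representation \<rho> \<longleftrightarrow>
     (\<forall>x. clinear (\<rho> x)) \<and> (\<forall>v. clinear (\<lambda>x. \<rho> x v)) \<and>
     (\<forall>x y v. \<rho> (lie_bracket x y) v = \<rho> x (\<rho> y v) - \<rho> y (\<rho> x v))"

definition irreducible_representation ::
  "('g::complex_lie_algebra \<Rightarrow> 'v::complex_vector \<Rightarrow> 'v) \<Rightarrow> bool" where
  "irreducible_representation \<rho> \<longleftrightarrow>
     lie_representation \<rho> \<and> (\<exists>v :: 'v. v \<noteq> 0) \<and>
     (\<forall>U. cv.subspace U \<and> (\<forall>x. \<forall>u\<in>U. \<rho> x u \<in> U) \<longrightarrow> U = {0} \<or> U = UNIV)"

definition weight_space ::
  "'g::complex_lie_algebra set \<Rightarrow> ('g \<Rightarrow> 'v::complex_vector \<Rightarrow> 'v) \<Rightarrow> ('g \<Rightarrow> complex) \<Rightarrow> 'v set" where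
  "weight_space H \<rho> \<mu> = {v. \<forall>h\<in>H. \<rho> h v = \<mu> h *\<^sub>C v}"

definition weights ::
  "'g::complex_lie_algebra set \<Rightarrow> ('g \<Rightarrow> 'v::complex_vector \<Rightarrow> 'v) \<Rightarrow> ('g \<Rightarrow> complex) set" where
  "weights H \<rho> = {\<mu> \<in> dual H. weight_space H \<rho> \<mu> \<noteq> {0}}"

definition has_highest_weight ::
  "'g::complex_lie_algebra set \<Rightarrow> nat \<Rightarrow> (nat \<Rightarrow> 'g \<Rightarrow> complex)
     \<Rightarrow> ('g \<Rightarrow> 'v::complex_vector \<Rightarrow> 'v) \<Rightarrow> ('g \<Rightarrow> complex) \<Rightarrow> bool" where
  "has_highest_weight H t \<alpha> \<rho> lam \<longleftrightarrow>
     lam \<in> weights H \<rho> \<and>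
     (\<exists>v\<in>weight_space H \<rho> lam. v \<noteq> 0 \<and>
        (\<forall>\<beta>\<in>positive_roots H t \<alpha>. \<forall>x\<in>root_space H \<beta>. \<rho> x v = 0))"

text \<open>The last conjunct says that the weights form a single orbit under the Weyl group.\<close>

definition minuscule_representation ::
  "'g::complex_lie_algebra set \<Rightarrow> nat \<Rightarrow> (nat \<Rightarrow> 'g \<Rightarrow> complex)
     \<Rightarrow> ('g \<Rightarrow> 'v::complex_vector \<Rightarrow> 'v) \<Rightarrow> ('g \<Rightarrow> complex) \<Rightarrow> bool" where
  "minuscule_representation H t \<alpha> \<rho> lam \<longleftrightarrow>
     finite_dim TYPE('v) \<and> irreducible_representation \<rho> \<and>
     dominant H t \<alpha> lam \<and> has_highest_weight H t \<alpha> \<rho> lam \<and>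
     (\<forall>\<mu>\<in>weights H \<rho>. (\<lambda>w. w \<mu>) ` weyl_group H t \<alpha> = weights H \<rho>)"


section \<open>The minuscule heap\<close>

text \<open>Covering in the order on weights opposite to the root order: the highest weight is minimal.\<close>

definition weight_cover ::
  "'g::complex_lie_algebra set \<Rightarrow> nat \<Rightarrow> (nat \<Rightarrow> 'g \<Rightarrow> complex)
     \<Rightarrow> ('g \<Rightarrow> 'v::complex_vector \<Rightarrow> 'v) \<Rightarrow> ('g \<Rightarrow> complex) \<Rightarrow> ('g \<Rightarrow> complex) \<Rightarrow> bool" where
  "weight_cover H t \<alpha> \<rho> \<mu> \<nu> \<longleftrightarrow>
     \<mu> \<in> weights H \<rho> \<and> \<nu> \<in> weights H \<rho> \<and> (\<exists>i\<in>{1..t}. \<nu> = \<mu> - \<alpha> i)"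

definition minuscule_element ::
  "'g::complex_lie_algebra set \<Rightarrow> nat \<Rightarrow> (nat \<Rightarrow> 'g \<Rightarrow> complex)
     \<Rightarrow> ('g \<Rightarrow> 'v::complex_vector \<Rightarrow> 'v) \<Rightarrow> ('g \<Rightarrow> complex)
     \<Rightarrow> (('g \<Rightarrow> complex) \<Rightarrow> 'g \<Rightarrow> complex) \<Rightarrow> bool" where
  "minuscule_element H t \<alpha> \<rho> lam w \<longleftrightarrow>
     w \<in> weyl_group H t \<alpha> \<and>
     (\<exists>js. reduced_word H t \<alpha> w js \<and>
        (\<forall>k<length js. weight_cover H t \<alpha> \<rho>
           (word_elt H \<alpha> (take k js) lam) (word_elt H \<alpha> (take (Suc k) js) lam)))"

definition heap_carrier :: "nat list \<Rightarrow> nat set" where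
  "heap_carrier js = {1..length js}"

definition heap_label :: "nat list \<Rightarrow> nat \<Rightarrow> nat" where
  "heap_label js j = js ! (j - 1)"

definition heap_order ::
  "'g::complex_lie_algebra set \<Rightarrow> (nat \<Rightarrow> 'g \<Rightarrow> complex) \<Rightarrow> nat list \<Rightarrow> (nat \<times> nat) set" where
  "heap_order H \<alpha> js =
     {(j, j'). j \<in> heap_carrier js \<and> j' \<in> heap_carrier js \<and> j < j' \<and>
        word_elt H \<alpha> [heap_label js j, heap_label js j'] \<noteq>
        word_elt H \<alpha> [heap_label js j', heap_label js j]}\<^sup>*"


section \<open>Order ideals, toggles, the Fon-Der-Flaass action, and homomesy\<close>

text \<open>A poset is given by a carrier \<open>P\<close> and its reflexive order relation \<open>r\<close>.\<close>

definition order_ideals :: "'a set \<Rightarrow> ('a \<times> 'a) set \<Rightarrow> 'a set set" where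
  "order_ideals P r = {I. I \<subseteq> P \<and> (\<forall>x\<in>I. \<forall>y\<in>P. (y, x) \<in> r \<longrightarrow> y \<in> I)}"

definition toggle :: "'a set \<Rightarrow> ('a \<times> 'a) set \<Rightarrow> 'a \<Rightarrow> 'a set \<Rightarrow> 'a set" where
  "toggle P r p I = (if sym_diff I {p} \<in> order_ideals P r then sym_diff I {p} else I)"

definition minimal_elements :: "('a \<times> 'a) set \<Rightarrow> 'a set \<Rightarrow> 'a set" where
  "minimal_elements r A = {m \<in> A. \<forall>x\<in>A. (x, m) \<in> r \<longrightarrow> x = m}"

definition fon_der_flaass :: "'a set \<Rightarrow> ('a \<times> 'a) set \<Rightarrow> 'a set \<Rightarrow> 'a set" where
  "fon_der_flaass P r I = {x \<in> P. \<exists>m\<in>minimal_elements r (P - I). (x, m) \<in> r}"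

definition bij_order :: "'s set \<Rightarrow> ('s \<Rightarrow> 's) \<Rightarrow> nat" where
  "bij_order S \<tau> = (LEAST m. m > 0 \<and> (\<forall>x\<in>S. (\<tau> ^^ m) x = x))"

definition homomesic :: "'s set \<Rightarrow> ('s \<Rightarrow> 's) \<Rightarrow> ('s \<Rightarrow> real) \<Rightarrow> real \<Rightarrow> bool" where
  "homomesic S \<tau> f c \<longleftrightarrow>
     finite S \<and> bij_betw \<tau> S S \<and>
     (\<forall>x\<in>S. 1 / real (bij_order S \<tau>) * (\<Sum>k<bij_order S \<tau>. f ((\<tau> ^^ k) x)) = c)"

end

theory Submission
  imports Defs "HOL-Combinatorics.Cycles"
begin

text \<open>An order ideal \<open>I\<close> of the heap corresponds to the weight \<open>\<mu>\<^sub>I = lam - \<Sum>p\<in>I. \<alpha>(label p)\<close> in the orbit of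
  \<open>lam\<close>. The pairing of \<open>\<mu>\<^sub>I\<close> with the coroot of \<open>\<alpha>\<^sub>i\<close> is \<open>a\<^sub>i(I) - r\<^sub>i(I)\<close>, where \<open>a\<^sub>i\<close> and \<open>r\<^sub>i\<close> count
  the addable and removable elements labelled \<open>i\<close>. Write \<open>\<mu>\<^sub>I = \<Sum>i. d\<^sub>i(I) \<alpha>\<^sub>i\<close>. Since all weights of
  the orbit have the same norm, \<open>2 (lam, lam) / \<Omega>\<^sup>2 = \<Sum>i. d\<^sub>i(I) (a\<^sub>i(I) - r\<^sub>i(I))\<close> for every \<open>I\<close>.
  Rowmotion \<open>\<Psi>\<close> turns the addable elements into the removable ones, so \<open>a\<^sub>i(I) = r\<^sub>i(\<Psi> I)\<close>, and if this
  number is nonzero then \<open>d\<^sub>i(I) = d\<^sub>i(\<Psi> I) + 1\<close>. Hence the constant differs from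
  \<open>\<Sum>i. r\<^sub>i(\<Psi> I) = g(\<Psi> I)\<close> by a difference of a function along \<open>\<Psi>\<close>, which cancels over an orbit.

  The Lie theory behind this is derived without Cartan's criterion: \<open>sl\<^sub>2\<close> computations show that all
  weights take rational multiples of \<open>\<beta>([e, f])\<close> as values on \<open>[e, f]\<close>, for \<open>e\<close>, \<open>f\<close> root vectors of \<open>\<beta>\<close> and \<open>- \<beta>\<close>; these brackets span
  the Cartan subalgebra because \<open>[g, g] = g\<close>, and so the Killing form is positive definite on a real
  form of it.\<close>

section \<open>Rowmotion on a finite poset\<close>

text \<open>The exact values 1 and -1 of a pairing come from comparing an ideal with the initial
  segment of the word before one occurrence of a letter, where the pairing is known to be 1; before
  the first and after the last occurrence, dominance of \<open>lam\<close> and antidominance of its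
  image under the longest element take over. The occurrences of a letter form a chain in the heap,
  so at most one of them is addable and at most one removable, and rowmotion through an addable one
  moves its coordinate by exactly one. One obstacle is that \<open>js\<close> is an arbitrary
  reduced word, whereas a chain of covers is given for a single one; a comparison of heights
  transfers it. On the Lie side, the real values give every element \<open>h\<close> of
  \<open>H\<close> a conjugate whose Killing product with \<open>h\<close> is a sum of squared
  moduli. Hence the radical of the form, an ideal, is not the whole algebra and must vanish.\<close>

locale finite_poset =
  fixes P :: "'a set" and r :: "('a \<times> 'a) set"
  assumes finite_carrier: "finite P"
    and refl_rel: "(x, x) \<in> r"
    and trans_rel: "(x, y) \<in> r \<Longrightarrow> (y, z) \<in> r \<Longrightarrow> (x, z) \<in> r"
    and antisym_rel: "(x, y) \<in> r \<Longrightarrow> (y, x) \<in> r \<Longrightarrow> x = y"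
begin

abbreviation "\<J> \<equiv> order_ideals P r"

lemma finite_ideals: "finite \<J>"
  by (rule finite_subset[of _ "Pow P"]) (auto simp: order_ideals_def finite_carrier)

lemma ideal_subset: "I \<in> \<J> \<Longrightarrow> I \<subseteq> P"
  by (auto simp: order_ideals_def)

lemma ideal_down: "I \<in> \<J> \<Longrightarrow> x \<in> I \<Longrightarrow> y \<in> P \<Longrightarrow> (y, x) \<in> r \<Longrightarrow> y \<in> I"
  by (auto simp: order_ideals_def)

lemma rowmotion_ideal: "fon_der_flaass P r I \<in> \<J>"
  unfolding order_ideals_def fon_der_flaass_def by (auto intro: trans_rel)

lemma exists_minimal_below:
  assumes "A \<subseteq> P" "x \<in> A"
  obtains m where "m \<in> minimal_elements r A" "(m, x) \<in> r"
proof -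
  define S where "S = {y \<in> A. (y, x) \<in> r}"
  define R where "R = {(y, z). y \<in> S \<and> z \<in> S \<and> (y, z) \<in> r \<and> y \<noteq> z}"
  have fin: "finite S" using assms finite_carrier by (auto simp: S_def intro: finite_subset)
  have "R \<subseteq> S \<times> S" by (auto simp: R_def)
  then have "finite R" using fin finite_subset by blast
  moreover have "trans R"
    unfolding R_def trans_def using trans_rel antisym_rel by blast
  then have "acyclic R"
    unfolding acyclic_def by (simp add: trancl_id) (auto simp: R_def)
  ultimately have "wf R" by (rule finite_acyclic_wf)
  moreover have "x \<in> S" using assms by (simp add: S_def refl_rel)
  ultimately obtain m where m: "m \<in> S" "\<And>y. (y, m) \<in> R \<Longrightarrow> y \<notin> S"
    by (rule wfE_min) blast
  have "m \<in> minimal_elements r A"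
    using m trans_rel unfolding minimal_elements_def S_def R_def by blast
  with m(1) show thesis using that by (auto simp: S_def)
qed

lemma insert_ideal_iff:
  assumes "I \<in> \<J>" "p \<in> P - I"
  shows "insert p I \<in> \<J> \<longleftrightarrow> p \<in> minimal_elements r (P - I)"
  using assms antisym_rel unfolding order_ideals_def minimal_elements_def by blast

text \<open>The minimal elements of the complement form an antichain, and an ideal generated by an
  antichain has exactly that antichain as its maximal elements. So what can be added to
  \<open>I\<close> is what can be removed from its image.\<close>

lemma removable_rowmotion_iff:
  assumes I: "I \<in> \<J>"
  shows "p \<in> fon_der_flaass P r I \<and> fon_der_flaass P r I - {p} \<in> \<J>
    \<longleftrightarrow> p \<in> minimal_elements r (P - I)"
proof
  assume *: "p \<in> fon_der_flaass P r I \<and> fon_der_flaass P r I - {p} \<in> \<J>"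
  then obtain m where m: "m \<in> minimal_elements r (P - I)" "(p, m) \<in> r" "p \<in> P"
    by (auto simp: fon_der_flaass_def)
  then have "m \<in> fon_der_flaass P r I"
    by (auto simp: fon_der_flaass_def minimal_elements_def refl_rel)
  then have "m = p" using * m ideal_down[of "fon_der_flaass P r I - {p}" m p] by auto
  then show "p \<in> minimal_elements r (P - I)" using m by simp
next
  assume p: "p \<in> minimal_elements r (P - I)"
  then have "p \<in> fon_der_flaass P r I"
    by (auto simp: fon_der_flaass_def minimal_elements_def refl_rel)
  moreover have "x = p" if "x \<in> fon_der_flaass P r I" "(p, x) \<in> r" for x
  proof -
    obtain m where m: "m \<in> minimal_elements r (P - I)" "(x, m) \<in> r"
      using \<open>x \<in> _\<close> by (auto simp: fon_der_flaass_def)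
    then have "(p, m) \<in> r" using that trans_rel by blast
    then have "p = m" using p m by (auto simp: minimal_elements_def)
    then show ?thesis using m that antisym_rel by blast
  qed
  ultimately show "p \<in> fon_der_flaass P r I \<and> fon_der_flaass P r I - {p} \<in> \<J>"
    using rowmotion_ideal[of I] unfolding order_ideals_def by blast
qed

text \<open>The complement is an up-set of a finite poset, hence generated by its minimal elements;
  these therefore determine \<open>I\<close>.\<close>

lemma ideal_complement_eq:
  assumes "I \<in> \<J>"
  shows "I = {x \<in> P. \<not> (\<exists>m\<in>minimal_elements r (P - I). (m, x) \<in> r)}"
proof (intro equalityI subsetI)
  fix x assume "x \<in> I"
  then show "x \<in> {x \<in> P. \<not> (\<exists>m\<in>minimal_elements r (P - I). (m, x) \<in> r)}"
    using assms unfolding order_ideals_def minimal_elements_def by blast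
next
  fix x assume x: "x \<in> {x \<in> P. \<not> (\<exists>m\<in>minimal_elements r (P - I). (m, x) \<in> r)}"
  show "x \<in> I"
  proof (rule ccontr)
    assume "x \<notin> I"
    then obtain m where "m \<in> minimal_elements r (P - I)" "(m, x) \<in> r"
      using exists_minimal_below[of "P - I" x] x by auto
    with x show False by blast
  qed
qed

text \<open>The maximal elements of the image give back the minimal elements of the complement,
  hence \<open>I\<close>; on a finite set injectivity is enough.\<close>

lemma bij_rowmotion: "bij_betw (fon_der_flaass P r) \<J> \<J>"
proof -
  have "inj_on (fon_der_flaass P r) \<J>"
  proof (rule inj_onI)
    fix I J assume *: "I \<in> \<J>" "J \<in> \<J>" "fon_der_flaass P r I = fon_der_flaass P r J"
    then have "minimal_elements r (P - I) = minimal_elements r (P - J)"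
      using removable_rowmotion_iff[of I] removable_rowmotion_iff[of J] by auto
    then show "I = J" using ideal_complement_eq[OF *(1)] ideal_complement_eq[OF *(2)] by simp
  qed
  moreover have "fon_der_flaass P r ` \<J> \<subseteq> \<J>" using rowmotion_ideal by blast
  ultimately show ?thesis
    by (simp add: bij_betw_def endo_inj_surj finite_ideals)
qed

lemma toggle_removes_iff:
  assumes "I \<in> \<J>" "p \<in> I"
  shows "toggle P r p I = I - {p} \<longleftrightarrow> I - {p} \<in> \<J>"
proof -
  have "sym_diff I {p} = I - {p}" using assms by auto
  then show ?thesis using assms unfolding toggle_def by auto
qed

end

text \<open>Guarantees that the \<open>LEAST\<close> in \<open>bij_order\<close> is
  attained.\<close>

lemma bij_order_exists:
  assumes "finite S" "bij_betw \<tau> S S"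
  shows "\<exists>m>0. \<forall>x\<in>S. (\<tau> ^^ m) x = x"
proof -
  \<comment> \<open>\<open>permutes\<close> demands the identity outside \<open>S\<close>, where
    \<open>\<tau>\<close> is arbitrary.\<close>
  define \<sigma> where "\<sigma> x = (if x \<in> S then \<tau> x else x)" for x
  have "bij_betw \<sigma> S S \<longleftrightarrow> bij_betw \<tau> S S" by (rule bij_betw_cong) (simp add: \<sigma>_def)
  then have "\<sigma> permutes S" using assms(2) by (intro bij_imp_permutes) (auto simp: \<sigma>_def)
  then have "permutation \<sigma>" using assms(1) permutation_permutes by blast
  then obtain m where m: "\<sigma> ^^ m = id" "m > 0" by (rule permutation_is_nilpotent)
  have "(\<sigma> ^^ k) x = (\<tau> ^^ k) x \<and> (\<tau> ^^ k) x \<in> S" if "x \<in> S" for x k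
    using that assms(2) by (induction k) (auto simp: \<sigma>_def bij_betw_def)
  with m show ?thesis by (metis id_apply)
qed

text \<open>Summed over one full period, the differences of \<open>F\<close> telescope to zero,
  because the last point is again the first.\<close>

lemma homomesic_potentialI:
  assumes fin: "finite S" and bij: "bij_betw \<tau> S S"
    and potential: "\<And>x. x \<in> S \<Longrightarrow> f x = c + F (\<tau> x) - F x"
  shows "homomesic S \<tau> f c"
proof -
  define m where "m = bij_order S \<tau>"
  have m: "m > 0" "\<And>x. x \<in> S \<Longrightarrow> (\<tau> ^^ m) x = x"
    using LeastI_ex[OF bij_order_exists[OF fin bij]] unfolding m_def bij_order_def by blast+
  have "1 / real m * (\<Sum>k<m. f ((\<tau> ^^ k) x)) = c" if x: "x \<in> S" for x
  proof -
    have in_S: "(\<tau> ^^ k) x \<in> S" for k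
      by (induction k) (use x bij in \<open>auto simp: bij_betw_def\<close>)
    have "(\<Sum>k<m. f ((\<tau> ^^ k) x)) = (\<Sum>k<m. c + (F ((\<tau> ^^ Suc k) x) - F ((\<tau> ^^ k) x)))"
      by (rule sum.cong) (simp_all add: potential[OF in_S])
    also have "\<dots> = m * c + (F ((\<tau> ^^ m) x) - F x)"
      unfolding sum.distrib using sum_lessThan_telescope[of "\<lambda>k. F ((\<tau> ^^ k) x)" m] by simp
    finally show ?thesis using m x by simp
  qed
  then show ?thesis unfolding homomesic_def m_def using fin bij by blast
qed

section \<open>Heaps of words over a simply laced Cartan matrix\<close>

text \<open>Here \<open>x i\<close> stands for the pairing of \<open>lam\<close> with the coroot of
  \<open>\<alpha> i\<close>, and \<open>a\<close> for the Cartan matrix. \<open>start\<close> is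
  dominance of \<open>lam\<close>; \<open>step\<close> says that each letter meets pairing 1, so
  that its reflection subtracts precisely one simple root; \<open>stop\<close> is antidominance of
  the last weight. Positions in \<open>js\<close> start at 0, heap elements at 1.\<close>

locale minuscule_word =
  fixes N :: "nat set" and a :: "nat \<Rightarrow> nat \<Rightarrow> real" and x :: "nat \<Rightarrow> real" and js :: "nat list"
  assumes finite_N: "finite N" and labels: "set js \<subseteq> N"
    and diag: "i \<in> N \<Longrightarrow> a i i = 2"
    and sym: "i \<in> N \<Longrightarrow> j \<in> N \<Longrightarrow> a i j = a j i"
    and off_diag: "i \<in> N \<Longrightarrow> j \<in> N \<Longrightarrow> i \<noteq> j \<Longrightarrow> a i j = 0 \<or> a i j = -1"
    and start: "i \<in> N \<Longrightarrow> x i \<ge> 0"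
    and step: "k < length js \<Longrightarrow> x (js ! k) - (\<Sum>j<k. a (js ! j) (js ! k)) = 1"
    and stop: "i \<in> N \<Longrightarrow> x i - (\<Sum>j<length js. a (js ! j) i) \<le> 0"
begin

definition "P = heap_carrier js"
abbreviation "l \<equiv> heap_label js"
text \<open>Non-commutation of two simple reflections is expressed by the Cartan entry -1;
  \<open>commute_iff\<close> later identifies the two, and thereby \<open>r\<close> with
  \<open>heap_order\<close>.\<close>

definition "base = {(j, j'). j \<in> P \<and> j' \<in> P \<and> j < j' \<and> a (l j) (l j') = -1}"
definition "r = base\<^sup>*"

text \<open>The pairing of \<open>lam\<close> minus the simple roots labelling \<open>S\<close> with
  the coroot of \<open>i\<close>. \<open>S\<close> is any set, since ideals are compared with
  initial segments of the word, which are used here merely as sets.\<close>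

definition "pairing S i = x i - (\<Sum>j\<in>S. a (l j) i)"

lemma label_in: "p \<in> P \<Longrightarrow> l p \<in> N"
  using labels unfolding P_def heap_carrier_def heap_label_def by (force simp: subset_iff)

lemma P_eq: "P = Suc ` {..<length js}"
  unfolding P_def heap_carrier_def by (simp add: image_Suc_lessThan)

lemma finite_P: "finite P" by (simp add: P_eq)

lemma pairing_before: "p \<in> P \<Longrightarrow> pairing {1..<p} (l p) = 1"
proof -
  assume p: "p \<in> P"
  then obtain k where k: "p = Suc k" "k < length js" by (auto simp: P_eq)
  have "{1..<p} = Suc ` {..<k}" by (auto simp: k image_Suc_lessThan)
  then show ?thesis
    using step[OF k(2)] by (simp add: pairing_def k(1) heap_label_def sum.reindex)
qed

lemma pairing_all: "i \<in> N \<Longrightarrow> pairing P i \<le> 0"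
  using stop by (simp add: pairing_def P_eq heap_label_def sum.reindex)

lemma pairing_empty: "i \<in> N \<Longrightarrow> pairing {} i \<ge> 0"
  by (simp add: pairing_def start)

lemma rel_le: "(p, q) \<in> r \<Longrightarrow> p \<le> q"
  unfolding r_def by (induction rule: rtrancl_induct) (auto simp: base_def)

sublocale finite_poset P r
proof unfold_locales
  show "p = q" if "(p, q) \<in> r" "(q, p) \<in> r" for p q
    using that[THEN rel_le] by simp
qed (auto simp: finite_P r_def)

section \<open>Occurrences of a letter, its neighbours, and the values of the pairing\<close>

definition "Lab i = {p \<in> P. l p = i}"
definition "Nbr i = {p \<in> P. a (l p) i = -1}"

text \<open>An occurrence of \<open>i\<close> costs 2 and a neighbour returns 1, because
  \<open>off_diag\<close> permits no entry below -1. Everything that follows is a comparison of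
  these two counts.\<close>

lemma pairing_eq:
  assumes "S \<subseteq> P" "i \<in> N"
  shows "pairing S i = x i - 2 * card (S \<inter> Lab i) + card (S \<inter> Nbr i)"
proof -
  have fin: "finite S" using assms finite_P finite_subset by blast
  have "(\<Sum>j\<in>S. a (l j) i)
      = (\<Sum>j\<in>S. (if j \<in> Lab i then 2 else 0) - (if j \<in> Nbr i then 1 else 0))"
  proof (rule sum.cong)
    fix j assume "j \<in> S"
    then have "l j \<in> N" "j \<in> P" using assms label_in by auto
    then show "a (l j) i = (if j \<in> Lab i then 2 else 0) - (if j \<in> Nbr i then 1 else 0)"
      using diag off_diag[of "l j" i] assms(2) by (auto simp: Lab_def Nbr_def)
  qed simp
  also have "\<dots> = 2 * real (card (S \<inter> Lab i)) - real (card (S \<inter> Nbr i))"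
    using fin by (simp add: sum_subtractf sum.If_cases Int_def conj_commute)
  finally show ?thesis by (simp add: pairing_def)
qed

lemma Nbr_below: "q \<in> Nbr i \<Longrightarrow> p \<in> Lab i \<Longrightarrow> q < p \<Longrightarrow> (q, p) \<in> base"
  by (auto simp: Nbr_def Lab_def base_def)

lemma Nbr_above: "q \<in> Nbr i \<Longrightarrow> p \<in> Lab i \<Longrightarrow> p < q \<Longrightarrow> (p, q) \<in> base"
  using sym label_in by (auto simp: Nbr_def Lab_def base_def)

lemma base_to_Lab: "(q, p) \<in> base \<Longrightarrow> p \<in> Lab i \<Longrightarrow> q \<in> Nbr i \<and> q < p"
  by (auto simp: Nbr_def Lab_def base_def)

lemma base_from_Lab: "(p, q) \<in> base \<Longrightarrow> p \<in> Lab i \<Longrightarrow> q \<in> Nbr i \<and> p < q"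
  using sym label_in by (auto simp: Nbr_def Lab_def base_def)

text \<open>The pairing with \<open>i\<close> drops from 1 to -1 at an occurrence of \<open>i\<close>, so neighbours of \<open>i\<close> must
  bring it back to 1 before the next occurrence.\<close>

lemma Lab_chain:
  assumes "p \<in> Lab i" "q \<in> Lab i" "p < q"
  shows "(p, q) \<in> r"
proof -
  have P: "p \<in> P" "q \<in> P" and i: "i \<in> N" "l p = i" "l q = i"
    using assms label_in by (auto simp: Lab_def)
  have sub: "{1..<p} \<subseteq> P" "{1..<q} \<subseteq> P" using P by (auto simp: P_def heap_carrier_def)
  have split: "{1..<q} \<inter> A = ({1..<p} \<inter> A) \<union> ({p..<q} \<inter> A)" for A
    using assms(3) P by (auto simp: P_def heap_carrier_def)
  have card: "card ({1..<q} \<inter> A) = card ({1..<p} \<inter> A) + card ({p..<q} \<inter> A)" for A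
    unfolding split by (rule card_Un_disjoint) auto
  have "pairing {1..<p} i = pairing {1..<q} i" using pairing_before P i by metis
  then have "2 * real (card ({p..<q} \<inter> Lab i)) = real (card ({p..<q} \<inter> Nbr i))"
    unfolding pairing_eq[OF sub(1) i(1)] pairing_eq[OF sub(2) i(1)] card by simp
  then have "2 * card ({p..<q} \<inter> Lab i) = card ({p..<q} \<inter> Nbr i)" by linarith
  moreover have "card ({p..<q} \<inter> Lab i) > 0"
    using assms by (auto simp: card_gt_0_iff)
  ultimately obtain z where z: "z \<in> {p..<q} \<inter> Nbr i"
    by (metis card.empty ex_in_conv less_numeral_extra(3) mult_eq_0_iff zero_neq_numeral)
  moreover have "z \<noteq> p" using z i diag by (auto simp: Nbr_def)
  ultimately show ?thesis
    using Nbr_below[of z i q] Nbr_above[of z i p] assms unfolding r_def by auto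
qed

text \<open>If \<open>i\<close> is exhausted in \<open>I\<close>, the rest of \<open>P\<close> can
  only contribute neighbours, so the pairing is at most that of \<open>P\<close>, which is not
  positive. Otherwise let \<open>p\<close> be the first \<open>i\<close> outside \<open>I\<close>.
  Then \<open>I\<close> and \<open>{1..<p}\<close> contain the same occurrences of \<open>i\<close>,
  and all neighbours of \<open>i\<close> in \<open>I\<close> precede \<open>p\<close>, so the
  pairing is 1 minus the number of neighbours before \<open>p\<close> that \<open>I\<close> lacks.
  That number is zero exactly if \<open>p\<close> is minimal in the complement.\<close>

lemma pairing_addable:
  assumes I: "I \<in> \<J>" and i: "i \<in> N"
  shows "pairing I i \<le> 1 \<and>
    (pairing I i = 1 \<longleftrightarrow> (\<exists>q\<in>minimal_elements r (P - I). l q = i))"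
proof (cases "Lab i \<subseteq> I")
  case True
  have IP: "I \<subseteq> P" using I ideal_subset by blast
  have "I \<inter> Lab i = P \<inter> Lab i" using True IP by (auto simp: Lab_def)
  moreover have "card (I \<inter> Nbr i) \<le> card (P \<inter> Nbr i)"
    using IP finite_P by (intro card_mono) auto
  ultimately have "pairing I i \<le> pairing P i" using pairing_eq[OF IP i] pairing_eq[OF order_refl i] by simp
  then have "pairing I i \<le> 0" using pairing_all[OF i] by simp
  moreover have "\<not> (\<exists>q\<in>minimal_elements r (P - I). l q = i)"
    using True by (auto simp: minimal_elements_def Lab_def)
  ultimately show ?thesis by auto
next
  case False
  have IP: "I \<subseteq> P" using I ideal_subset by blast
  define p where "p = (LEAST p. p \<in> Lab i - I)"
  have p: "p \<in> Lab i" "p \<notin> I" using LeastI_ex[of "\<lambda>p. p \<in> Lab i - I"] False unfolding p_def by auto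
  have least: "p \<le> q" if "q \<in> Lab i - I" for q unfolding p_def using that by (rule Least_le)
  have pP: "p \<in> P" "l p = i" using p by (auto simp: Lab_def)
  have sub: "{1..<p} \<subseteq> P" using pP by (auto simp: P_def heap_carrier_def)
  have pos: "q \<ge> 1" if "q \<in> P" for q using that by (auto simp: P_def heap_carrier_def)
  have L: "I \<inter> Lab i = {1..<p} \<inter> Lab i"
  proof (intro equalityI subsetI)
    fix q assume q: "q \<in> I \<inter> Lab i"
    have "\<not> p < q" using q p pP I Lab_chain[of p i q] ideal_down by blast
    moreover have "q \<noteq> p" using p q by auto
    ultimately show "q \<in> {1..<p} \<inter> Lab i" using q IP pos by auto
  next
    fix q assume "q \<in> {1..<p} \<inter> Lab i" then show "q \<in> I \<inter> Lab i" using least[of q] by auto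
  qed
  have "q < p" if "q \<in> I" "q \<in> Nbr i" for q
  proof (rule ccontr)
    assume "\<not> q < p"
    moreover have "q \<noteq> p" using that p by auto
    ultimately have "(p, q) \<in> r" using Nbr_above[OF that(2) p(1)] unfolding r_def by auto
    then show False using ideal_down[OF I that(1) pP(1)] p by blast
  qed
  then have M: "{1..<p} \<inter> Nbr i = (I \<inter> Nbr i) \<union> ({1..<p} \<inter> Nbr i - I)"
    using pos IP by auto
  have "card ({1..<p} \<inter> Nbr i) = card (I \<inter> Nbr i) + card ({1..<p} \<inter> Nbr i - I)"
    by (subst M, rule card_Un_disjoint) (use IP finite_P finite_subset in auto)
  then have eq: "pairing I i = 1 - real (card ({1..<p} \<inter> Nbr i - I))"
    using pairing_eq[OF IP i] pairing_eq[OF sub i] pairing_before[OF pP(1)] L pP by simp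
  have "{1..<p} \<inter> Nbr i - I = {} \<longleftrightarrow> (\<exists>q\<in>minimal_elements r (P - I). l q = i)"
  proof
    assume none: "{1..<p} \<inter> Nbr i - I = {}"
    have "y = p" if y: "y \<in> P - I" "(y, p) \<in> r" for y
    proof (rule ccontr)
      assume "y \<noteq> p"
      \<comment> \<open>The last generating relation on a path into \<open>p\<close> starts at a
        neighbour of \<open>i\<close>, which by assumption already lies in \<open>I\<close>.\<close>
      then obtain z where z: "(y, z) \<in> r" "(z, p) \<in> base"
        using y(2) unfolding r_def by (metis rtranclE)
      then have "z \<in> {1..<p} \<inter> Nbr i"
        using base_to_Lab[OF z(2) p(1)] pos by (auto simp: Nbr_def)
      then have "z \<in> I" using none by auto
      then show False using ideal_down[OF I _ _ z(1)] y by auto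
    qed
    then show "\<exists>q\<in>minimal_elements r (P - I). l q = i"
      using p pP by (auto simp: minimal_elements_def)
  next
    assume "\<exists>q\<in>minimal_elements r (P - I). l q = i"
    then obtain q where q: "q \<in> minimal_elements r (P - I)" "l q = i" by auto
    have "q \<in> Lab i - I" using q by (auto simp: minimal_elements_def Lab_def)
    then have "\<not> p < q" using q p pP Lab_chain[of p i q] by (auto simp: minimal_elements_def)
    then have qp: "q = p" using least[OF \<open>q \<in> Lab i - I\<close>] by simp
    have "z \<in> I" if "z \<in> {1..<p} \<inter> Nbr i" for z
    proof (rule ccontr)
      assume "z \<notin> I"
      moreover have "(z, p) \<in> r" using Nbr_below[of z i p] that p unfolding r_def by auto
      ultimately have "z = p" using q qp that by (auto simp: minimal_elements_def Nbr_def)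
      then show False using that by auto
    qed
    then show "{1..<p} \<inter> Nbr i - I = {}" by auto
  qed
  then show ?thesis using eq by (auto simp: card_eq_0_iff)
qed

text \<open>Dual to \<open>pairing_addable\<close>. Without an \<open>i\<close> in \<open>I\<close>,
  neighbours can only raise the pairing above its initial value, which is nonnegative. Otherwise let
  \<open>p\<close> be the last \<open>i\<close> in \<open>I\<close>: down-closure puts all earlier
  occurrences and neighbours into \<open>I\<close>, and \<open>p\<close> itself lowers the value 1
  to -1, so the pairing is -1 plus the number of neighbours in \<open>I\<close> after
  \<open>p\<close>. Those neighbours are what prevents the removal of \<open>p\<close>.\<close>

lemma pairing_removable:
  assumes I: "I \<in> \<J>" and i: "i \<in> N"
  shows "pairing I i \<ge> -1 \<and>
    (pairing I i = -1 \<longleftrightarrow> (\<exists>q\<in>I. I - {q} \<in> \<J> \<and> l q = i))"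
proof (cases "I \<inter> Lab i = {}")
  case True
  have IP: "I \<subseteq> P" using I ideal_subset by blast
  have "pairing I i \<ge> pairing {} i" using pairing_eq[OF IP i] pairing_eq[OF empty_subsetI i] True by simp
  then have "pairing I i \<ge> 0" using pairing_empty[OF i] by simp
  moreover have "\<not> (\<exists>q\<in>I. I - {q} \<in> \<J> \<and> l q = i)"
    using True IP by (auto simp: Lab_def)
  ultimately show ?thesis by auto
next
  case False
  have IP: "I \<subseteq> P" using I ideal_subset by blast
  then have fin: "finite I" using finite_P finite_subset by blast
  define p where "p = Max (I \<inter> Lab i)"
  have p: "p \<in> Lab i" "p \<in> I" using Max_in[of "I \<inter> Lab i"] False fin unfolding p_def by auto
  have greatest: "q \<le> p" if "q \<in> I \<inter> Lab i" for q unfolding p_def using that fin by simp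
  have pP: "p \<in> P" "l p = i" using p by (auto simp: Lab_def)
  have sub: "{1..<p} \<subseteq> P" using pP by (auto simp: P_def heap_carrier_def)
  have pos: "q \<ge> 1" if "q \<in> P" for q using that by (auto simp: P_def heap_carrier_def)
  have L: "I \<inter> Lab i = insert p ({1..<p} \<inter> Lab i)"
  proof (intro equalityI subsetI)
    fix q assume q: "q \<in> I \<inter> Lab i"
    then show "q \<in> insert p ({1..<p} \<inter> Lab i)" using greatest[OF q] IP pos by force
  next
    fix q assume q: "q \<in> insert p ({1..<p} \<inter> Lab i)"
    show "q \<in> I \<inter> Lab i"
    proof (cases "q = p")
      case False
      then have "q \<in> Lab i" "q < p" using q by auto
      then show ?thesis using Lab_chain[of q i p] p ideal_down[OF I p(2)] by (auto simp: Lab_def)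
    qed (use p in auto)
  qed
  have M: "I \<inter> Nbr i = ({1..<p} \<inter> Nbr i) \<union> (I \<inter> Nbr i \<inter> {p<..})"
  proof (intro equalityI subsetI)
    fix q assume q: "q \<in> I \<inter> Nbr i"
    have "p \<noteq> q" using q pP diag i by (auto simp: Nbr_def)
    then show "q \<in> ({1..<p} \<inter> Nbr i) \<union> (I \<inter> Nbr i \<inter> {p<..})" using q IP pos by auto
  next
    fix q assume q: "q \<in> ({1..<p} \<inter> Nbr i) \<union> (I \<inter> Nbr i \<inter> {p<..})"
    then show "q \<in> I \<inter> Nbr i"
      using Nbr_below[of q i p] p ideal_down[OF I p(2)] unfolding r_def by (auto simp: Nbr_def)
  qed
  have "card (I \<inter> Nbr i) = card ({1..<p} \<inter> Nbr i) + card (I \<inter> Nbr i \<inter> {p<..})"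
    by (subst M, rule card_Un_disjoint) (use fin in auto)
  moreover have "card (I \<inter> Lab i) = Suc (card ({1..<p} \<inter> Lab i))"
    unfolding L by simp
  ultimately have eq: "pairing I i = -1 + card (I \<inter> Nbr i \<inter> {p<..})"
    using pairing_eq[OF IP i] pairing_eq[OF sub i] pairing_before[OF pP(1)] pP by simp
  have "I \<inter> Nbr i \<inter> {p<..} = {} \<longleftrightarrow> (\<exists>q\<in>I. I - {q} \<in> \<J> \<and> l q = i)"
  proof
    assume none: "I \<inter> Nbr i \<inter> {p<..} = {}"
    have "y = p" if y: "y \<in> I" "(p, y) \<in> r" for y
    proof (rule ccontr)
      assume "y \<noteq> p"
      then obtain z where z: "(z, y) \<in> r" "(p, z) \<in> base"
        using y(2) unfolding r_def by (metis converse_rtranclE)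
      have "z \<in> Nbr i" "p < z" using base_from_Lab[OF z(2) p(1)] by auto
      moreover have "z \<in> I" using ideal_down[OF I y(1) _ z(1)] \<open>z \<in> Nbr i\<close> by (auto simp: Nbr_def)
      ultimately show False using none by auto
    qed
    then have "I - {p} \<in> \<J>" using I unfolding order_ideals_def by blast
    then show "\<exists>q\<in>I. I - {q} \<in> \<J> \<and> l q = i" using p pP by blast
  next
    assume "\<exists>q\<in>I. I - {q} \<in> \<J> \<and> l q = i"
    then obtain q where q: "q \<in> I" "I - {q} \<in> \<J>" "l q = i" by auto
    have qL: "q \<in> I \<inter> Lab i" using q IP by (auto simp: Lab_def)
    have "\<not> q < p"
      using Lab_chain[of q i p] p q qL ideal_down[OF q(2), of p q] by (auto simp: Lab_def)
    then have qp: "q = p" using greatest[OF qL] by simp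
    have False if z: "z \<in> I \<inter> Nbr i \<inter> {p<..}" for z
    proof -
      have "(p, z) \<in> r" using Nbr_above[of z i p] z p unfolding r_def by auto
      then show False using ideal_down[OF q(2), of z p] z qp pP by auto
    qed
    then show "I \<inter> Nbr i \<inter> {p<..} = {}" by auto
  qed
  then show ?thesis using eq fin by (auto simp: card_eq_0_iff)
qed

definition "removable I i = card {q \<in> I. I - {q} \<in> \<J> \<and> l q = i}"

text \<open>Two removable elements cannot be comparable, while equally labelled ones always are by
  \<open>Lab_chain\<close>; so the count is at most 1.\<close>

lemma removable_eq:
  assumes I: "I \<in> \<J>" and i: "i \<in> N"
  shows "real (removable I i) = (if pairing I i = -1 then 1 else 0)"
proof -
  let ?R = "{q \<in> I. I - {q} \<in> \<J> \<and> l q = i}"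
  have IP: "I \<subseteq> P" using I ideal_subset by blast
  have unique: "p = q" if "p \<in> ?R" "q \<in> ?R" for p q
  proof -
    have "\<not> p < q" if "p \<in> ?R" "q \<in> ?R" for p q
    proof
      assume "p < q"
      then have "(p, q) \<in> r" using that IP Lab_chain[of p i q] by (auto simp: Lab_def)
      then show False using that IP \<open>p < q\<close> ideal_down[of "I - {p}" q p] by auto
    qed
    then show ?thesis using that by (meson linorder_neqE_nat)
  qed
  show ?thesis
  proof (cases "pairing I i = -1")
    case True
    then obtain q where "q \<in> ?R" using pairing_removable[OF I i] by auto
    then have "?R = {q}" using unique by blast
    then show ?thesis using True by (simp add: removable_def)
  next
    case False
    then have "?R = {}" using pairing_removable[OF I i] by auto
    then show ?thesis using False by (simp only: removable_def) simp
  qed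
qed

lemma removable_rowmotion_eq:
  assumes I: "I \<in> \<J>" and i: "i \<in> N"
  shows "real (removable (fon_der_flaass P r I) i) = (if pairing I i = 1 then 1 else 0)"
proof -
  have "pairing (fon_der_flaass P r I) i = -1 \<longleftrightarrow> pairing I i = 1"
    using pairing_removable[OF rowmotion_ideal i, of I] pairing_addable[OF I i]
      removable_rowmotion_iff[OF I] by blast
  then show ?thesis using removable_eq[OF rowmotion_ideal i, of I] by simp
qed

text \<open>Integrality is inherited from the value 1 before some occurrence of \<open>i\<close>,
  from which the pairing differs by an integer count. If \<open>i\<close> does not occur, the
  pairing grows with the ideal, from a nonnegative value at the empty ideal to a nonpositive one at
  \<open>P\<close>, hence is 0.\<close>

lemma pairing_sign:
  assumes I: "I \<in> \<J>" and i: "i \<in> N"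
  shows "pairing I i \<in> {-1, 0, 1}"
proof -
  have IP: "I \<subseteq> P" using I ideal_subset by blast
  have "pairing I i \<in> \<int>"
  proof (cases "Lab i = {}")
    case True
    have "card (I \<inter> Nbr i) \<le> card (P \<inter> Nbr i)"
      using IP finite_P by (intro card_mono) auto
    then have "pairing {} i \<le> pairing I i" "pairing I i \<le> pairing P i"
      using True pairing_eq[OF IP i] pairing_eq[OF empty_subsetI i] pairing_eq[OF order_refl i]
      by simp_all
    then have "pairing I i = 0" using pairing_empty[OF i] pairing_all[OF i] by simp
    then show ?thesis by simp
  next
    case False
    then obtain p where p: "p \<in> P" "l p = i" by (auto simp: Lab_def)
    have sub: "{1..<p} \<subseteq> P" using p by (auto simp: P_def heap_carrier_def)
    have "x i = 1 + 2 * real (card ({1..<p} \<inter> Lab i)) - real (card ({1..<p} \<inter> Nbr i))"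
      using pairing_before[OF p(1)] pairing_eq[OF sub i] p(2) by simp
    also have "\<dots> \<in> \<int>" by (intro Ints_add Ints_diff Ints_mult) auto
    finally show ?thesis unfolding pairing_eq[OF IP i] by (intro Ints_add Ints_diff Ints_mult) auto
  qed
  then obtain z :: int where z: "pairing I i = of_int z" by (elim Ints_cases)
  then have "-1 \<le> z" "z \<le> 1"
    using pairing_addable[OF I i] pairing_removable[OF I i] by linarith+
  then have "z = -1 \<or> z = 0 \<or> z = 1" by linarith
  then show ?thesis using z by auto
qed

text \<open>The value 1 is recorded by the first count, the value -1 by the second, and the two
  exclude each other.\<close>

lemma pairing_eq_removable:
  assumes I: "I \<in> \<J>" and i: "i \<in> N"
  shows "pairing I i = real (removable (fon_der_flaass P r I) i) - real (removable I i)"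
  using pairing_sign[OF I i] removable_eq[OF I i] removable_rowmotion_eq[OF I i] by auto

text \<open>Every element with the label of \<open>q\<close> is comparable to \<open>q\<close>.
  Those below \<open>q\<close> lie in \<open>I\<close> by minimality of \<open>q\<close> and also in
  the image, which is generated by \<open>q\<close> among others; those above \<open>q\<close> lie
  in neither, since the generators form an antichain. Only \<open>q\<close> is gained.\<close>

lemma card_Lab_rowmotion:
  assumes I: "I \<in> \<J>" and q: "q \<in> minimal_elements r (P - I)"
  shows "card (fon_der_flaass P r I \<inter> Lab (l q)) = Suc (card (I \<inter> Lab (l q)))"
proof -
  have qP: "q \<in> P" "q \<notin> I" using q by (auto simp: minimal_elements_def)
  have "fon_der_flaass P r I \<inter> Lab (l q) = insert q (I \<inter> Lab (l q))"
  proof (intro equalityI subsetI)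
    fix y assume y: "y \<in> fon_der_flaass P r I \<inter> Lab (l q)"
    then obtain m where m: "m \<in> minimal_elements r (P - I)" "(y, m) \<in> r" "y \<in> P" "l y = l q"
      by (auto simp: fon_der_flaass_def Lab_def)
    consider "y = q" | "(y, q) \<in> r" "y \<noteq> q" | "(q, y) \<in> r" "y \<noteq> q"
      using Lab_chain[of y "l q" q] Lab_chain[of q "l q" y] m qP by (force simp: Lab_def)
    then show "y \<in> insert q (I \<inter> Lab (l q))"
    proof cases
      case 2
      then have "y \<in> I" using q m by (auto simp: minimal_elements_def)
      then show ?thesis using m by (simp add: Lab_def)
    next
      case 3
      then have "(q, m) \<in> r" using m trans_rel by blast
      then have "q = m" using m(1) qP by (auto simp: minimal_elements_def)
      then show ?thesis using 3 m antisym_rel by blast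
    qed simp
  next
    fix y assume y: "y \<in> insert q (I \<inter> Lab (l q))"
    have "(y, q) \<in> r" if "y \<noteq> q"
    proof -
      have "\<not> q < y" using y that qP Lab_chain[of q "l q" y] ideal_down[OF I, of y q]
        by (auto simp: Lab_def)
      then show ?thesis using y that qP Lab_chain[of y "l q" q] by (auto simp: Lab_def)
    qed
    then show "y \<in> fon_der_flaass P r I \<inter> Lab (l q)"
      using y q qP refl_rel by (auto simp: fon_der_flaass_def Lab_def)
  qed
  moreover have "finite (I \<inter> Lab (l q))"
    using finite_P by (auto simp: Lab_def intro: finite_subset)
  ultimately show ?thesis using qP by simp
qed

text \<open>Multiplying by the count, which is 0 or 1, covers both cases at once: if no
  \<open>i\<close> was addable, the number of letters \<open>i\<close> may change by any
  amount.\<close>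

lemma removable_coord:
  assumes I: "I \<in> \<J>" and i: "i \<in> N"
  shows "real (removable (fon_der_flaass P r I) i)
      * (real (card (fon_der_flaass P r I \<inter> Lab i)) - real (card (I \<inter> Lab i)))
    = real (removable (fon_der_flaass P r I) i)"
proof (cases "pairing I i = 1")
  case True
  then obtain q where "q \<in> minimal_elements r (P - I)" "l q = i"
    using pairing_addable[OF I i] by auto
  then show ?thesis using card_Lab_rowmotion[OF I] by auto
qed (simp add: removable_rowmotion_eq[OF I i])

lemma sum_removable:
  assumes I: "I \<in> \<J>"
  shows "card {p \<in> P. p \<in> I \<and> toggle P r p I = I - {p}} = (\<Sum>i\<in>N. removable I i)"
proof -
  have IP: "I \<subseteq> P" using I ideal_subset by blast
  then have fin: "finite I" using finite_P finite_subset by blast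
  have "{p \<in> P. p \<in> I \<and> toggle P r p I = I - {p}} = (\<Union>i\<in>N. {q \<in> I. I - {q} \<in> \<J> \<and> l q = i})"
    using toggle_removes_iff[OF I] IP label_in by blast
  also have "card \<dots> = (\<Sum>i\<in>N. removable I i)"
    unfolding removable_def using finite_N fin by (subst card_UN_disjoint) auto
  finally show ?thesis .
qed

section \<open>Coordinates of weights and invariance of the norm\<close>

context
  fixes c :: "nat \<Rightarrow> real"
  assumes coords: "\<And>i. i \<in> N \<Longrightarrow> x i = (\<Sum>j\<in>N. c j * a j i)"
begin

text \<open>The coefficient of \<open>\<alpha> i\<close> in the weight of \<open>I\<close>, where
  \<open>c\<close> holds the coefficients of \<open>lam\<close>.\<close>

definition "coord I i = c i - real (card (I \<inter> Lab i))"

lemma pairing_coord: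
  assumes "I \<subseteq> P" "i \<in> N"
  shows "pairing I i = (\<Sum>j\<in>N. coord I j * a j i)"
proof -
  have fin: "finite I" using assms finite_P finite_subset by blast
  have "(\<Sum>p\<in>I. a (l p) i) = (\<Sum>j\<in>N. \<Sum>p | p \<in> I \<and> l p = j. a (l p) i)"
    using fin finite_N assms label_in by (intro sum.group[symmetric]) auto
  also have "\<dots> = (\<Sum>j\<in>N. real (card (I \<inter> Lab j)) * a j i)"
  proof (rule sum.cong)
    fix j
    have "{p \<in> I. l p = j} = I \<inter> Lab j" using assms by (auto simp: Lab_def)
    then show "(\<Sum>p | p \<in> I \<and> l p = j. a (l p) i) = real (card (I \<inter> Lab j)) * a j i"
      by (simp add: Lab_def)
  qed simp
  finally show ?thesis
    using coords[OF assms(2)] by (simp add: pairing_def coord_def left_diff_distrib sum_subtractf)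
qed

text \<open>Adding an element is a simple reflection of the corresponding weight, so the norm of the
  weight is the same for all ideals.\<close>

lemma norm_const:
  assumes "I \<in> \<J>"
  shows "(\<Sum>i\<in>N. coord I i * pairing I i) = (\<Sum>i\<in>N. c i * x i)"
  using assms
proof (induction "card I" arbitrary: I)
  case 0
  then have "I = {}" using finite_P finite_subset[OF ideal_subset[OF 0(2)]] by simp
  then show ?case by (simp add: coord_def pairing_def)
next
  case (Suc n)
  have IP: "I \<subseteq> P" using Suc.prems ideal_subset by blast
  then have fin: "finite I" using finite_P finite_subset by blast
  have "I \<noteq> {}" using Suc.hyps by auto
  \<comment> \<open>The heap order refines the order of positions, so the last position in
    \<open>I\<close> is a maximal element and can be removed.\<close>
  define p where "p = Max I"
  have p: "p \<in> I" "p \<in> P" using Max_in[OF fin \<open>I \<noteq> {}\<close>] IP unfolding p_def by auto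
  define J k where "J = I - {p}" and "k = l p"
  have k: "k \<in> N" using label_in p unfolding k_def by blast
  have J: "J \<in> \<J>"
  proof -
    have "y = p" if "y \<in> I" "(p, y) \<in> r" for y
      using rel_le[OF that(2)] Max_ge[OF fin that(1)] unfolding p_def by simp
    then show ?thesis using Suc.prems unfolding order_ideals_def J_def by blast
  qed
  have "insert p J = I" using p unfolding J_def by auto
  then have "p \<in> minimal_elements r (P - J)"
    using insert_ideal_iff[OF J, of p] p Suc.prems by (auto simp: J_def)
  then have one: "pairing J k = 1" using pairing_addable[OF J k] unfolding k_def by blast
  have pairI: "pairing I i = pairing J i - a k i" for i
    using fin p sum.remove[of I p "\<lambda>j. a (l j) i"] by (simp add: pairing_def J_def k_def)
  have coordI: "coord I i = coord J i - (if i = k then 1 else 0)" for i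
  proof (cases "i = k")
    case True
    then have "I \<inter> Lab i = insert p (J \<inter> Lab i)" "p \<notin> J \<inter> Lab i"
      using p by (auto simp: J_def Lab_def k_def)
    then show ?thesis using True fin by (simp add: coord_def J_def)
  next
    case False
    then have "I \<inter> Lab i = J \<inter> Lab i" by (auto simp: J_def Lab_def k_def)
    then show ?thesis using False by (simp add: coord_def)
  qed
  have "(\<Sum>i\<in>N. coord I i * pairing I i)
      = (\<Sum>i\<in>N. coord J i * pairing J i) - (\<Sum>i\<in>N. coord J i * a k i)
        - (\<Sum>i\<in>N. if i = k then pairing J i - a k i else 0)"
    unfolding pairI coordI sum_subtractf[symmetric] by (rule sum.cong) (auto simp: algebra_simps)
  also have "(\<Sum>i\<in>N. coord J i * a k i) = pairing J k"
    unfolding pairing_coord[OF ideal_subset[OF J] k] using sym k by (intro sum.cong) auto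
  also have "(\<Sum>i\<in>N. if i = k then pairing J i - a k i else 0) = pairing J k - 2"
    using finite_N k diag by simp
  finally have "(\<Sum>i\<in>N. coord I i * pairing I i) = (\<Sum>i\<in>N. coord J i * pairing J i)"
    using one by simp
  moreover have "card J = n" using Suc.hyps p fin by (simp add: J_def)
  ultimately show ?case using Suc.hyps(1)[of J] J by simp
qed

lemma homomesic_rowmotion:
  "homomesic \<J> (fon_der_flaass P r)
     (\<lambda>I. real (card {p \<in> P. p \<in> I \<and> toggle P r p I = I - {p}})) (\<Sum>i\<in>N. c i * x i)"
proof (rule homomesic_potentialI[OF finite_ideals bij_rowmotion,
      \<comment> \<open>With \<open>d\<close>, \<open>r\<close> the coordinates and counts at
        \<open>I\<close>, and \<open>d'\<close>, \<open>r'\<close> those at its image, the constant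
        is the sum of \<open>(1 + d') r' - d r\<close>. Writing \<open>d r = (1 + d) r - r\<close>
        isolates the sum of the \<open>r\<close>, which is the statistic at \<open>I\<close>, and
        leaves a difference of \<open>F\<close>.\<close>
      where F = "\<lambda>I. - (\<Sum>i\<in>N. (1 + coord I i) * real (removable I i))"])
  fix I assume I: "I \<in> \<J>"
  let ?J = "fon_der_flaass P r I"
  have "(\<Sum>i\<in>N. c i * x i) = (\<Sum>i\<in>N. coord I i * pairing I i)" using norm_const[OF I] by simp
  also have "\<dots> = (\<Sum>i\<in>N. (1 + coord ?J i) * real (removable ?J i) - coord I i * real (removable I i))"
  proof (rule sum.cong)
    fix i assume i: "i \<in> N"
    show "coord I i * pairing I i
      = (1 + coord ?J i) * real (removable ?J i) - coord I i * real (removable I i)"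
      unfolding pairing_eq_removable[OF I i] coord_def
      using removable_coord[OF I i] by (simp add: algebra_simps)
  qed simp
  finally show "real (card {p \<in> P. p \<in> I \<and> toggle P r p I = I - {p}})
      = (\<Sum>i\<in>N. c i * x i) + - (\<Sum>i\<in>N. (1 + coord ?J i) * real (removable ?J i))
        - - (\<Sum>i\<in>N. (1 + coord I i) * real (removable I i))"
    by (simp add: sum_removable[OF I] sum_subtractf algebra_simps sum.distrib)
qed

end

end

section \<open>Traces and commuting diagonalizable maps\<close>

lemma finite_basis:
  assumes "finite_dim TYPE('a::complex_vector)" "cv.independent (B :: 'a set)"
  shows "finite B"
  using assms cv.independent_span_bound unfolding finite_dim_def by blast

lemma clinearD:
  assumes "clinear f"
  shows "f (x + y) = f x + f y" "f (c *\<^sub>C x) = c *\<^sub>C f x"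
proof -
  interpret Vector_Spaces.linear scaleC scaleC f by fact
  show "f (x + y) = f x + f y" "f (c *\<^sub>C x) = c *\<^sub>C f x" by (simp_all add: add scale)
qed

lemma clinear_sum:
  assumes "clinear f"
  shows "f (\<Sum>b\<in>B. c b *\<^sub>C g b) = (\<Sum>b\<in>B. c b *\<^sub>C f (g b))"
proof -
  interpret Vector_Spaces.linear scaleC scaleC f by fact
  show ?thesis by (simp add: sum scale)
qed

lemma clinear_zero: "clinear f \<Longrightarrow> f 0 = 0"
  using clinearD(2)[of f 0 0] by simp

lemma clinear_diff: "clinear f \<Longrightarrow> f (x - y) = f x - f y"
  using clinearD[of f] by (metis add_diff_cancel_right' diff_add_cancel)

lemma clinearI:
  assumes "\<And>x y. f (x + y) = f x + f y" "\<And>c x. f (c *\<^sub>C x) = c *\<^sub>C f x"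
  shows "clinear f"
  by (simp add: Vector_Spaces.linear_iff assms cv.vector_space_axioms)

text \<open>\<open>trace\<close> fixes an unspecified basis; with the basis as a parameter, the
  Killing form can be computed in a basis of weight vectors.\<close>

definition diag_sum :: "'a::complex_vector set \<Rightarrow> ('a \<Rightarrow> 'a) \<Rightarrow> complex" where
  "diag_sum B f = (\<Sum>b\<in>B. cv.representation B (f b) b)"

locale finite_cbasis =
  fixes B :: "'a::complex_vector set"
  assumes finite_B: "finite B" and indep: "cv.independent B" and span: "cv.span B = UNIV"
begin

abbreviation "rep \<equiv> cv.representation B"

lemma rep_sum: "(\<Sum>b\<in>B. rep v b *\<^sub>C b) = v"
  using cv.sum_representation_eq[OF indep _ finite_B, of v] span by simp

lemma rep_linear:
  "rep (u + v) b = rep u b + rep v b" "rep (c *\<^sub>C v) b = c * rep v b"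
  "rep (\<Sum>x\<in>X. g x) b = (\<Sum>x\<in>X. rep (g x) b)"
  using cv.representation_add[OF indep] cv.representation_scale[OF indep]
    cv.representation_sum[OF indep, of X g] span by simp_all

lemma rep_basis: "b \<in> B \<Longrightarrow> b' \<in> B \<Longrightarrow> rep b b' = (if b' = b then 1 else 0)"
  using cv.representation_basis[OF indep] by simp

lemma diag_sum_comp:
  assumes "clinear f"
  shows "diag_sum B (\<lambda>v. f (g v)) = (\<Sum>b\<in>B. \<Sum>c\<in>B. rep (g b) c * rep (f c) b)"
  unfolding diag_sum_def
proof (rule sum.cong)
  fix b
  have "f (g b) = (\<Sum>c\<in>B. rep (g b) c *\<^sub>C f c)"
    using clinear_sum[OF assms, of "rep (g b)" id B] by (simp add: rep_sum)
  then show "rep (f (g b)) b = (\<Sum>c\<in>B. rep (g b) c * rep (f c) b)" by (simp add: rep_linear)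
qed simp

lemma diag_sum_commute:
  assumes "clinear f" "clinear g"
  shows "diag_sum B (\<lambda>v. f (g v)) = diag_sum B (\<lambda>v. g (f v))"
  unfolding diag_sum_comp[OF assms(1)] diag_sum_comp[OF assms(2)]
  by (subst sum.swap) (simp add: mult.commute)

end

text \<open>Expand each vector of \<open>B\<close> in \<open>C\<close> and exchange the sums: the
  remaining \<open>B\<close>-coefficients reassemble \<open>f c\<close>.\<close>

lemma diag_sum_basis_independent:
  fixes f :: "'a::complex_vector \<Rightarrow> 'a"
  assumes "finite_cbasis B" "finite_cbasis C" "clinear f"
  shows "diag_sum B f = diag_sum C f"
proof -
  interpret B: finite_cbasis B by fact
  interpret C: finite_cbasis C by fact
  have "diag_sum B f = (\<Sum>b\<in>B. B.rep (\<Sum>c\<in>C. C.rep b c *\<^sub>C f c) b)"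
    unfolding diag_sum_def
    by (simp add: clinear_sum[OF assms(3), of _ "\<lambda>c. c" C, symmetric] C.rep_sum)
  also have "\<dots> = (\<Sum>b\<in>B. \<Sum>c\<in>C. B.rep (f c) b * C.rep b c)"
    by (simp add: B.rep_linear mult.commute)
  also have "\<dots> = (\<Sum>c\<in>C. C.rep (\<Sum>b\<in>B. B.rep (f c) b *\<^sub>C b) c)"
    by (subst sum.swap) (simp add: C.rep_linear)
  also have "\<dots> = diag_sum C f" by (simp add: diag_sum_def B.rep_sum)
  finally show ?thesis .
qed

lemma trace_eq_diag_sum:
  fixes f :: "'a::complex_vector \<Rightarrow> 'a"
  assumes "finite_cbasis B" "clinear f"
  shows "trace f = diag_sum B f"
proof -
  interpret B: finite_cbasis B by fact
  define C where "C = (SOME B :: 'a set. cv.independent B \<and> cv.span B = UNIV)"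
  have "cv.independent C \<and> cv.span C = UNIV"
    unfolding C_def by (rule someI[of _ B]) (simp add: B.indep B.span)
  moreover then have "finite C"
    using cv.independent_span_bound[OF B.finite_B, of C] B.span by auto
  ultimately have "finite_cbasis C" by unfold_locales auto
  then have "diag_sum C f = diag_sum B f"
    using diag_sum_basis_independent assms by blast
  then show ?thesis by (simp add: trace_def diag_sum_def C_def Let_def)
qed

lemma finite_dim_basis_in:
  fixes X :: "'a::complex_vector set"
  assumes "finite_dim TYPE('a)" "cv.span X = UNIV"
  obtains B where "B \<subseteq> X" "finite_cbasis B"
proof -
  obtain B where B: "B \<subseteq> X" "cv.independent B" "X \<subseteq> cv.span B"
    using cv.maximal_independent_subset[of X] by blast
  then have "cv.span B = UNIV" using assms(2) cv.span_mono cv.span_span by blast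
  with B finite_basis[OF assms(1)] that show thesis by (simp add: finite_cbasis_def)
qed

text \<open>Applying \<open>T\<close> minus \<open>c a\<close> kills the summand \<open>v a\<close>
  and multiplies the others by nonzero scalars, so induction applies to them. Zero vectors are
  allowed, which makes the lemma usable for components of a decomposition.\<close>

lemma eigenvectors_sum_zero:
  assumes T: "clinear T" and "finite A" and "inj_on c A"
    and "\<And>i. i \<in> A \<Longrightarrow> T (v i) = c i *\<^sub>C v i" and "(\<Sum>i\<in>A. v i) = 0" and "i \<in> A"
  shows "v i = 0"
  using assms(2-)
proof (induction A arbitrary: v i rule: finite_induct)
  case (insert a A)
  have "(\<Sum>i\<in>insert a A. T (v i)) = (\<Sum>i\<in>insert a A. c i *\<^sub>C v i)"
    using insert.prems(2) by (intro sum.cong) auto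
  moreover have "T (\<Sum>i\<in>insert a A. v i) = (\<Sum>i\<in>insert a A. T (v i))"
    using clinear_sum[OF T, of "\<lambda>_. 1" v "insert a A"] by (simp add: scaleC_one)
  ultimately have "(\<Sum>i\<in>insert a A. c i *\<^sub>C v i) - c a *\<^sub>C (\<Sum>i\<in>insert a A. v i) = 0"
    using insert.prems clinear_zero[OF T] by simp
  moreover have "(\<Sum>i\<in>insert a A. c i *\<^sub>C v i) - c a *\<^sub>C (\<Sum>i\<in>insert a A. v i)
      = (\<Sum>i\<in>A. (c i - c a) *\<^sub>C v i)"
    using insert.hyps
    by (simp add: cv.scale_right_distrib cv.scale_sum_right cv.scale_left_diff_distrib sum_subtractf)
  moreover have "T ((c i - c a) *\<^sub>C v i) = c i *\<^sub>C (c i - c a) *\<^sub>C v i" if "i \<in> A" for i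
    using insert.prems(2)[of i] that by (simp add: clinearD[OF T] mult.commute)
  ultimately have "(c j - c a) *\<^sub>C v j = 0" if "j \<in> A" for j
    using insert.IH[of "\<lambda>i. (c i - c a) *\<^sub>C v i" j] insert.prems(1) that by auto
  moreover have "c j \<noteq> c a" if "j \<in> A" for j
    using that insert.prems(1) insert.hyps(2) unfolding inj_on_def by blast
  ultimately have zero: "v j = 0" if "j \<in> A" for j using that by force
  then have "v a = 0" using insert.prems(3) insert.hyps by simp
  then show ?case using zero insert.prems(4) by blast
qed simp

text \<open>Makes strings of weight vectors terminate: repeated raising or lowering gives pairwise
  different eigenvalues, so some vector must be zero.\<close>

lemma finitely_many_eigenvalues:
  fixes T :: "'a::complex_vector \<Rightarrow> 'a"
  assumes fd: "finite_dim TYPE('a)" and T: "clinear T"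
    and "\<And>n::nat. T (v n) = c n *\<^sub>C v n" and "inj c"
  shows "\<exists>n. v n = 0"
proof (rule ccontr)
  assume "\<nexists>n. v n = 0"
  then have nz: "v n \<noteq> 0" for n by blast
  have inj: "inj v"
  proof (rule injI)
    fix n m assume "v n = v m"
    then have "c n *\<^sub>C v m = c m *\<^sub>C v m" using assms(3) by metis
    then have "c n = c m" using nz by simp
    then show "n = m" using \<open>inj c\<close> by (simp add: inj_eq)
  qed
  have "cv.independent (range v)"
  proof
    assume "cv.dependent (range v)"
    then obtain t u where t: "finite t" "t \<subseteq> range v" "(\<Sum>x\<in>t. u x *\<^sub>C x) = 0" "\<exists>x\<in>t. u x \<noteq> 0"
      unfolding cv.dependent_explicit by blast
    obtain S where S: "finite S" "t = v ` S" using finite_subset_image[OF t(1,2)] by blast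
    have "(\<Sum>n\<in>S. u (v n) *\<^sub>C v n) = 0"
      using t(3) S sum.reindex[of v S "\<lambda>x. u x *\<^sub>C x"] inj by (simp add: inj_on_def inj_def)
    moreover have "T (u (v n) *\<^sub>C v n) = c n *\<^sub>C u (v n) *\<^sub>C v n" for n
      by (simp add: clinearD[OF T] assms(3) mult.commute)
    ultimately have "u (v n) *\<^sub>C v n = 0" if "n \<in> S" for n
      using eigenvectors_sum_zero[OF T S(1), of c "\<lambda>n. u (v n) *\<^sub>C v n"] that \<open>inj c\<close>
      by (meson inj_on_subset subset_UNIV)
    then show False using t(4) S nz by auto
  qed
  then have "finite (range v)" by (rule finite_basis[OF fd])
  then show False using inj finite_imageD by blast
qed

lemma eigenvector_decomposition:
  assumes "diagonalizable T" "clinear T"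
  shows "\<exists>A u. finite A \<and> v = (\<Sum>i\<in>A. u i) \<and> (\<forall>i\<in>A. T (u i) = i *\<^sub>C u i)"
proof -
  have "v \<in> cv.span {v. \<exists>c. T v = c *\<^sub>C v}" using assms(1) by (simp add: diagonalizable_def)
  then obtain t w where t: "finite t" "t \<subseteq> {v. \<exists>c. T v = c *\<^sub>C v}" "v = (\<Sum>a\<in>t. w a *\<^sub>C a)"
    unfolding cv.span_explicit by blast
  then have "\<forall>a\<in>t. \<exists>c. T a = c *\<^sub>C a" by blast
  then obtain e where e: "\<And>a. a \<in> t \<Longrightarrow> T a = e a *\<^sub>C a" by metis
  define u where "u i = (\<Sum>a | a \<in> t \<and> e a = i. w a *\<^sub>C a)" for i
  have "v = (\<Sum>i\<in>e ` t. u i)"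
    unfolding u_def t(3) using t(1) by (intro sum.group[symmetric]) auto
  moreover have "T (u i) = i *\<^sub>C u i" for i
    unfolding u_def clinear_sum[OF assms(2)] cv.scale_sum_right
    by (rule sum.cong) (auto simp: e mult.commute)
  ultimately show ?thesis using t(1) by blast
qed

text \<open>Split a joint eigenvector of \<open>F\<close> into eigencomponents of the new map
  \<open>T a\<close>. They remain eigenvectors of each \<open>T h\<close>: the deviations
  \<open>w j\<close> are eigenvectors of \<open>T a\<close> for different eigenvalues because the
  maps commute, and they sum to zero, so each vanishes.\<close>

lemma joint_eigenvectors_span:
  fixes T :: "'i \<Rightarrow> 'a::complex_vector \<Rightarrow> 'a"
  assumes "finite F" and "\<And>h. h \<in> F \<Longrightarrow> clinear (T h) \<and> diagonalizable (T h)"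
    and "\<And>h k v. h \<in> F \<Longrightarrow> k \<in> F \<Longrightarrow> T h (T k v) = T k (T h v)"
  shows "cv.span {v. \<forall>h\<in>F. \<exists>c. T h v = c *\<^sub>C v} = UNIV"
  using assms
proof (induction F rule: finite_induct)
  case (insert a F)
  let ?X = "\<lambda>F. {v. \<forall>h\<in>F. \<exists>c. T h v = c *\<^sub>C v}"
  have "?X F \<subseteq> cv.span (?X (insert a F))"
  proof
    fix v assume v: "v \<in> ?X F"
    obtain A u where A: "finite A" "v = (\<Sum>i\<in>A. u i)" "\<And>i. i \<in> A \<Longrightarrow> T a (u i) = i *\<^sub>C u i"
      using eigenvector_decomposition[of "T a" v] insert.prems(1) by blast
    have "u i \<in> ?X (insert a F)" if i: "i \<in> A" for i
    proof -
      have "\<exists>c. T h (u i) = c *\<^sub>C u i" if h: "h \<in> F" for h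
      proof -
        have lin: "clinear (T h)" "clinear (T a)" using insert.prems h by auto
        obtain k where k: "T h v = k *\<^sub>C v" using v h by auto
        define w where "w j = T h (u j) - k *\<^sub>C u j" for j
        have "(\<Sum>j\<in>A. w j) = T h v - k *\<^sub>C v"
          using clinear_sum[OF lin(1), of "\<lambda>_. 1" u A]
          by (simp add: w_def sum_subtractf A(2) cv.scale_sum_right scaleC_one)
        then have "(\<Sum>j\<in>A. w j) = 0" using k by simp
        moreover have "T a (w j) = j *\<^sub>C w j" if "j \<in> A" for j
        proof -
          have "T a (T h (u j)) = j *\<^sub>C T h (u j)"
            using insert.prems(2)[of a h "u j"] h A(3)[OF that] clinearD(2)[OF lin(1)] by auto
          then show ?thesis
            using A(3)[OF that] unfolding w_def
            by (simp add: clinear_diff[OF lin(2)] clinearD(2)[OF lin(2)] cv.scale_right_diff_distrib mult.commute)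
        qed
        ultimately have "w i = 0"
          using eigenvectors_sum_zero[OF lin(2) A(1), of "\<lambda>j. j" w i] i by auto
        then show ?thesis by (auto simp: w_def)
      qed
      then show ?thesis using A(3)[OF i] by blast
    qed
    then show "v \<in> cv.span (?X (insert a F))"
      unfolding A(2) by (intro cv.span_sum cv.span_base)
  qed
  then have "cv.span (?X F) \<subseteq> cv.span (?X (insert a F))"
    by (rule cv.span_minimal[OF _ cv.subspace_span])
  moreover have "cv.span (?X F) = UNIV" using insert.IH insert.prems by simp
  ultimately show ?case by blast
qed simp

section \<open>Weights of representations\<close>

lemma lie_bracket_skew: "lie_bracket y x = - lie_bracket x (y :: 'g::complex_lie_algebra)"
proof -
  have "lie_bracket (x + y) (x + y) = 0" by (rule lie_self)
  then have "lie_bracket x y + lie_bracket y x = 0"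
    by (simp only: lie_add_left lie_add_right) (simp add: lie_self add.commute)
  then show ?thesis by (simp add: add_eq_0_iff)
qed

lemma ad_representation: "lie_representation (lie_bracket :: 'g::complex_lie_algebra \<Rightarrow> 'g \<Rightarrow> 'g)"
proof -
  have neg: "lie_bracket x (- y) = - lie_bracket x y" for x y :: 'g
    using lie_scaleC_right[of x "-1" y] by simp
  have "lie_bracket (lie_bracket x y) v
      = lie_bracket x (lie_bracket y v) - lie_bracket y (lie_bracket x v)" for x y v :: 'g
    using lie_jacobi[of x y v] lie_bracket_skew[of v "lie_bracket x y"]
      lie_bracket_skew[of v x] neg[of y "lie_bracket x v"]
    by (simp add: algebra_simps eq_neg_iff_add_eq_0)
  then show ?thesis
    unfolding lie_representation_def
    by (auto intro!: clinearI simp: lie_add_left lie_add_right lie_scaleC_left lie_scaleC_right)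
qed

lemma repD:
  assumes "lie_representation \<rho>"
  shows "clinear (\<rho> x)" "clinear (\<lambda>x. \<rho> x v)"
    "\<rho> (lie_bracket x y) v = \<rho> x (\<rho> y v) - \<rho> y (\<rho> x v)"
  using assms by (auto simp: lie_representation_def)

lemma ad_linear: "clinear (lie_bracket (x :: 'g::complex_lie_algebra))"
  by (rule repD(1)[OF ad_representation])

lemma weight_shift:
  assumes "lie_representation \<rho>" "x \<in> root_space H \<beta>" "v \<in> weight_space H \<rho> \<mu>"
  shows "\<rho> x v \<in> weight_space H \<rho> (\<mu> + \<beta>)"
  unfolding weight_space_def
proof (intro CollectI ballI)
  fix h assume h: "h \<in> H"
  have "\<rho> h (\<rho> x v) = \<rho> (lie_bracket h x) v + \<rho> x (\<rho> h v)"
    by (simp add: repD(3)[OF assms(1)])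
  also have "\<dots> = \<beta> h *\<^sub>C \<rho> x v + \<mu> h *\<^sub>C \<rho> x v"
    using assms(2,3) h clinearD(2)[OF repD(2)[OF assms(1)]] clinearD(2)[OF repD(1)[OF assms(1)]]
    by (simp add: root_space_def weight_space_def)
  finally show "\<rho> h (\<rho> x v) = (\<mu> + \<beta>) h *\<^sub>C \<rho> x v"
    by (simp add: cv.scale_left_distrib add.commute)
qed

lemma root_space_weight_space: "root_space H \<beta> = weight_space H lie_bracket \<beta>"
  by (simp add: root_space_def weight_space_def)

lemma root_space_add:
  "x \<in> root_space H \<beta> \<Longrightarrow> y \<in> root_space H \<gamma> \<Longrightarrow> lie_bracket x y \<in> root_space H (\<beta> + \<gamma>)"
  using weight_shift[OF ad_representation, of x H \<beta> y \<gamma>]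
  by (simp add: root_space_weight_space add.commute)

lemma dualD:
  assumes "\<phi> \<in> dual H"
  shows "x \<in> H \<Longrightarrow> y \<in> H \<Longrightarrow> \<phi> (x + y) = \<phi> x + \<phi> y" "x \<in> H \<Longrightarrow> \<phi> (c *\<^sub>C x) = c * \<phi> x"
    "x \<notin> H \<Longrightarrow> \<phi> x = 0"
  using assms by (auto simp: dual_def)

lemma dual_apply_zero: "\<phi> \<in> dual H \<Longrightarrow> \<phi> 0 = 0"
  using dualD(2)[of \<phi> H 0 0] dualD(3)[of \<phi> H 0] by fastforce

lemma dual_eqI:
  assumes "\<phi> \<in> dual H" "\<psi> \<in> dual H" "\<And>h. h \<in> H \<Longrightarrow> \<phi> h = \<psi> h"
  shows "\<phi> = \<psi>"
  using assms dualD(3) by (metis ext)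

lemma dual_zero: "0 \<in> dual H" by (simp add: dual_def)

lemma dual_plus: "\<phi> \<in> dual H \<Longrightarrow> \<psi> \<in> dual H \<Longrightarrow> \<phi> + \<psi> \<in> dual H"
  by (auto simp: dual_def algebra_simps)

lemma dual_scale: "\<phi> \<in> dual H \<Longrightarrow> c *\<^sub>F \<phi> \<in> dual H"
  by (auto simp: dual_def scale_fun_def algebra_simps)

lemma dual_uminus: "\<phi> \<in> dual H \<Longrightarrow> - \<phi> \<in> dual H"
  by (auto simp: dual_def)

lemma dual_minus: "\<phi> \<in> dual H \<Longrightarrow> \<psi> \<in> dual H \<Longrightarrow> \<phi> - \<psi> \<in> dual H"
  by (auto simp: dual_def algebra_simps)

text \<open>The \<open>sl\<^sub>2\<close> computation for a highest weight vector \<open>v\<close>; \<open>e\<close>, \<open>f\<close>, \<open>[e, f]\<close> need not be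
  normalised, and \<open>\<beta>([e, f]) = 0\<close> is allowed.\<close>

lemma highest_vector_weight:
  fixes \<rho> :: "'g::complex_lie_algebra \<Rightarrow> 'v::complex_vector \<Rightarrow> 'v"
  assumes rep: "lie_representation \<rho>" and fd: "finite_dim TYPE('v)"
    and h0: "h0 \<in> H" "\<beta> h0 \<noteq> 0"
    and ef: "e \<in> root_space H \<beta>" "f \<in> root_space H (- \<beta>)" "lie_bracket e f \<in> H"
    and v: "v \<in> weight_space H \<rho> \<mu>" "v \<noteq> 0" "\<rho> e v = 0"
  shows "\<exists>n::nat. 2 * \<mu> (lie_bracket e f) = of_nat n * \<beta> (lie_bracket e f)"
proof -
  define h where "h = lie_bracket e f"
  define w where "w n = (\<rho> f ^^ n) v" for n
  have w0: "w 0 = v" and wS: "w (Suc n) = \<rho> f (w n)" for n by (simp_all add: w_def)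
  have wt: "\<rho> k (w n) = (\<mu> k - of_nat n * \<beta> k) *\<^sub>C w n" if "k \<in> H" for n k
  proof -
    have "w n \<in> weight_space H \<rho> (\<lambda>k. \<mu> k - of_nat n * \<beta> k)"
    proof (induction n)
      case 0 then show ?case using v by (simp add: w0)
    next
      case (Suc n)
      have "(\<lambda>k. \<mu> k - of_nat n * \<beta> k) + - \<beta> = (\<lambda>k. \<mu> k - of_nat (Suc n) * \<beta> k)"
        by (auto simp: algebra_simps)
      then show ?case using weight_shift[OF rep ef(2) Suc] by (simp add: wS)
    qed
    then show ?thesis using that by (simp add: weight_space_def)
  qed
  \<comment> \<open>The eigenvalues of \<open>h0\<close>, not of \<open>[e, f]\<close>, separate the
    string, as \<open>\<beta>\<close> might vanish on \<open>[e, f]\<close>.\<close>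
  have "\<exists>n. w n = 0"
  proof (rule finitely_many_eigenvalues[OF fd repD(1)[OF rep] wt[OF h0(1)]])
    show "inj (\<lambda>n. \<mu> h0 - of_nat n * \<beta> h0)" using h0(2) by (auto simp: inj_def)
  qed
  then have "w (LEAST n. w n = 0) = 0" by (rule LeastI_ex)
  moreover obtain n where n: "(LEAST n. w n = 0) = Suc n"
    using calculation v(2) w0 by (metis not0_implies_Suc)
  ultimately have last: "w (Suc n) = 0" "w n \<noteq> 0" using not_less_Least[of n "\<lambda>n. w n = 0"] by auto
  \<comment> \<open>The usual formula for \<open>e f^(m+1) v\<close>, doubled to avoid the
    denominator left by an unnormalised \<open>h\<close>. At the last nonzero vector of the string
    its left side is zero.\<close>
  have "2 *\<^sub>C \<rho> e (w (Suc m)) = (of_nat (Suc m) * (2 * \<mu> h - of_nat m * \<beta> h)) *\<^sub>C w m" for m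
  proof (induction m)
    case 0
    have "\<rho> e (\<rho> f v) = \<rho> h v + \<rho> f (\<rho> e v)" by (simp add: repD(3)[OF rep] h_def)
    then show ?case using wt[of h 0] v(3) ef(3) clinear_zero[OF repD(1)[OF rep]]
      by (simp add: wS w0 h_def)
  next
    case (Suc m)
    have "\<rho> e (w (Suc (Suc m))) = \<rho> h (w (Suc m)) + \<rho> f (\<rho> e (w (Suc m)))"
      by (simp add: repD(3)[OF rep] h_def wS[of "Suc m"])
    then have "2 *\<^sub>C \<rho> e (w (Suc (Suc m)))
        = 2 *\<^sub>C \<rho> h (w (Suc m)) + \<rho> f (2 *\<^sub>C \<rho> e (w (Suc m)))"
      by (simp add: cv.scale_right_distrib clinearD(2)[OF repD(1)[OF rep]])
    also have "\<dots> = (2 * (\<mu> h - of_nat (Suc m) * \<beta> h)) *\<^sub>C w (Suc m)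
        + (of_nat (Suc m) * (2 * \<mu> h - of_nat m * \<beta> h)) *\<^sub>C w (Suc m)"
      using wt[of h "Suc m"] ef(3) Suc
      by (simp add: h_def[symmetric] clinearD(2)[OF repD(1)[OF rep]] wS)
    also have "\<dots> = (of_nat (Suc (Suc m)) * (2 * \<mu> h - of_nat (Suc m) * \<beta> h)) *\<^sub>C w (Suc m)"
      unfolding cv.scale_left_distrib[symmetric] by (simp add: algebra_simps)
    finally show ?case .
  qed
  from this[of n] have "of_nat (Suc n) * (2 * \<mu> h - of_nat n * \<beta> h) = 0"
    using last clinear_zero[OF repD(1)[OF rep]] by (metis cv.scale_eq_0_iff cv.scale_zero_right)
  then have "2 * \<mu> h = of_nat n * \<beta> h" by (metis eq_iff_diff_eq_0 mult_eq_0_iff of_nat_neq_0)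
  then show ?thesis unfolding h_def by blast
qed

text \<open>Raise \<open>v\<close> by \<open>e\<close> until the string ends, after \<open>n\<close>
  steps, and apply \<open>highest_vector_weight\<close> to the weight
  \<open>\<mu> + n \<beta>\<close> found there; the integer is \<open>m - 2 n\<close>.\<close>

lemma weight_half_integral:
  fixes \<rho> :: "'g::complex_lie_algebra \<Rightarrow> 'v::complex_vector \<Rightarrow> 'v"
  assumes rep: "lie_representation \<rho>" and fd: "finite_dim TYPE('v)"
    and h0: "h0 \<in> H" "\<beta> h0 \<noteq> 0"
    and ef: "e \<in> root_space H \<beta>" "f \<in> root_space H (- \<beta>)" "lie_bracket e f \<in> H"
    and v: "v \<in> weight_space H \<rho> \<mu>" "v \<noteq> 0"
  shows "\<exists>z::int. 2 * \<mu> (lie_bracket e f) = of_int z * \<beta> (lie_bracket e f)"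
proof -
  define w where "w n = (\<rho> e ^^ n) v" for n
  have w0: "w 0 = v" and wS: "w (Suc n) = \<rho> e (w n)" for n by (simp_all add: w_def)
  have wt: "w n \<in> weight_space H \<rho> (\<lambda>k. \<mu> k + of_nat n * \<beta> k)" for n
  proof (induction n)
    case 0 then show ?case using v by (simp add: w0)
  next
    case (Suc n)
    have "(\<lambda>k. \<mu> k + of_nat n * \<beta> k) + \<beta> = (\<lambda>k. \<mu> k + of_nat (Suc n) * \<beta> k)"
      by (auto simp: algebra_simps)
    then show ?case using weight_shift[OF rep ef(1) Suc] by (simp add: wS)
  qed
  have "\<exists>n. w n = 0"
  proof (rule finitely_many_eigenvalues[OF fd repD(1)[OF rep]])
    show "\<rho> h0 (w n) = (\<mu> h0 + of_nat n * \<beta> h0) *\<^sub>C w n" for n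
      using wt[of n] h0 by (simp add: weight_space_def)
    show "inj (\<lambda>n. \<mu> h0 + of_nat n * \<beta> h0)" using h0(2) by (auto simp: inj_def)
  qed
  then have "w (LEAST n. w n = 0) = 0" by (rule LeastI_ex)
  moreover obtain n where n: "(LEAST n. w n = 0) = Suc n"
    using calculation v(2) w0 by (metis not0_implies_Suc)
  ultimately have last: "\<rho> e (w n) = 0" "w n \<noteq> 0"
    using not_less_Least[of n "\<lambda>n. w n = 0"] wS by auto
  obtain m :: nat where "2 * (\<mu> (lie_bracket e f) + of_nat n * \<beta> (lie_bracket e f))
      = of_nat m * \<beta> (lie_bracket e f)"
    using highest_vector_weight[OF rep fd h0 ef wt last(2,1)] by blast
  then have "2 * \<mu> (lie_bracket e f) = of_int (int m - 2 * int n) * \<beta> (lie_bracket e f)"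
    by (simp add: algebra_simps)
  then show ?thesis by blast
qed

section \<open>The Killing form and the roots\<close>

locale simple_lie =
  fixes H :: "'g::complex_lie_algebra set"
  assumes simple: "simple_lie_algebra TYPE('g)" and cartan: "cartan_subalgebra H"
begin

lemma fd: "finite_dim TYPE('g)"
  using simple by (simp add: simple_lie_algebra_def)

lemma ideal_trivial: "lie_ideal I \<Longrightarrow> I = {0} \<or> I = (UNIV :: 'g set)"
  using simple by (simp add: simple_lie_algebra_def)

lemma H_subspace: "cv.subspace H"
  using cartan by (simp add: cartan_subalgebra_def)

lemma H_commute: "x \<in> H \<Longrightarrow> y \<in> H \<Longrightarrow> lie_bracket x y = 0"
  using cartan by (simp add: cartan_subalgebra_def)

lemma H_centralizer: "(\<And>h. h \<in> H \<Longrightarrow> lie_bracket h x = 0) \<Longrightarrow> x \<in> H"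
  using cartan by (simp add: cartan_subalgebra_def)

lemmas H_closed = cv.subspace_0[OF H_subspace] cv.subspace_add[OF H_subspace]
  cv.subspace_scale[OF H_subspace] cv.subspace_diff[OF H_subspace] cv.subspace_neg[OF H_subspace]

lemma nonabelian: "\<exists>x y :: 'g. lie_bracket x y \<noteq> 0"
  using simple by (simp add: simple_lie_algebra_def)

text \<open>The centre is an ideal and, as the algebra is not abelian, not the whole of it.\<close>

lemma center_trivial:
  assumes "\<And>y :: 'g. lie_bracket x y = 0"
  shows "x = 0"
proof -
  have "lie_ideal {x :: 'g. \<forall>y. lie_bracket x y = 0}"
    unfolding lie_ideal_def cv.subspace_def
  proof (intro conjI allI ballI impI)
    fix x y assume "y \<in> {x :: 'g. \<forall>y. lie_bracket x y = 0}"
    then have "lie_bracket x y = 0" using lie_bracket_skew[of x y] by simp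
    then show "lie_bracket x y \<in> {x. \<forall>y. lie_bracket x y = 0}"
      by (simp add: clinear_zero[OF repD(2)[OF ad_representation]])
  qed (simp_all add: lie_add_left lie_scaleC_left clinear_zero[OF repD(2)[OF ad_representation]])
  then have "{x :: 'g. \<forall>y. lie_bracket x y = 0} = {0}"
    using ideal_trivial nonabelian by blast
  then show ?thesis using assms by blast
qed

text \<open>If \<open>H\<close> were zero, everything would centralize it and so lie in
  \<open>H\<close>, which is abelian.\<close>

lemma H_nontrivial: "\<exists>h\<in>H. h \<noteq> 0"
proof (rule ccontr)
  assume "\<not> (\<exists>h\<in>H. h \<noteq> 0)"
  then have all: "x \<in> H" for x
    by (intro H_centralizer) (auto simp: clinear_zero[OF repD(2)[OF ad_representation]])
  have "lie_bracket x y = 0" for x y :: 'g by (rule H_commute[OF all all])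
  then show False using nonabelian by blast
qed

lemma root_space_zero: "x \<in> root_space H \<beta> \<Longrightarrow> (\<And>h. h \<in> H \<Longrightarrow> \<beta> h = 0) \<Longrightarrow> x \<in> H"
  by (rule H_centralizer) (simp add: root_space_def)

lemma bracket_opposite: "e \<in> root_space H \<beta> \<Longrightarrow> f \<in> root_space H (- \<beta>) \<Longrightarrow> lie_bracket e f \<in> H"
  using root_space_add[of e H \<beta> f "- \<beta>"] by (auto intro: root_space_zero)

text \<open>Diagonalize simultaneously the commuting maps \<open>ad h\<close> for \<open>h\<close>
  in a finite basis \<open>F\<close> of \<open>H\<close>. Being an eigenvector is a linear condition
  on \<open>h\<close>, so it extends from \<open>F\<close> to \<open>H\<close>, and since
  \<open>b\<close> is nonzero its eigenvalue is a linear functional of \<open>h\<close>.\<close>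

lemma weight_basis_exists:
  "\<exists>B. finite_cbasis B \<and> (\<forall>b\<in>B. \<exists>\<beta>\<in>dual H. b \<in> root_space H \<beta>)"
proof -
  obtain F where F: "F \<subseteq> H" "cv.independent F" "H \<subseteq> cv.span F"
    using cv.maximal_independent_subset[of H] by blast
  let ?X = "{v. \<forall>h\<in>F. \<exists>c. lie_bracket h v = c *\<^sub>C v}"
  have "cv.span ?X = UNIV"
  proof (rule joint_eigenvectors_span)
    show "finite F" using finite_basis[OF fd F(2)] .
    show "clinear (lie_bracket h) \<and> diagonalizable (lie_bracket h)" if "h \<in> F" for h
      using that F(1) cartan ad_linear by (auto simp: cartan_subalgebra_def)
    show "lie_bracket h (lie_bracket k v) = lie_bracket k (lie_bracket h v)"
      if "h \<in> F" "k \<in> F" for h k v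
    proof -
      have "lie_bracket h k = 0" using that F(1) H_commute by blast
      then show ?thesis
        using repD(3)[OF ad_representation, of h k v]
        by (simp add: clinear_zero[OF repD(2)[OF ad_representation]])
    qed
  qed
  then obtain B where B: "B \<subseteq> ?X" "finite_cbasis B" using finite_dim_basis_in[OF fd] by blast
  interpret finite_cbasis B by fact
  have "\<exists>\<beta>\<in>dual H. b \<in> root_space H \<beta>" if b: "b \<in> B" for b
  proof -
    have "b \<noteq> 0" using b indep cv.dependent_zero by blast
    have "cv.subspace {h. \<exists>c. lie_bracket h b = c *\<^sub>C b}"
      unfolding cv.subspace_def
    proof (intro conjI allI impI ballI)
      show "0 \<in> {h. \<exists>c. lie_bracket h b = c *\<^sub>C b}"
        by (auto simp: clinear_zero[OF repD(2)[OF ad_representation]] intro!: exI[of _ 0])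
    next
      fix x y assume "x \<in> {h. \<exists>c. lie_bracket h b = c *\<^sub>C b}" "y \<in> {h. \<exists>c. lie_bracket h b = c *\<^sub>C b}"
      then show "x + y \<in> {h. \<exists>c. lie_bracket h b = c *\<^sub>C b}"
        by (auto simp: lie_add_left scaleC_add_left[symmetric])
    next
      fix c x assume "x \<in> {h. \<exists>c. lie_bracket h b = c *\<^sub>C b}"
      then show "c *\<^sub>C x \<in> {h. \<exists>c. lie_bracket h b = c *\<^sub>C b}"
        by (auto simp: lie_scaleC_left)
    qed
    moreover have "F \<subseteq> {h. \<exists>c. lie_bracket h b = c *\<^sub>C b}" using b B by blast
    ultimately have "\<exists>c. lie_bracket h b = c *\<^sub>C b" if "h \<in> H" for h
      using that F(3) cv.span_minimal by blast
    then obtain \<gamma> where \<gamma>: "\<And>h. h \<in> H \<Longrightarrow> lie_bracket h b = \<gamma> h *\<^sub>C b" by metis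
    \<comment> \<open>Extension by zero, as \<open>dual\<close> prescribes.\<close>
    define \<beta> where "\<beta> h = (if h \<in> H then \<gamma> h else 0)" for h
    have "\<gamma> (x + y) = \<gamma> x + \<gamma> y" if "x \<in> H" "y \<in> H" for x y
    proof -
      have "\<gamma> (x + y) *\<^sub>C b = (\<gamma> x + \<gamma> y) *\<^sub>C b"
        using \<gamma>[of "x + y"] \<gamma>[OF that(1)] \<gamma>[OF that(2)] that H_closed
        by (simp add: lie_add_left scaleC_add_left)
      then show ?thesis using \<open>b \<noteq> 0\<close> by simp
    qed
    moreover have "\<gamma> (c *\<^sub>C x) = c * \<gamma> x" if "x \<in> H" for c x
    proof -
      have "\<gamma> (c *\<^sub>C x) *\<^sub>C b = (c * \<gamma> x) *\<^sub>C b"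
        using \<gamma>[of "c *\<^sub>C x"] \<gamma>[OF that] that H_closed by (metis lie_scaleC_left scaleC_scaleC)
      then show ?thesis using \<open>b \<noteq> 0\<close> by simp
    qed
    ultimately have "\<beta> \<in> dual H" using H_closed by (auto simp: dual_def \<beta>_def)
    moreover have "b \<in> root_space H \<beta>" using \<gamma> by (auto simp: root_space_def \<beta>_def)
    ultimately show ?thesis by blast
  qed
  then show ?thesis using B by blast
qed

text \<open>A basis adapted to the root decomposition. It also contains vectors of weight 0, namely
  those lying in \<open>H\<close>.\<close>

definition "WB = (SOME B. finite_cbasis B \<and> (\<forall>b\<in>B. \<exists>\<beta>\<in>dual H. b \<in> root_space H \<beta>))"
definition "wt b = (SOME \<beta>. \<beta> \<in> dual H \<and> b \<in> root_space H \<beta>)"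

lemma WB: "finite_cbasis WB" "b \<in> WB \<Longrightarrow> \<exists>\<beta>\<in>dual H. b \<in> root_space H \<beta>"
  using someI_ex[OF weight_basis_exists] unfolding WB_def by blast+

sublocale finite_cbasis WB by (rule WB)

lemma wt: "b \<in> WB \<Longrightarrow> wt b \<in> dual H" "b \<in> WB \<Longrightarrow> b \<in> root_space H (wt b)"
  using someI_ex[of "\<lambda>\<beta>. \<beta> \<in> dual H \<and> b \<in> root_space H \<beta>"] WB(2)[of b] unfolding wt_def by blast+

lemma wt_zero: "b \<in> WB \<Longrightarrow> wt b 0 = 0"
  using wt(1) dual_apply_zero by blast

lemma wt_bracket: "b \<in> WB \<Longrightarrow> h \<in> H \<Longrightarrow> lie_bracket h b = wt b h *\<^sub>C b"
  using wt(2) by (simp add: root_space_def)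

lemma WB_nonzero: "b \<in> WB \<Longrightarrow> b \<noteq> 0"
  using indep cv.dependent_zero by blast

lemma rep_bracket:
  assumes "h \<in> H" "b \<in> WB"
  shows "rep (lie_bracket h v) b = wt b h * rep v b"
proof -
  have "lie_bracket h v = (\<Sum>c\<in>WB. rep v c *\<^sub>C lie_bracket h c)"
    using clinear_sum[OF ad_linear, of h "rep v" "\<lambda>c. c" WB] by (simp add: rep_sum)
  also have "\<dots> = (\<Sum>c\<in>WB. (rep v c * wt c h) *\<^sub>C c)"
    using wt_bracket[OF _ assms(1)] by simp
  finally have "rep (lie_bracket h v) b = (\<Sum>c\<in>WB. rep v c * wt c h * rep c b)"
    by (simp add: rep_linear)
  also have "\<dots> = (\<Sum>c\<in>WB. if c = b then wt b h * rep v b else 0)"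
    using rep_basis[OF _ assms(2)] by (intro sum.cong) auto
  finally show ?thesis using assms(2) finite_B by simp
qed

lemma rep_root_space:
  assumes "u \<in> root_space H \<delta>" "b \<in> WB" "rep u b \<noteq> 0" "h \<in> H"
  shows "wt b h = \<delta> h"
proof -
  have "wt b h * rep u b = rep (\<delta> h *\<^sub>C u) b"
    using rep_bracket[OF assms(4,2), of u] assms(1,4) by (simp add: root_space_def)
  then show ?thesis using assms(3) by (simp add: rep_linear)
qed

section \<open>Invariance, orthogonality and nondegeneracy of the Killing form\<close>

lemma killing_diag_sum: "killing x y = diag_sum WB (\<lambda>z. lie_bracket x (lie_bracket y z))"
  unfolding killing_def
proof (rule trace_eq_diag_sum[OF WB(1)])
  show "clinear (\<lambda>z. lie_bracket x (lie_bracket y z))"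
    by (rule clinearI) (simp_all add: lie_add_right lie_scaleC_right)
qed

lemma killing_commute: "killing x y = killing y (x::'g)"
  unfolding killing_diag_sum by (rule diag_sum_commute) (rule ad_linear)+

lemma killing_linear:
  "killing (x + y) z = killing x z + killing y z" "killing (c *\<^sub>C x) z = c * killing x (z::'g)"
  "killing z (x + y) = killing z x + killing z y" "killing z (c *\<^sub>C x) = c * killing z (x::'g)"
proof -
  show *: "killing (x + y) z = killing x z + killing y z" "killing (c *\<^sub>C x) z = c * killing x z" for x y z :: 'g and c
    by (simp_all add: killing_diag_sum diag_sum_def lie_add_left lie_scaleC_left rep_linear
        sum.distrib sum_distrib_left)
  show "killing z (x + y) = killing z x + killing z y" "killing z (c *\<^sub>C x) = c * killing z x"
    using * killing_commute by metis+
qed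

lemma killing_zero: "killing 0 (x::'g) = 0" "killing x (0::'g) = 0"
  using killing_linear(2)[of 0 0 x] killing_linear(4)[of x 0 0] by simp_all

lemma killing_invariant: "killing (lie_bracket x y) z = killing x (lie_bracket y (z::'g))"
proof -
  have diff: "diag_sum WB (\<lambda>v. f v - g v) = diag_sum WB f - diag_sum WB g" for f g :: "'g \<Rightarrow> 'g"
  proof -
    have "rep (f b - g b) b = rep (f b) b - rep (g b) b" for b
      using rep_linear(1)[of "f b - g b" "g b" b] by simp
    then show ?thesis by (simp add: diag_sum_def sum_subtractf)
  qed
  have "diag_sum WB (\<lambda>v. lie_bracket y (lie_bracket x (lie_bracket z v)))
      = diag_sum WB (\<lambda>v. lie_bracket x (lie_bracket z (lie_bracket y v)))"
    by (rule diag_sum_commute[OF ad_linear])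
      (auto intro!: clinearI simp: lie_add_right lie_scaleC_right)
  then show ?thesis
    unfolding killing_diag_sum repD(3)[OF ad_representation] clinear_diff[OF ad_linear] diff by simp
qed

lemma killing_H:
  assumes "h \<in> H" "h' \<in> H"
  shows "killing h h' = (\<Sum>b\<in>WB. wt b h * wt b h')"
  unfolding killing_diag_sum diag_sum_def using assms
  by (intro sum.cong) (auto simp: wt_bracket lie_scaleC_right rep_linear rep_basis mult.commute)

text \<open>The composite of \<open>ad x\<close> and \<open>ad y\<close> shifts every weight by the
  nonzero sum of \<open>\<beta>\<close> and \<open>\<gamma>\<close>, so its diagonal entries
  vanish.\<close>

lemma killing_orthogonal:
  assumes "x \<in> root_space H \<beta>" "y \<in> root_space H \<gamma>" "h \<in> H" "\<beta> h + \<gamma> h \<noteq> 0"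
  shows "killing x y = 0"
  unfolding killing_diag_sum diag_sum_def
proof (rule sum.neutral, rule ballI)
  fix b assume b: "b \<in> WB"
  have "lie_bracket x (lie_bracket y b) \<in> root_space H (\<beta> + (\<gamma> + wt b))"
    using root_space_add assms(1,2) wt(2)[OF b] by blast
  from rep_root_space[OF this b _ assms(3)] show "rep (lie_bracket x (lie_bracket y b)) b = 0"
    using assms(4) by (auto simp: algebra_simps)
qed

lemma H_zeroI:
  assumes "h \<in> H" "\<And>b. b \<in> WB \<Longrightarrow> wt b h = 0"
  shows "h = 0"
proof (rule center_trivial)
  fix v
  have "lie_bracket h v = (\<Sum>c\<in>WB. rep v c *\<^sub>C lie_bracket h c)"
    using clinear_sum[OF ad_linear, of h "rep v" "\<lambda>c. c" WB] by (simp add: rep_sum)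
  then show "lie_bracket h v = 0" using assms wt_bracket by simp
qed

lemma brackets_span: "cv.span {lie_bracket x y | x y :: 'g. True} = UNIV"
proof -
  let ?S = "{lie_bracket x y | x y :: 'g. True}"
  have "lie_ideal (cv.span ?S)"
    unfolding lie_ideal_def by (auto intro: cv.span_base)
  moreover have "cv.span ?S \<noteq> {0}"
    using nonabelian cv.span_base[of _ ?S] by blast
  ultimately show ?thesis using ideal_trivial by blast
qed

lemma wt_half_integral:
  assumes "\<beta> h0 \<noteq> 0" "h0 \<in> H" "e \<in> root_space H \<beta>" "f \<in> root_space H (- \<beta>)" "b \<in> WB"
  shows "\<exists>z::int. 2 * wt b (lie_bracket e f) = of_int z * \<beta> (lie_bracket e f)"
  using weight_half_integral[OF ad_representation fd assms(2,1,3,4) bracket_opposite[OF assms(3,4)]]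
    wt(2)[OF assms(5)] WB_nonzero[OF assms(5)] root_space_weight_space by blast

text \<open>These elements form a real subspace of \<open>H\<close>, a stand-in for the real span of
  the coroots before the coroots are available.\<close>

definition "coroot_like h \<longleftrightarrow> h \<in> H \<and> (\<forall>b\<in>WB. wt b h \<in> \<real>)"

text \<open>On \<open>h = [b, b']\<close> every weight is a half-integral multiple of
  \<open>wt b h\<close>. If that value is nonzero, rescaling it to 2 makes all weights integral; if
  it is zero, all weights vanish on \<open>h\<close> and \<open>h = 0\<close>. If both vectors have
  weight 0, they lie in \<open>H\<close> and commute.\<close>

lemma bracket_coroot_like:
  assumes b: "b \<in> WB" "b' \<in> WB" "\<And>h. h \<in> H \<Longrightarrow> wt b h + wt b' h = 0"
  shows "\<exists>c h. coroot_like h \<and> lie_bracket b b' = c *\<^sub>C h"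
proof (cases "\<exists>h0\<in>H. wt b h0 \<noteq> 0")
  case True
  then obtain h0 where h0: "h0 \<in> H" "wt b h0 \<noteq> 0" by blast
  have "wt b' = - wt b"
    using wt(1) b by (intro dual_eqI[of _ H]) (auto simp: dual_uminus add_eq_0_iff)
  then have b': "b' \<in> root_space H (- wt b)" using wt(2)[OF b(2)] by simp
  note rs = wt(2)[OF b(1)] b'
  define h where "h = lie_bracket b b'"
  have hH: "h \<in> H" unfolding h_def by (rule bracket_opposite[OF rs])
  have half: "\<exists>z::int. 2 * wt c h = of_int z * wt b h" if "c \<in> WB" for c
    unfolding h_def by (rule wt_half_integral[of _ h0]) (use h0 rs that in auto)
  show ?thesis
  proof (cases "wt b h = 0")
    case True
    then have "h = 0" using half by (intro H_zeroI[OF hH]) auto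
    then show ?thesis unfolding h_def using H_closed wt_zero
      by (intro exI[of _ 0] exI[of _ 0]) (auto simp: coroot_like_def)
  next
    case False
    have "coroot_like ((2 / wt b h) *\<^sub>C h)"
      unfolding coroot_like_def
    proof (intro conjI ballI)
      show "(2 / wt b h) *\<^sub>C h \<in> H" using hH H_closed by blast
      fix c assume c: "c \<in> WB"
      obtain z :: int where "2 * wt c h = of_int z * wt b h" using half[OF c] by blast
      then have "wt c ((2 / wt b h) *\<^sub>C h) = of_int z"
        using False dualD(2)[OF wt(1)[OF c] hH] by (simp add: field_simps)
      then show "wt c ((2 / wt b h) *\<^sub>C h) \<in> \<real>" by simp
    qed
    moreover have "lie_bracket b b' = (wt b h / 2) *\<^sub>C (2 / wt b h) *\<^sub>C h"
      using False by (simp add: h_def)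
    ultimately show ?thesis by blast
  qed
next
  case False
  then have "b \<in> H" "b' \<in> H"
    using b(3) root_space_zero[OF wt(2)[OF b(1)]] root_space_zero[OF wt(2)[OF b(2)]] by auto
  then have "lie_bracket b b' = 0" by (rule H_commute)
  then show ?thesis using H_closed wt_zero
    by (intro exI[of _ 0] exI[of _ 0]) (auto simp: coroot_like_def)
qed

text \<open>Since \<open>[g, g] = g\<close>, taking components of weight 0 shows that the brackets of opposite root
  vectors span \<open>H\<close>.\<close>

lemma H_span_coroot_like: "H \<subseteq> cv.span {h. coroot_like h}"
proof
  fix x assume x: "x \<in> H"
  let ?B0 = "{b \<in> WB. \<forall>h\<in>H. wt b h = 0}"
  \<comment> \<open>The projection to the weight space 0 along the other root spaces. Among brackets
    of basis vectors only those with opposite weights survive it.\<close>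
  define pr where "pr v = (\<Sum>b\<in>?B0. rep v b *\<^sub>C b)" for v
  have pr_lin: "clinear pr"
    by (rule clinearI) (simp_all add: pr_def rep_linear cv.scale_left_distrib sum.distrib cv.scale_sum_right)
  have pr_eq: "pr u = (if \<forall>h\<in>H. \<delta> h = 0 then u else 0)" if u: "u \<in> root_space H \<delta>" for u \<delta>
  proof (cases "\<forall>h\<in>H. \<delta> h = 0")
    case True
    have "pr u = (\<Sum>b\<in>WB. rep u b *\<^sub>C b)"
      unfolding pr_def using rep_root_space[OF u] True finite_B
      by (intro sum.mono_neutral_left) auto
    then show ?thesis using True by (simp add: rep_sum)
  next
    case False
    then have "rep u b = 0" if "b \<in> ?B0" for b using rep_root_space[OF u, of b] that by fastforce
    then have "pr u = 0" by (simp add: pr_def)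
    then show ?thesis using False by presburger
  qed
  have "pr (lie_bracket u v) \<in> cv.span {h. coroot_like h}" for u v
  proof -
    have v: "lie_bracket u v = (\<Sum>b\<in>WB. rep v b *\<^sub>C lie_bracket u b)"
      using clinear_sum[OF ad_linear, of u "rep v" "\<lambda>c. c" WB] by (simp add: rep_sum)
    have u: "lie_bracket u b = (\<Sum>c\<in>WB. rep u c *\<^sub>C lie_bracket c b)" for b
      using clinear_sum[OF repD(2)[OF ad_representation, of b], of "rep u" "\<lambda>c. c" WB]
      by (simp add: rep_sum)
    have "pr (lie_bracket u v)
        = (\<Sum>b\<in>WB. rep v b *\<^sub>C (\<Sum>c\<in>WB. rep u c *\<^sub>C pr (lie_bracket c b)))"
      unfolding v unfolding u unfolding clinear_sum[OF pr_lin] ..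
    moreover have "pr (lie_bracket c b) \<in> cv.span {h. coroot_like h}" if bc: "b \<in> WB" "c \<in> WB" for b c
    proof (cases "\<forall>h\<in>H. wt c h + wt b h = 0")
      case True
      then obtain k h where "coroot_like h" "lie_bracket c b = k *\<^sub>C h"
        using bracket_coroot_like[of c b] bc True by blast
      moreover have "pr (lie_bracket c b) = lie_bracket c b"
        using pr_eq[OF root_space_add[OF wt(2) wt(2)]] bc True by simp
      ultimately show ?thesis by (simp add: cv.span_base cv.span_scale)
    next
      case False
      then have "pr (lie_bracket c b) = 0"
        using pr_eq[OF root_space_add[OF wt(2) wt(2)], of c b] bc by auto
      then show ?thesis by (simp add: cv.span_zero)
    qed
    ultimately show ?thesis by (auto intro!: cv.span_sum cv.span_scale)
  qed
  moreover have "cv.subspace {v. pr v \<in> cv.span {h. coroot_like h}}"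
    unfolding cv.subspace_def
    by (auto simp: clinearD[OF pr_lin] clinear_zero[OF pr_lin]
        intro: cv.span_add cv.span_scale cv.span_zero)
  ultimately have "cv.span {lie_bracket x y | x y. True} \<subseteq> {v. pr v \<in> cv.span {h. coroot_like h}}"
    by (intro cv.span_minimal) auto
  then have "pr x \<in> cv.span {h. coroot_like h}" using brackets_span by blast
  moreover have "pr x = x"
    using pr_eq[of x 0] x H_commute by (simp add: root_space_def)
  ultimately show "x \<in> cv.span {h. coroot_like h}" by simp
qed

text \<open>Conjugate the coefficients of \<open>h\<close> in a spanning family on which all weights
  are real.\<close>

lemma exists_conjugate:
  assumes "h \<in> H"
  shows "\<exists>k\<in>H. \<forall>b\<in>WB. wt b k = cnj (wt b h)"
proof -
  have "h \<in> cv.span {h. coroot_like h}" using assms H_span_coroot_like by blast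
  then have "h \<in> H \<and> (\<exists>k\<in>H. \<forall>b\<in>WB. wt b k = cnj (wt b h))"
  proof (induction rule: cv.span_induct_alt)
    case base
    show ?case using H_closed wt_zero by (intro conjI bexI[of _ 0]) auto
  next
    case (step c x y)
    then obtain k where k: "k \<in> H" "\<And>b. b \<in> WB \<Longrightarrow> wt b k = cnj (wt b y)" and y: "y \<in> H" by blast
    have x: "x \<in> H" "\<And>b. b \<in> WB \<Longrightarrow> cnj (wt b x) = wt b x"
      using step.hyps by (auto simp: coroot_like_def Reals_cnj_iff)
    have cl: "c *\<^sub>C x \<in> H" "cnj c *\<^sub>C x \<in> H" "c *\<^sub>C x + y \<in> H" "cnj c *\<^sub>C x + k \<in> H"
      using H_closed x k y by auto
    have "wt b (cnj c *\<^sub>C x + k) = cnj (wt b (c *\<^sub>C x + y))" if "b \<in> WB" for b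
      using that x k y cl wt(1)[OF that] by (simp add: dualD)
    then show ?case using cl by blast
  qed
  then show ?thesis by blast
qed

text \<open>The Killing product of \<open>h\<close> with its conjugate is the sum of the squared
  moduli of \<open>wt b h\<close>.\<close>

lemma killing_nondegenerate_H:
  assumes "h \<in> H" "\<And>k. k \<in> H \<Longrightarrow> killing h k = 0"
  shows "h = 0"
proof (rule H_zeroI[OF assms(1)])
  obtain k where k: "k \<in> H" "\<And>b. b \<in> WB \<Longrightarrow> wt b k = cnj (wt b h)"
    using exists_conjugate[OF assms(1)] by blast
  have "killing h k = (\<Sum>b\<in>WB. of_real ((cmod (wt b h))\<^sup>2))"
    unfolding killing_H[OF assms(1) k(1)] using k(2)
    by (intro sum.cong) (simp_all add: complex_norm_square[symmetric])
  then have "(\<Sum>b\<in>WB. (cmod (wt b h))\<^sup>2) = 0"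
    using assms(2)[OF k(1)] by (metis of_real_eq_0_iff of_real_sum)
  then show "wt b h = 0" if "b \<in> WB" for b
    using that finite_B by (simp add: sum_nonneg_eq_0_iff)
qed

text \<open>By invariance the radical is an ideal, and a proper one because the form is
  nondegenerate on the nonzero space \<open>H\<close>.\<close>

lemma killing_nondegenerate:
  assumes "\<And>y. killing x y = 0"
  shows "x = (0::'g)"
proof -
  let ?R = "{x :: 'g. \<forall>y. killing x y = 0}"
  have "lie_ideal ?R"
    unfolding lie_ideal_def cv.subspace_def
  proof (intro conjI allI ballI impI)
    fix x y assume "y \<in> ?R"
    then have "killing (lie_bracket y x) z = 0" for z using killing_invariant by simp
    then show "lie_bracket x y \<in> ?R"
      using lie_bracket_skew[of x y] killing_linear(2)[of "-1" "lie_bracket y x"] by simp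
  qed (simp_all add: killing_linear killing_zero)
  moreover have "?R \<noteq> UNIV" using killing_nondegenerate_H H_nontrivial by blast
  ultimately have "?R = {0}" using ideal_trivial by blast
  then show ?thesis using assms by blast
qed

lemma root_not_zero:
  assumes "\<beta> \<in> roots H"
  shows "\<beta> \<in> dual H" "\<exists>h\<in>H. \<beta> h \<noteq> 0" "\<exists>e\<in>root_space H \<beta>. e \<noteq> 0"
proof -
  show \<beta>: "\<beta> \<in> dual H" using assms by (simp add: roots_def)
  then show "\<exists>h\<in>H. \<beta> h \<noteq> 0"
    using assms dual_eqI[OF \<beta> dual_zero] by (auto simp: roots_def)
  have "0 \<in> root_space H \<beta>"
    by (simp add: root_space_def clinear_zero[OF ad_linear])
  then show "\<exists>e\<in>root_space H \<beta>. e \<noteq> 0" using assms by (auto simp: roots_def)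
qed

text \<open>Some basis vector pairs nontrivially with \<open>e\<close>, and by orthogonality its
  weight is \<open>- \<beta>\<close>. Scaled so that \<open>killing e f = 1\<close>, it makes
  \<open>[e, f]\<close> represent \<open>\<beta>\<close>, by invariance.\<close>

lemma root_vectors:
  assumes "\<beta> \<in> roots H"
  shows "\<exists>e f. e \<in> root_space H \<beta> \<and> f \<in> root_space H (- \<beta>) \<and>
    (\<forall>h\<in>H. killing (lie_bracket e f) h = \<beta> h)"
proof -
  obtain e where e: "e \<in> root_space H \<beta>" "e \<noteq> 0" using root_not_zero[OF assms] by blast
  have "\<exists>b\<in>WB. killing e b \<noteq> 0"
  proof (rule ccontr)
    assume *: "\<not> (\<exists>b\<in>WB. killing e b \<noteq> 0)"
    \<comment> \<open>Multiplying the functional by the nonzero vector \<open>e\<close> makes it an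
      endomorphism, to which \<open>clinear_sum\<close> applies.\<close>
    have lin: "clinear (\<lambda>y. killing e y *\<^sub>C e)"
      by (rule clinearI) (simp_all add: killing_linear scaleC_add_left)
    have "killing e y *\<^sub>C e = 0" for y
      using clinear_sum[OF lin, of "rep y" "\<lambda>b. b" WB] * by (simp add: rep_sum)
    then show False using killing_nondegenerate[of e] e(2) by simp
  qed
  then obtain b where b: "b \<in> WB" "killing e b \<noteq> 0" by blast
  then have "\<beta> h + wt b h = 0" if "h \<in> H" for h
    using killing_orthogonal[OF e(1) wt(2)[OF b(1)] that] by blast
  then have "wt b = - \<beta>"
    using root_not_zero(1)[OF assms] wt(1)[OF b(1)]
    by (intro dual_eqI[of _ H]) (auto simp: dual_uminus add_eq_0_iff)
  then have b': "b \<in> root_space H (- \<beta>)" using wt(2)[OF b(1)] by simp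
  define f where "f = (1 / killing e b) *\<^sub>C b"
  have f: "f \<in> root_space H (- \<beta>)"
    using b' by (auto simp: f_def root_space_def lie_scaleC_right mult.commute)
  have "killing (lie_bracket e f) h = \<beta> h" if h: "h \<in> H" for h
  proof -
    have "lie_bracket f h = \<beta> h *\<^sub>C f"
      using f h lie_bracket_skew[of f h] by (simp add: root_space_def)
    then have "killing (lie_bracket e f) h = \<beta> h * killing e f"
      by (simp add: killing_invariant killing_linear)
    then show ?thesis using b(2) by (simp add: f_def killing_linear)
  qed
  then show ?thesis using e f by blast
qed

section \<open>The inner product on the real span of the roots\<close>

abbreviation "\<V> \<equiv> real_dual H"
abbreviation "kd \<equiv> killing_dual H"

lemma kd_unique:
  assumes "t \<in> H" "\<And>h. h \<in> H \<Longrightarrow> killing t h = \<phi> h"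
  shows "kd \<phi> = t"
  unfolding killing_dual_def
proof (rule the_equality)
  fix s assume s: "s \<in> H \<and> (\<forall>h\<in>H. killing s h = \<phi> h)"
  have "s - t = 0"
  proof (rule killing_nondegenerate_H)
    show "s - t \<in> H" using s assms H_closed by blast
    show "killing (s - t) k = 0" if "k \<in> H" for k
      using s assms that killing_linear(1)[of "s - t" t k] by simp
  qed
  then show "s = t" by simp
qed (use assms in blast)

lemma real_dual_closed:
  "0 \<in> \<V>" "\<phi> \<in> \<V> \<Longrightarrow> \<psi> \<in> \<V> \<Longrightarrow> \<phi> + \<psi> \<in> \<V>" "\<phi> \<in> \<V> \<Longrightarrow> \<psi> \<in> \<V> \<Longrightarrow> \<phi> - \<psi> \<in> \<V>"
  "\<phi> \<in> \<V> \<Longrightarrow> r *\<^sub>F \<phi> \<in> \<V>" "\<phi> \<in> \<V> \<Longrightarrow> - \<phi> \<in> \<V>" "\<phi> \<in> roots H \<Longrightarrow> \<phi> \<in> \<V>"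
  unfolding real_dual_def
  by (auto intro: rf.span_zero rf.span_add rf.span_diff rf.span_scale rf.span_neg rf.span_base)

text \<open>Existence passes through real linear combinations, and for a single root the bracket
  from \<open>root_vectors\<close> is the representing element.\<close>

lemma kd:
  assumes "\<phi> \<in> \<V>"
  shows "\<phi> \<in> dual H" "kd \<phi> \<in> H" "h \<in> H \<Longrightarrow> killing (kd \<phi>) h = \<phi> h"
proof -
  have "\<phi> \<in> dual H \<and> (\<exists>t\<in>H. \<forall>h\<in>H. killing t h = \<phi> h)"
    using assms unfolding real_dual_def
  proof (induction rule: rf.span_induct_alt)
    case base
    show ?case using H_closed dual_zero[of H, unfolded zero_fun_def]
      by (auto simp: killing_zero zero_fun_def intro!: bexI[of _ 0])
  next
    case (step c \<beta> \<psi>)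
    then obtain t where t: "t \<in> H" "\<And>h. h \<in> H \<Longrightarrow> killing t h = \<psi> h" by blast
    obtain e f where ef: "e \<in> root_space H \<beta>" "f \<in> root_space H (- \<beta>)"
      "\<And>h. h \<in> H \<Longrightarrow> killing (lie_bracket e f) h = \<beta> h"
      using root_vectors[OF step.hyps(1)] by blast
    have "of_real c *\<^sub>C lie_bracket e f + t \<in> H"
      using bracket_opposite[OF ef(1,2)] t H_closed by blast
    moreover have "killing (of_real c *\<^sub>C lie_bracket e f + t) h = (c *\<^sub>F \<beta> + \<psi>) h" if "h \<in> H" for h
      using that ef t by (simp add: killing_linear scale_fun_def)
    moreover have "c *\<^sub>F \<beta> + \<psi> \<in> dual H"
      using step root_not_zero(1) by (intro dual_plus dual_scale) auto
    ultimately have "c *\<^sub>F \<beta> + \<psi> \<in> dual H \<and>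
      (\<exists>t\<in>H. \<forall>h\<in>H. killing t h = (c *\<^sub>F \<beta> + \<psi>) h)" by blast
    then show ?case by (simp only: plus_fun_def)
  qed
  then obtain t where "\<phi> \<in> dual H" "t \<in> H" "\<And>h. h \<in> H \<Longrightarrow> killing t h = \<phi> h" by blast
  moreover then have "kd \<phi> = t" by (intro kd_unique)
  ultimately show "\<phi> \<in> dual H" "kd \<phi> \<in> H" "h \<in> H \<Longrightarrow> killing (kd \<phi>) h = \<phi> h" by auto
qed

lemma kd_linear:
  assumes "\<phi> \<in> \<V>" "\<psi> \<in> \<V>"
  shows "kd (\<phi> + \<psi>) = kd \<phi> + kd \<psi>" "kd (r *\<^sub>F \<phi>) = of_real r *\<^sub>C kd \<phi>"
  using assms H_closed by (auto intro!: kd_unique simp: kd killing_linear scale_fun_def)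

lemma kd_root:
  assumes "\<beta> \<in> roots H"
  shows "\<exists>e f. e \<in> root_space H \<beta> \<and> f \<in> root_space H (- \<beta>) \<and> kd \<beta> = lie_bracket e f"
proof -
  obtain e f where ef: "e \<in> root_space H \<beta>" "f \<in> root_space H (- \<beta>)"
    "\<And>h. h \<in> H \<Longrightarrow> killing (lie_bracket e f) h = \<beta> h"
    using root_vectors[OF assms(1)] by blast
  then show ?thesis using kd_unique[OF bracket_opposite[OF ef(1,2)]] by blast
qed

lemma weights_iff:
  assumes "lie_representation \<rho>"
  shows "\<mu> \<in> weights H \<rho> \<longleftrightarrow> \<mu> \<in> dual H \<and> (\<exists>v\<in>weight_space H \<rho> \<mu>. v \<noteq> 0)"
proof -
  have "0 \<in> weight_space H \<rho> \<mu>"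
    by (simp add: weight_space_def clinear_zero[OF repD(1)[OF assms]])
  then show ?thesis by (auto simp: weights_def)
qed

lemma weight_half_integral_root:
  fixes \<rho> :: "'g \<Rightarrow> 'v::complex_vector \<Rightarrow> 'v"
  assumes "lie_representation \<rho>" "finite_dim TYPE('v)" "v \<in> weight_space H \<rho> \<mu>" "v \<noteq> 0" "\<beta> \<in> roots H"
  shows "\<exists>z::int. 2 * \<mu> (kd \<beta>) = of_int z * \<beta> (kd \<beta>)"
proof -
  obtain e f where ef: "e \<in> root_space H \<beta>" "f \<in> root_space H (- \<beta>)" "kd \<beta> = lie_bracket e f"
    using kd_root[OF assms(5)] by blast
  obtain h0 where "h0 \<in> H" "\<beta> h0 \<noteq> 0" using root_not_zero(2)[OF assms(5)] by blast
  then show ?thesis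
    unfolding ef(3)
    using weight_half_integral[OF assms(1,2) _ _ ef(1,2) bracket_opposite[OF ef(1,2)] assms(3,4)]
    by blast
qed

lemma wt_half_integral_root:
  "\<beta> \<in> roots H \<Longrightarrow> b \<in> WB \<Longrightarrow> \<exists>z::int. 2 * wt b (kd \<beta>) = of_int z * \<beta> (kd \<beta>)"
  using weight_half_integral_root[OF ad_representation fd, of b "wt b"] wt(2) WB_nonzero
    root_space_weight_space by blast

text \<open>Every weight takes on \<open>kd \<beta>\<close> a half-integral multiple of
  \<open>\<beta> (kd \<beta>)\<close>, so expanding the Killing form gives
  \<open>\<beta> (kd \<beta>) = S * (\<beta> (kd \<beta>))\<^sup>2\<close> with \<open>S\<close> a
  sum of rational squares. Were the value zero, all weights would vanish on
  \<open>kd \<beta>\<close>; hence it is \<open>1 / S\<close>.\<close>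

lemma root_norm:
  assumes "\<beta> \<in> roots H"
  shows "\<exists>c>0. \<beta> (kd \<beta>) = of_real c"
proof -
  note \<beta> = real_dual_closed(6)[OF assms]
  note k = kd[OF \<beta>]
  have nz: "\<beta> (kd \<beta>) \<noteq> 0"
  proof
    assume "\<beta> (kd \<beta>) = 0"
    then have "kd \<beta> = 0"
      using wt_half_integral_root[OF assms] by (intro H_zeroI[OF k(2)]) fastforce
    then show False using k(3) root_not_zero(2)[OF assms] by (auto simp: killing_zero)
  qed
  obtain z :: "'g \<Rightarrow> int" where z: "\<And>b. b \<in> WB \<Longrightarrow> 2 * wt b (kd \<beta>) = of_int (z b) * \<beta> (kd \<beta>)"
    using wt_half_integral_root[OF assms] by metis
  define S :: real where "S = (\<Sum>b\<in>WB. (of_int (z b) / 2)\<^sup>2)"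
  have "\<beta> (kd \<beta>) = killing (kd \<beta>) (kd \<beta>)" using k by simp
  also have "\<dots> = (\<Sum>b\<in>WB. of_real ((of_int (z b) / 2)\<^sup>2) * (\<beta> (kd \<beta>))\<^sup>2)"
    unfolding killing_H[OF k(2) k(2)]
  proof (rule sum.cong)
    fix b assume "b \<in> WB"
    then have wtb: "wt b (kd \<beta>) = of_int (z b) / 2 * \<beta> (kd \<beta>)" using z[of b] by (simp add: field_simps)
    show "wt b (kd \<beta>) * wt b (kd \<beta>) = of_real ((of_int (z b) / 2)\<^sup>2) * (\<beta> (kd \<beta>))\<^sup>2"
      unfolding wtb by (simp add: power2_eq_square)
  qed simp
  also have "\<dots> = of_real S * \<beta> (kd \<beta>) * \<beta> (kd \<beta>)"
    by (simp add: S_def sum_distrib_right power2_eq_square mult.assoc)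
  finally have "of_real S * \<beta> (kd \<beta>) = 1" using nz by simp
  then have "\<beta> (kd \<beta>) = of_real (1 / S)" "S \<noteq> 0"
    by (auto simp: eq_divide_eq mult.commute)
  moreover have "S \<ge> 0" unfolding S_def by (intro sum_nonneg) simp
  ultimately show ?thesis by (intro exI[of _ "1 / S"]) simp
qed

lemma real_on_kd:
  assumes "\<And>\<beta>. \<beta> \<in> roots H \<Longrightarrow> \<phi> (kd \<beta>) \<in> \<real>" "\<phi> \<in> dual H" "\<psi> \<in> \<V>"
  shows "\<phi> (kd \<psi>) \<in> \<real>"
proof -
  have "\<psi> \<in> \<V> \<and> \<phi> (kd \<psi>) \<in> \<real>"
    using assms(3) unfolding real_dual_def
  proof (induction rule: rf.span_induct_alt)
    case base
    have "kd 0 = 0" using H_closed by (intro kd_unique) (auto simp: killing_zero)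
    then show ?case
      using assms(2) dual_apply_zero[of \<phi> H] rf.span_zero[of "roots H"]
      unfolding zero_fun_def by simp
  next
    case (step c \<beta> \<psi>)
    have \<beta>: "\<beta> \<in> \<V>" "\<psi> \<in> \<V>" "c *\<^sub>F \<beta> \<in> \<V>"
      using step real_dual_closed by (auto simp: real_dual_def)
    then have "\<phi> (kd (c *\<^sub>F \<beta> + \<psi>)) = of_real c * \<phi> (kd \<beta>) + \<phi> (kd \<psi>)"
      using kd(2) H_closed assms(2) by (simp add: kd_linear dualD)
    also have "\<dots> \<in> \<real>" using assms(1) step by (intro Reals_add Reals_mult) auto
    finally have "c *\<^sub>F \<beta> + \<psi> \<in> rf.span (roots H) \<and> \<phi> (kd (c *\<^sub>F \<beta> + \<psi>)) \<in> \<real>"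
      using real_dual_closed(2)[OF \<beta>(3,2)] unfolding real_dual_def by blast
    then show ?case by (simp only: plus_fun_def)
  qed
  then show ?thesis by blast
qed

lemma wt_real: "b \<in> WB \<Longrightarrow> \<psi> \<in> \<V> \<Longrightarrow> wt b (kd \<psi>) \<in> \<real>"
proof (rule real_on_kd)
  fix \<beta> assume b: "b \<in> WB" and \<beta>: "\<beta> \<in> roots H"
  obtain z :: int and c where "2 * wt b (kd \<beta>) = of_int z * \<beta> (kd \<beta>)" "\<beta> (kd \<beta>) = of_real c"
    using wt_half_integral_root[OF \<beta> b] root_norm[OF \<beta>] by blast
  then have "wt b (kd \<beta>) = of_int z * of_real c / 2" by (simp add: field_simps)
  also have "\<dots> \<in> \<real>" by (intro Reals_divide Reals_mult) auto
  finally show "wt b (kd \<beta>) \<in> \<real>" .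
qed (use wt in auto)

lemma killing_real:
  assumes "\<phi> \<in> \<V>" "\<psi> \<in> \<V>"
  shows "killing (kd \<phi>) (kd \<psi>) \<in> \<real>"
  unfolding killing_H[OF kd(2)[OF assms(1)] kd(2)[OF assms(2)]]
  using wt_real assms by (intro sum_in_Reals Reals_mult) auto

lemma ip_eq:
  assumes "\<phi> \<in> \<V>" "\<psi> \<in> \<V>"
  shows "of_real (ip H \<phi> \<psi>) = killing (kd \<phi>) (kd \<psi>)" "of_real (ip H \<phi> \<psi>) = \<phi> (kd \<psi>)"
  using killing_real[OF assms] kd(3)[OF assms(1) kd(2)[OF assms(2)]] by (auto simp: ip_def)

lemma ip_commute: "ip H \<phi> \<psi> = ip H \<psi> \<phi>"
  by (simp add: ip_def killing_commute)

lemma ip_add: "\<phi> \<in> \<V> \<Longrightarrow> \<psi> \<in> \<V> \<Longrightarrow> ip H (\<phi> + \<psi>) \<chi> = ip H \<phi> \<chi> + ip H \<psi> \<chi>"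
  by (simp add: ip_def kd_linear killing_linear)

lemma ip_scale: "\<phi> \<in> \<V> \<Longrightarrow> ip H (r *\<^sub>F \<phi>) \<chi> = r * ip H \<phi> \<chi>"
  by (simp add: ip_def kd_linear killing_linear)

lemma ip_diff: "\<phi> \<in> \<V> \<Longrightarrow> \<psi> \<in> \<V> \<Longrightarrow> ip H (\<phi> - \<psi>) \<chi> = ip H \<phi> \<chi> - ip H \<psi> \<chi>"
  using ip_add[of "\<phi> - \<psi>" \<psi> \<chi>] real_dual_closed by simp

lemma ip_linear:
  "\<phi> \<in> \<V> \<Longrightarrow> \<psi> \<in> \<V> \<Longrightarrow> ip H (\<phi> + \<psi>) \<chi> = ip H \<phi> \<chi> + ip H \<psi> \<chi>"
  "\<phi> \<in> \<V> \<Longrightarrow> \<psi> \<in> \<V> \<Longrightarrow> ip H (\<phi> - \<psi>) \<chi> = ip H \<phi> \<chi> - ip H \<psi> \<chi>"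
  "\<phi> \<in> \<V> \<Longrightarrow> ip H (r *\<^sub>F \<phi>) \<chi> = r * ip H \<phi> \<chi>"
  "\<phi> \<in> \<V> \<Longrightarrow> \<psi> \<in> \<V> \<Longrightarrow> ip H \<chi> (\<phi> + \<psi>) = ip H \<chi> \<phi> + ip H \<chi> \<psi>"
  "\<phi> \<in> \<V> \<Longrightarrow> \<psi> \<in> \<V> \<Longrightarrow> ip H \<chi> (\<phi> - \<psi>) = ip H \<chi> \<phi> - ip H \<chi> \<psi>"
  "\<phi> \<in> \<V> \<Longrightarrow> ip H \<chi> (r *\<^sub>F \<phi>) = r * ip H \<chi> \<phi>"
  by (simp_all add: ip_add ip_diff ip_scale ip_commute[of \<chi> "\<phi> + \<psi>"]
      ip_commute[of \<chi> "\<phi> - \<psi>"] ip_commute[of \<chi> "r *\<^sub>F \<phi>"] ip_commute[of \<phi> \<chi>]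
      ip_commute[of \<psi> \<chi>])

text \<open>The weights are real on \<open>kd \<phi>\<close>, so the form is a sum of real squares,
  which vanishes only if every weight does.\<close>

lemma ip_pos:
  assumes "\<phi> \<in> \<V>"
  shows "ip H \<phi> \<phi> \<ge> 0" "ip H \<phi> \<phi> = 0 \<Longrightarrow> \<phi> = 0"
proof -
  note k = kd[OF assms]
  have "Re (wt b (kd \<phi>) * wt b (kd \<phi>)) = (Re (wt b (kd \<phi>)))\<^sup>2" if "b \<in> WB" for b
    using wt_real[OF that assms] by (simp add: complex_is_Real_iff power2_eq_square)
  then have eq: "ip H \<phi> \<phi> = (\<Sum>b\<in>WB. (Re (wt b (kd \<phi>)))\<^sup>2)"
    unfolding ip_def killing_H[OF k(2) k(2)] Re_sum by simp
  then show "ip H \<phi> \<phi> \<ge> 0" by (simp add: sum_nonneg)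
  assume "ip H \<phi> \<phi> = 0"
  then have "Re (wt b (kd \<phi>)) = 0" if "b \<in> WB" for b
    using that finite_B unfolding eq by (simp add: sum_nonneg_eq_0_iff)
  then have "kd \<phi> = 0"
    using wt_real[OF _ assms] by (intro H_zeroI[OF k(2)]) (auto simp: complex_is_Real_iff complex_eq_iff)
  then show "\<phi> = 0" using k(3) by (intro dual_eqI[OF k(1) dual_zero]) (simp add: killing_zero)
qed

lemma root_ip_pos: "\<beta> \<in> roots H \<Longrightarrow> ip H \<beta> \<beta> > 0"
  using ip_pos[OF real_dual_closed(6), of \<beta>] unfolding roots_def by fastforce

lemma weight_integral:
  fixes \<rho> :: "'g \<Rightarrow> 'v::complex_vector \<Rightarrow> 'v"
  assumes "lie_representation \<rho>" "finite_dim TYPE('v)" "\<mu> \<in> weights H \<rho>" "\<mu> \<in> \<V>" "\<beta> \<in> roots H"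
  shows "\<exists>z::int. 2 * ip H \<mu> \<beta> = of_int z * ip H \<beta> \<beta>"
proof -
  obtain v where "v \<in> weight_space H \<rho> \<mu>" "v \<noteq> 0" using assms(3) weights_iff[OF assms(1)] by blast
  then obtain z :: int where "2 * \<mu> (kd \<beta>) = of_int z * \<beta> (kd \<beta>)"
    using weight_half_integral_root[OF assms(1,2) _ _ assms(5)] by blast
  then have "complex_of_real (2 * ip H \<mu> \<beta>) = of_real (of_int z * ip H \<beta> \<beta>)"
    using ip_eq(2) assms(4) real_dual_closed(6)[OF assms(5)] by simp
  then show ?thesis unfolding of_real_eq_iff by blast
qed

text \<open>Were \<open>\<rho> e v = 0\<close>, then \<open>v\<close> would be a highest vector and
  its pairing with \<open>\<beta>\<close> nonnegative. So a negative pairing gives a nonzero vector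
  of weight \<open>\<mu> + \<beta>\<close>; for a positive one, \<open>e\<close> and
  \<open>f\<close> exchange roles and \<open>[f, e] = - kd \<beta>\<close>.\<close>

lemma weight_step:
  fixes \<rho> :: "'g \<Rightarrow> 'v::complex_vector \<Rightarrow> 'v"
  assumes rep: "lie_representation \<rho>" and fdv: "finite_dim TYPE('v)"
    and \<mu>: "\<mu> \<in> weights H \<rho>" "\<mu> \<in> \<V>" and \<beta>: "\<beta> \<in> roots H"
  shows "ip H \<mu> \<beta> > 0 \<Longrightarrow> \<mu> - \<beta> \<in> weights H \<rho>" "ip H \<mu> \<beta> < 0 \<Longrightarrow> \<mu> + \<beta> \<in> weights H \<rho>"
proof -
  obtain v where v: "v \<in> weight_space H \<rho> \<mu>" "v \<noteq> 0" using \<mu> weights_iff[OF rep] by blast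
  obtain e f where ef: "e \<in> root_space H \<beta>" "f \<in> root_space H (- \<beta>)" "kd \<beta> = lie_bracket e f"
    using kd_root[OF \<beta>] by blast
  obtain h0 where h0: "h0 \<in> H" "\<beta> h0 \<noteq> 0" using root_not_zero(2)[OF \<beta>] by blast
  note \<beta>V = real_dual_closed(6)[OF \<beta>]
  have H: "lie_bracket e f \<in> H" "lie_bracket f e \<in> H"
    using kd(2)[OF \<beta>V] ef(3) H_closed(5) lie_bracket_skew[of f e] by auto
  have dual: "\<mu> \<in> dual H" "\<beta> \<in> dual H" using kd(1) \<mu>(2) \<beta>V by auto
  have eq: "\<mu> (kd \<beta>) = of_real (ip H \<mu> \<beta>)" "\<beta> (kd \<beta>) = of_real (ip H \<beta> \<beta>)"
    using ip_eq(2) \<mu>(2) \<beta>V by auto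
  show "\<mu> + \<beta> \<in> weights H \<rho>" if neg: "ip H \<mu> \<beta> < 0"
  proof -
    have "\<rho> e v \<noteq> 0"
    proof
      assume "\<rho> e v = 0"
      then obtain n :: nat where "2 * \<mu> (kd \<beta>) = of_nat n * \<beta> (kd \<beta>)"
        using highest_vector_weight[OF rep fdv h0 ef(1,2) H(1) v] ef(3) by auto
      then have "complex_of_real (2 * ip H \<mu> \<beta>) = of_real (n * ip H \<beta> \<beta>)" by (simp add: eq)
      then have "2 * ip H \<mu> \<beta> = n * ip H \<beta> \<beta>" unfolding of_real_eq_iff .
      moreover have "n * ip H \<beta> \<beta> \<ge> 0" using root_ip_pos[OF \<beta>] by simp
      ultimately show False using neg by linarith
    qed
    then show ?thesis
      using weight_shift[OF rep ef(1) v(1)] dual_plus[OF dual] weights_iff[OF rep] by blast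
  qed
  show "\<mu> - \<beta> \<in> weights H \<rho>" if pos: "ip H \<mu> \<beta> > 0"
  proof -
    have "\<rho> f v \<noteq> 0"
    proof
      assume "\<rho> f v = 0"
      moreover have "e \<in> root_space H (- (- \<beta>))" "(- \<beta>) h0 \<noteq> 0" using ef h0 by auto
      ultimately obtain n :: nat where n: "2 * \<mu> (lie_bracket f e) = of_nat n * (- \<beta>) (lie_bracket f e)"
        using highest_vector_weight[OF rep fdv h0(1) _ ef(2) _ H(2) v] by blast
      have fe: "lie_bracket f e = (-1) *\<^sub>C kd \<beta>" using lie_bracket_skew[of f e] ef(3) by simp
      then have "\<mu> (lie_bracket f e) = - of_real (ip H \<mu> \<beta>)" "\<beta> (lie_bracket f e) = - of_real (ip H \<beta> \<beta>)"
        unfolding fe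
        by (simp_all only: dualD(2)[OF dual(1) kd(2)[OF \<beta>V]] dualD(2)[OF dual(2) kd(2)[OF \<beta>V]] eq mult_minus1)
      then have "complex_of_real (- 2 * ip H \<mu> \<beta>) = of_real (n * ip H \<beta> \<beta>)" using n by simp
      then have "- 2 * ip H \<mu> \<beta> = n * ip H \<beta> \<beta>" unfolding of_real_eq_iff .
      moreover have "n * ip H \<beta> \<beta> \<ge> 0" using root_ip_pos[OF \<beta>] by simp
      ultimately show False using pos by linarith
    qed
    moreover have "\<mu> + - \<beta> = \<mu> - \<beta>" by simp
    ultimately show ?thesis
      using weight_shift[OF rep ef(2) v(1)] dual_minus[OF dual] weights_iff[OF rep] by metis
  qed
qed

end

section \<open>Simply laced root systems and the Weyl group\<close>

locale simply_laced_roots = simple_lie H for H :: "'g::complex_lie_algebra set" +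
  fixes t :: nat and \<alpha> :: "nat \<Rightarrow> 'g \<Rightarrow> complex" and \<Omega> :: real
  assumes sr: "simple_roots H t \<alpha>" and len: "\<forall>\<beta>\<in>roots H. root_length H \<beta> = \<Omega>"
begin

abbreviation "N \<equiv> {1..t}"
abbreviation "\<Phi> \<equiv> roots H"

text \<open>Keeps functionals as vectors instead of unfolding them pointwise; \<open>fun_ops\<close>
  restores the unfolding where an identity is checked by evaluation.\<close>

declare plus_fun_apply [simp del] zero_fun_apply [simp del] uminus_apply [simp del]
  minus_apply [simp del]

lemmas fun_ops = plus_fun_apply zero_fun_apply uminus_apply minus_apply scale_fun_def fun_eq_iff

lemma root_norm_eq: "\<beta> \<in> \<Phi> \<Longrightarrow> ip H \<beta> \<beta> = \<Omega>\<^sup>2"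
  using len root_ip_pos[of \<beta>] by (auto simp: root_length_def)

lemma \<Omega>_pos: "\<beta> \<in> \<Phi> \<Longrightarrow> \<Omega>\<^sup>2 > 0"
  using root_norm_eq root_ip_pos by metis

lemma \<alpha>_root: "i \<in> N \<Longrightarrow> \<alpha> i \<in> \<Phi>"
  using sr by (auto simp: simple_roots_def)

lemma root_V: "\<beta> \<in> \<Phi> \<Longrightarrow> \<beta> \<in> \<V>" by (rule real_dual_closed(6))

lemma \<alpha>_V: "i \<in> N \<Longrightarrow> \<alpha> i \<in> \<V>" using \<alpha>_root root_V by blast

lemma sum_V: "(\<And>i. i \<in> A \<Longrightarrow> f i \<in> \<V>) \<Longrightarrow> (\<Sum>i\<in>A. f i) \<in> \<V>"
  by (induction A rule: infinite_finite_induct) (auto simp: real_dual_closed)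

lemma ip_sum: "(\<And>i. i \<in> A \<Longrightarrow> f i \<in> \<V>) \<Longrightarrow> ip H (\<Sum>i\<in>A. f i) \<chi> = (\<Sum>i\<in>A. ip H (f i) \<chi>)"
proof (induction A rule: infinite_finite_induct)
  case (insert x F)
  then show ?case using sum_V[of F f] by (simp add: ip_linear)
qed (use ip_scale[OF real_dual_closed(1), of 0 \<chi>] in simp_all)

lemma coef_unique:
  assumes "(\<Sum>i\<in>N. c i *\<^sub>F \<alpha> i) = (\<Sum>i\<in>N. d i *\<^sub>F \<alpha> i)" "i \<in> N"
  shows "c i = d i"
proof -
  have inj: "inj_on \<alpha> N" and indep: "rf.independent (\<alpha> ` N)"
    using sr by (auto simp: simple_roots_def)
  let ?u = "\<lambda>\<beta>. c (inv_into N \<alpha> \<beta>) - d (inv_into N \<alpha> \<beta>)"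
  have "(\<Sum>\<beta>\<in>\<alpha> ` N. ?u \<beta> *\<^sub>F \<beta>) = (\<Sum>i\<in>N. (c i - d i) *\<^sub>F \<alpha> i)"
    using inj by (simp add: sum.reindex)
  also have "\<dots> = 0"
    using assms(1) by (simp add: rf.scale_left_diff_distrib sum_subtractf)
  finally have "?u (\<alpha> i) = 0"
    using rf.independentD[OF indep, of "\<alpha> ` N" ?u "\<alpha> i"] assms(2) by simp
  then show ?thesis using inj assms(2) by simp
qed

lemma \<alpha>_coef: "i \<in> N \<Longrightarrow> \<alpha> i = (\<Sum>j\<in>N. (if j = i then 1 else 0) *\<^sub>F \<alpha> j)"
  by (simp add: if_distrib[of "\<lambda>c. c *\<^sub>F _"] cong: if_cong)

lemma root_iff_weight: "\<beta> \<in> \<Phi> \<longleftrightarrow> \<beta> \<in> weights H lie_bracket \<and> \<beta> \<noteq> 0"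
  by (auto simp: roots_def weights_def root_space_weight_space)

lemma root_step:
  assumes "\<beta> \<in> \<Phi>" "\<gamma> \<in> \<Phi>"
  shows "ip H \<beta> \<gamma> > 0 \<Longrightarrow> \<beta> \<noteq> \<gamma> \<Longrightarrow> \<beta> - \<gamma> \<in> \<Phi>" "ip H \<beta> \<gamma> < 0 \<Longrightarrow> \<beta> \<noteq> - \<gamma> \<Longrightarrow> \<beta> + \<gamma> \<in> \<Phi>"
  using weight_step[OF ad_representation fd _ root_V[OF assms(1)] assms(2)] assms(1)
  unfolding root_iff_weight by (auto simp: add_eq_0_iff2)

text \<open>The squared norms of the difference and the sum of the two roots are
  \<open>2 - z\<close> and \<open>2 + z\<close> times \<open>\<Omega>\<^sup>2\<close>. Positivity
  bounds \<open>z\<close> by 2 in absolute value, and the extreme values force the roots to be equal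
  or opposite.\<close>

lemma root_pairing:
  assumes "\<beta> \<in> \<Phi>" "\<gamma> \<in> \<Phi>"
  shows "\<exists>z::int. 2 * ip H \<beta> \<gamma> = of_int z * \<Omega>\<^sup>2 \<and>
    (\<beta> = \<gamma> \<and> z = 2 \<or> \<beta> = - \<gamma> \<and> z = -2 \<or> \<beta> \<noteq> \<gamma> \<and> \<beta> \<noteq> - \<gamma> \<and> z \<in> {-1, 0, 1})"
proof -
  obtain z :: int where z: "2 * ip H \<beta> \<gamma> = of_int z * \<Omega>\<^sup>2"
    using weight_integral[OF ad_representation fd _ root_V[OF assms(1)] assms(2)] assms
      root_norm_eq root_iff_weight by metis
  note V = root_V[OF assms(1)] root_V[OF assms(2)]
  note pos = \<Omega>_pos[OF assms(1)]
  have minus: "ip H (\<beta> - \<gamma>) (\<beta> - \<gamma>) = (2 - of_int z) * \<Omega>\<^sup>2"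
    using V assms z root_norm_eq ip_commute[of \<gamma> \<beta>] by (simp add: ip_linear algebra_simps)
  have plus: "ip H (\<beta> + \<gamma>) (\<beta> + \<gamma>) = (2 + of_int z) * \<Omega>\<^sup>2"
    using V assms z root_norm_eq ip_commute[of \<gamma> \<beta>] by (simp add: ip_linear algebra_simps)
  have "(2 - of_int z) * \<Omega>\<^sup>2 \<ge> 0" "(2 + of_int z) * \<Omega>\<^sup>2 \<ge> 0"
    using ip_pos(1) V real_dual_closed minus plus by metis+
  then have "real_of_int z \<le> 2" "real_of_int z \<ge> -2"
    using pos by (auto simp: zero_le_mult_iff)
  then have "z \<in> {-2, -1, 0, 1, 2}" by auto
  moreover have "\<beta> = \<gamma>" if "z = 2"
  proof -
    have "\<beta> - \<gamma> = 0" using ip_pos(2)[of "\<beta> - \<gamma>"] minus that V real_dual_closed by simp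
    then show ?thesis by simp
  qed
  moreover have "\<beta> = - \<gamma>" if "z = -2"
  proof -
    have "\<beta> + \<gamma> = 0" using ip_pos(2)[of "\<beta> + \<gamma>"] plus that V real_dual_closed by simp
    then show ?thesis by (simp add: add_eq_0_iff2)
  qed
  moreover have "z = 2" if "\<beta> = \<gamma>" using z that root_norm_eq assms pos by simp
  moreover have "z = -2" if "\<beta> = - \<gamma>"
  proof -
    have "ip H (- \<gamma>) \<gamma> = - (\<Omega>\<^sup>2)"
      using ip_scale[OF V(2), of "-1" \<gamma>] root_norm_eq[OF assms(2)] by simp
    then have "(of_int z + 2) * \<Omega>\<^sup>2 = 0" using z that by (simp add: algebra_simps)
    then show ?thesis using pos by simp
  qed
  ultimately have "\<beta> = \<gamma> \<and> z = 2 \<or> \<beta> = - \<gamma> \<and> z = -2 \<or>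
      \<beta> \<noteq> \<gamma> \<and> \<beta> \<noteq> - \<gamma> \<and> z \<in> {-1, 0, 1}"
    by blast
  with z show ?thesis by blast
qed

lemma uminus_root:
  assumes "\<beta> \<in> \<Phi>"
  shows "- \<beta> \<in> \<Phi>"
proof -
  obtain e f where ef: "f \<in> root_space H (- \<beta>)" "kd \<beta> = lie_bracket e f"
    using kd_root[OF assms] by blast
  have "f \<noteq> 0"
  proof
    assume "f = 0"
    then have "kd \<beta> = 0" using ef(2) by (simp add: clinear_zero[OF ad_linear])
    then have "ip H \<beta> \<beta> = 0" by (simp add: ip_def killing_zero)
    then show False using root_ip_pos[OF assms] by simp
  qed
  then show ?thesis
    using ef(1) assms root_not_zero(1)[OF assms] by (auto simp: roots_def dual_uminus)
qed

text \<open>The reflection without restriction to \<open>\<V>\<close>, so that it composes as an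
  ordinary function; the common root length replaces the individual norm of
  \<open>\<beta>\<close>.\<close>

definition "reflect \<beta> \<mu> = \<mu> - (2 * ip H \<mu> \<beta> / \<Omega>\<^sup>2) *\<^sub>F \<beta>"

lemma ip_coroot: "\<beta> \<in> \<Phi> \<Longrightarrow> ip H \<mu> (coroot H \<beta>) = 2 * ip H \<mu> \<beta> / \<Omega>\<^sup>2"
  using root_norm_eq[of \<beta>] root_V[of \<beta>] by (simp add: coroot_def ip_linear)

lemma reflect_V: "\<beta> \<in> \<Phi> \<Longrightarrow> \<mu> \<in> \<V> \<Longrightarrow> reflect \<beta> \<mu> \<in> \<V>"
  by (simp add: reflect_def real_dual_closed root_V)

lemma reflect_ip:
  assumes "\<beta> \<in> \<Phi>" "\<mu> \<in> \<V>" "\<nu> \<in> \<V>"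
  shows "ip H (reflect \<beta> \<mu>) (reflect \<beta> \<nu>) = ip H \<mu> \<nu>"
  using assms \<Omega>_pos[OF assms(1)] root_norm_eq[OF assms(1)] ip_commute[of \<beta> \<nu>]
  by (simp add: reflect_def ip_linear real_dual_closed root_V field_simps power2_eq_square)

lemma reflect_involution:
  assumes "\<beta> \<in> \<Phi>" "\<mu> \<in> \<V>"
  shows "reflect \<beta> (reflect \<beta> \<mu>) = \<mu>"
proof -
  have "ip H (reflect \<beta> \<mu>) \<beta> = - ip H \<mu> \<beta>"
    using assms \<Omega>_pos[OF assms(1)] root_norm_eq[OF assms(1)]
    by (simp add: reflect_def ip_linear real_dual_closed root_V)
  then show ?thesis by (simp add: reflect_def[of \<beta> "reflect \<beta> \<mu>"]) (simp add: reflect_def)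
qed

lemma reflect_adjoint:
  assumes "\<beta> \<in> \<Phi>" "\<mu> \<in> \<V>" "\<nu> \<in> \<V>"
  shows "ip H (reflect \<beta> \<mu>) \<nu> = ip H \<mu> (reflect \<beta> \<nu>)"
  using reflect_ip[OF assms(1,2) reflect_V[OF assms(1,3)]] reflect_involution[OF assms(1,3)] by simp

lemma reflect_linear:
  assumes "\<mu> \<in> \<V>" "\<nu> \<in> \<V>"
  shows "reflect \<beta> (\<mu> - r *\<^sub>F \<nu>) = reflect \<beta> \<mu> - r *\<^sub>F reflect \<beta> \<nu>"
proof -
  have "2 * ip H (\<mu> - r *\<^sub>F \<nu>) \<beta> / \<Omega>\<^sup>2 = 2 * ip H \<mu> \<beta> / \<Omega>\<^sup>2 - r * (2 * ip H \<nu> \<beta> / \<Omega>\<^sup>2)"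
    using assms by (simp add: ip_linear real_dual_closed diff_divide_distrib algebra_simps)
  then show ?thesis
    unfolding reflect_def
    by (simp add: rf.scale_left_diff_distrib rf.scale_right_diff_distrib)
qed

lemma reflect_self: "\<beta> \<in> \<Phi> \<Longrightarrow> reflect \<beta> \<beta> = - \<beta>"
  using \<Omega>_pos[of \<beta>] root_norm_eq[of \<beta>]
  by (simp add: reflect_def) (simp add: fun_ops)

text \<open>For roots that are neither equal nor opposite the coefficient is 0, 1 or -1, so a single
  root step reaches the reflected functional.\<close>

lemma reflect_root:
  assumes "\<beta> \<in> \<Phi>" "\<gamma> \<in> \<Phi>"
  shows "reflect \<gamma> \<beta> \<in> \<Phi>"
proof -
  obtain z :: int where z: "2 * ip H \<beta> \<gamma> = of_int z * \<Omega>\<^sup>2" and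
    cases: "\<beta> = \<gamma> \<and> z = 2 \<or> \<beta> = - \<gamma> \<and> z = -2 \<or> \<beta> \<noteq> \<gamma> \<and> \<beta> \<noteq> - \<gamma> \<and> z \<in> {-1, 0, 1}"
    using root_pairing[OF assms] by blast
  have eq: "reflect \<gamma> \<beta> = \<beta> - of_int z *\<^sub>F \<gamma>"
    using z \<Omega>_pos[OF assms(1)] by (simp add: reflect_def)
  consider "\<beta> = \<gamma>" | "\<beta> = - \<gamma>" "z = -2" | "\<beta> \<noteq> \<gamma>" "z = 1" | "z = 0" | "\<beta> \<noteq> - \<gamma>" "z = -1"
    using cases by auto
  then show ?thesis
  proof cases
    case 1
    then show ?thesis using reflect_self[OF assms(2)] uminus_root[OF assms(2)] by simp
  next
    case 2
    then have "reflect \<gamma> \<beta> = \<gamma>" unfolding eq by (simp add: fun_ops)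
    then show ?thesis using assms by simp
  next
    case 3
    then have "2 * ip H \<beta> \<gamma> = \<Omega>\<^sup>2" using z by simp
    then have "ip H \<beta> \<gamma> > 0" using \<Omega>_pos[OF assms(1)] by linarith
    then show ?thesis using root_step(1)[OF assms] 3 eq by simp
  next
    case 4
    then show ?thesis using eq assms by simp
  next
    case 5
    then have "2 * ip H \<beta> \<gamma> = - (\<Omega>\<^sup>2)" using z by simp
    then have "ip H \<beta> \<gamma> < 0" using \<Omega>_pos[OF assms(1)] by linarith
    moreover have "reflect \<gamma> \<beta> = \<beta> + \<gamma>" using 5 unfolding eq by (simp add: fun_ops)
    ultimately show ?thesis using root_step(2)[OF assms] 5 by simp
  qed
qed

section \<open>Positive roots\<close>

abbreviation "pos \<equiv> positive_roots H t \<alpha>"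

lemma pos_root: "\<beta> \<in> pos \<Longrightarrow> \<beta> \<in> \<Phi>"
  by (simp add: positive_roots_def)

lemma pos_or_neg: "\<beta> \<in> \<Phi> \<Longrightarrow> \<beta> \<in> pos \<or> - \<beta> \<in> pos"
proof -
  assume \<beta>: "\<beta> \<in> \<Phi>"
  then obtain n :: "nat \<Rightarrow> nat" where
    "\<beta> = (\<Sum>i=1..t. real (n i) *\<^sub>F \<alpha> i) \<or> \<beta> = - (\<Sum>i=1..t. real (n i) *\<^sub>F \<alpha> i)"
    using sr unfolding simple_roots_def by blast
  moreover have "- \<beta> = (\<Sum>i=1..t. real (n i) *\<^sub>F \<alpha> i)" if "\<beta> = - (\<Sum>i=1..t. real (n i) *\<^sub>F \<alpha> i)"
    using that by (metis minus_minus)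
  ultimately show ?thesis
    using \<beta> uminus_root[OF \<beta>] unfolding positive_roots_def by blast
qed

lemma pos_coef:
  assumes "\<beta> \<in> pos" "\<beta> = (\<Sum>i\<in>N. c i *\<^sub>F \<alpha> i)" "i \<in> N"
  shows "c i \<ge> 0"
proof -
  obtain n :: "nat \<Rightarrow> nat" where "\<beta> = (\<Sum>i\<in>N. real (n i) *\<^sub>F \<alpha> i)"
    using assms(1) by (auto simp: positive_roots_def)
  then show ?thesis using coef_unique[of c "\<lambda>i. real (n i)" i] assms by simp
qed

lemma not_pos_and_neg: "\<beta> \<in> pos \<Longrightarrow> - \<beta> \<notin> pos"
proof
  assume *: "\<beta> \<in> pos" "- \<beta> \<in> pos"
  obtain n :: "nat \<Rightarrow> nat" where n: "\<beta> = (\<Sum>i\<in>N. real (n i) *\<^sub>F \<alpha> i)"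
    using *(1) by (auto simp: positive_roots_def)
  have eq: "- \<beta> = (\<Sum>i\<in>N. (- real (n i)) *\<^sub>F \<alpha> i)" by (simp add: n sum_negf)
  have "- real (n i) \<ge> 0" if "i \<in> N" for i using pos_coef[OF *(2) eq that] .
  then have "n i = 0" if "i \<in> N" for i using that by force
  then have "\<beta> = 0" unfolding n by simp
  then show False using pos_root[OF *(1)] by (simp add: roots_def)
qed

lemma simple_pos: "i \<in> N \<Longrightarrow> \<alpha> i \<in> pos"
  unfolding positive_roots_def
proof (intro CollectI conjI exI)
  assume i: "i \<in> N"
  show "\<alpha> i = (\<Sum>j=1..t. real (if j = i then 1 else 0) *\<^sub>F \<alpha> j)"
    using \<alpha>_coef[OF i] by (simp add: if_distrib[of real] cong: if_cong)
qed (rule \<alpha>_root)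

text \<open>The reflection changes only the coefficient of \<open>\<alpha> i\<close>. As all roots
  have the same length, a positive root other than \<open>\<alpha> i\<close> is no multiple of it,
  so some other positive coefficient remains and excludes a negative root.\<close>

lemma reflect_simple_pos:
  assumes i: "i \<in> N" and \<beta>: "\<beta> \<in> pos" "\<beta> \<noteq> \<alpha> i"
  shows "reflect (\<alpha> i) \<beta> \<in> pos"
proof -
  obtain n :: "nat \<Rightarrow> nat" where n: "\<beta> = (\<Sum>j\<in>N. real (n j) *\<^sub>F \<alpha> j)"
    using \<beta>(1) by (auto simp: positive_roots_def)
  have "\<exists>j\<in>N. j \<noteq> i \<and> n j \<noteq> 0"
  proof (rule ccontr)
    assume "\<not> ?thesis"
    then have "\<beta> = (\<Sum>j\<in>N. (if j = i then real (n i) else 0) *\<^sub>F \<alpha> j)"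
      unfolding n by (intro sum.cong) auto
    then have eq: "\<beta> = real (n i) *\<^sub>F \<alpha> i"
      using i by (simp add: if_distrib[of "\<lambda>c. c *\<^sub>F _"] cong: if_cong)
    then have "\<Omega>\<^sup>2 = (real (n i))\<^sup>2 * \<Omega>\<^sup>2"
      using root_norm_eq[OF pos_root[OF \<beta>(1)]] root_norm_eq[OF \<alpha>_root[OF i]] \<alpha>_V[OF i]
      by (simp add: ip_linear real_dual_closed power2_eq_square)
    then have "(real (n i))\<^sup>2 = 1" using \<Omega>_pos[OF \<alpha>_root[OF i]] by simp
    then have "(n i)\<^sup>2 = 1" by (metis of_nat_1 of_nat_eq_iff of_nat_power)
    then have "n i = 1" by (simp add: power2_eq_square)
    then show False using eq \<beta>(2) by simp
  qed
  then obtain j where j: "j \<in> N" "j \<noteq> i" "n j > 0" by auto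
  define k where "k = 2 * ip H \<beta> (\<alpha> i) / \<Omega>\<^sup>2"
  have "reflect (\<alpha> i) \<beta> = (\<Sum>j\<in>N. real (n j) *\<^sub>F \<alpha> j) - k *\<^sub>F (\<Sum>j\<in>N. (if j = i then 1 else 0) *\<^sub>F \<alpha> j)"
    using n \<alpha>_coef[OF i] by (simp add: reflect_def k_def)
  also have "\<dots> = (\<Sum>j\<in>N. (real (n j) - (if j = i then k else 0)) *\<^sub>F \<alpha> j)"
    by (simp add: rf.scale_sum_right rf.scale_left_diff_distrib sum_subtractf if_distrib[of "\<lambda>c. k * c"]
        cong: if_cong)
  finally have r: "reflect (\<alpha> i) \<beta> = (\<Sum>j\<in>N. (real (n j) - (if j = i then k else 0)) *\<^sub>F \<alpha> j)" .
  have "- reflect (\<alpha> i) \<beta> = (\<Sum>j\<in>N. (- (real (n j) - (if j = i then k else 0))) *\<^sub>F \<alpha> j)"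
    unfolding r by (simp only: rf.scale_minus_left sum_negf)
  then have "- reflect (\<alpha> i) \<beta> \<notin> pos" using pos_coef[of "- reflect (\<alpha> i) \<beta>" _ j] j by fastforce
  then show ?thesis using pos_or_neg reflect_root[OF pos_root[OF \<beta>(1)] \<alpha>_root[OF i]] by blast
qed

section \<open>Words and the Weyl group\<close>

lemma nth_N: "set js \<subseteq> N \<Longrightarrow> k < length js \<Longrightarrow> js ! k \<in> N"
  using nth_mem by blast

text \<open>As for words in the Weyl group, the head of the list acts first.\<close>

definition "act js \<mu> = fold (\<lambda>i. reflect (\<alpha> i)) js \<mu>"

lemma act_simps [simp]: "act [] \<mu> = \<mu>" "act (i # js) \<mu> = act js (reflect (\<alpha> i) \<mu>)"
  "act (js @ ks) \<mu> = act ks (act js \<mu>)"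
  by (simp_all add: act_def)

lemma act_V: "set js \<subseteq> N \<Longrightarrow> \<mu> \<in> \<V> \<Longrightarrow> act js \<mu> \<in> \<V>"
  by (induction js arbitrary: \<mu>) (auto simp: reflect_V \<alpha>_root)

lemma act_root: "set js \<subseteq> N \<Longrightarrow> \<beta> \<in> \<Phi> \<Longrightarrow> act js \<beta> \<in> \<Phi>"
  by (induction js arbitrary: \<beta>) (auto simp: reflect_root \<alpha>_root)

lemma act_ip: "set js \<subseteq> N \<Longrightarrow> \<mu> \<in> \<V> \<Longrightarrow> \<nu> \<in> \<V> \<Longrightarrow> ip H (act js \<mu>) (act js \<nu>) = ip H \<mu> \<nu>"
  by (induction js arbitrary: \<mu> \<nu>) (auto simp: reflect_ip reflect_V \<alpha>_root)

lemma act_rev: "set js \<subseteq> N \<Longrightarrow> \<mu> \<in> \<V> \<Longrightarrow> act js (act (rev js) \<mu>) = \<mu>"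
  by (induction js arbitrary: \<mu>) (auto simp: reflect_involution act_V \<alpha>_root)

lemma simple_reflection_eq: "i \<in> N \<Longrightarrow> simple_reflection H (\<alpha> i) = restrict (reflect (\<alpha> i)) \<V>"
  unfolding simple_reflection_def reflect_def using ip_coroot[OF \<alpha>_root] by simp

lemma simple_reflection_Bij: "i \<in> N \<Longrightarrow> simple_reflection H (\<alpha> i) \<in> Bij \<V>"
  unfolding Bij_def
  by (auto simp: simple_reflection_eq reflect_V reflect_involution \<alpha>_root
      intro!: bij_betwI[where g = "reflect (\<alpha> i)"])

lemma compose_restrict:
  "(\<And>\<mu>. \<mu> \<in> \<V> \<Longrightarrow> g \<mu> \<in> \<V>) \<Longrightarrow> compose \<V> (restrict f \<V>) (restrict g \<V>) = restrict (\<lambda>\<mu>. f (g \<mu>)) \<V>"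
  by (auto simp: compose_def fun_eq_iff)

text \<open>Membership in \<open>Bij\<close> is carried through the induction, since the product of
  \<open>BijGroup\<close> is composition only there.\<close>

lemma word_elt_eq: "set js \<subseteq> N \<Longrightarrow> word_elt H \<alpha> js = restrict (act js) \<V> \<and> word_elt H \<alpha> js \<in> Bij \<V>"
proof (induction js rule: rev_induct)
  case Nil
  have "word_elt H \<alpha> [] = \<one>\<^bsub>BijGroup \<V>\<^esub>" by (simp add: word_elt_def)
  then show ?case
    using id_Bij[of \<V>] by (simp add: BijGroup_def restrict_def)
next
  case (snoc i js)
  then have i: "i \<in> N" and js: "set js \<subseteq> N"
    and IH: "word_elt H \<alpha> js = restrict (act js) \<V>" "word_elt H \<alpha> js \<in> Bij \<V>" by auto
  have "word_elt H \<alpha> (js @ [i]) = simple_reflection H (\<alpha> i) \<otimes>\<^bsub>BijGroup \<V>\<^esub> word_elt H \<alpha> js"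
    by (simp add: word_elt_def)
  also have "\<dots> = compose \<V> (simple_reflection H (\<alpha> i)) (word_elt H \<alpha> js)"
    using IH(2) simple_reflection_Bij[OF i] by (simp add: BijGroup_def)
  finally have eq: "word_elt H \<alpha> (js @ [i]) = compose \<V> (simple_reflection H (\<alpha> i)) (word_elt H \<alpha> js)" .
  have "\<dots> = restrict (\<lambda>\<mu>. reflect (\<alpha> i) (act js \<mu>)) \<V>"
    unfolding IH(1) simple_reflection_eq[OF i] by (rule compose_restrict) (rule act_V[OF js])
  also have "\<dots> = restrict (act (js @ [i])) \<V>" by (auto simp: restrict_def)
  finally have r: "compose \<V> (simple_reflection H (\<alpha> i)) (word_elt H \<alpha> js) = restrict (act (js @ [i])) \<V>" .
  show ?case
    using compose_Bij[OF simple_reflection_Bij[OF i] IH(2)] unfolding eq r by blast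
qed

lemma word_elt_apply: "set js \<subseteq> N \<Longrightarrow> \<mu> \<in> \<V> \<Longrightarrow> word_elt H \<alpha> js \<mu> = act js \<mu>"
  using word_elt_eq by simp

lemma word_elt_eqI:
  "set js \<subseteq> N \<Longrightarrow> set ks \<subseteq> N \<Longrightarrow> (\<And>\<mu>. \<mu> \<in> \<V> \<Longrightarrow> act js \<mu> = act ks \<mu>)
    \<Longrightarrow> word_elt H \<alpha> js = word_elt H \<alpha> ks"
  using word_elt_eq by (auto intro!: restrict_ext)

lemma word_elt_append:
  assumes "set js \<subseteq> N" "set ks \<subseteq> N"
  shows "word_elt H \<alpha> (js @ ks) = word_elt H \<alpha> ks \<otimes>\<^bsub>BijGroup \<V>\<^esub> word_elt H \<alpha> js"
proof -
  have "word_elt H \<alpha> ks \<otimes>\<^bsub>BijGroup \<V>\<^esub> word_elt H \<alpha> js = compose \<V> (word_elt H \<alpha> ks) (word_elt H \<alpha> js)"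
    using word_elt_eq[OF assms(1), THEN conjunct2] word_elt_eq[OF assms(2), THEN conjunct2]
    by (simp add: BijGroup_def)
  also have "\<dots> = restrict (\<lambda>\<mu>. act ks (act js \<mu>)) \<V>"
    using word_elt_eq assms compose_restrict[of "act js"] act_V by simp
  also have "\<dots> = word_elt H \<alpha> (js @ ks)"
    using word_elt_eq[of "js @ ks"] assms by (auto simp: restrict_def)
  finally show ?thesis ..
qed

lemma weyl_group_iff: "w \<in> weyl_group H t \<alpha> \<longleftrightarrow> (\<exists>js. set js \<subseteq> N \<and> word_elt H \<alpha> js = w)"
proof
  let ?G = "BijGroup \<V>"
  have single: "word_elt H \<alpha> [i] = simple_reflection H (\<alpha> i)" if "i \<in> N" for i
    using word_elt_eq[of "[i]"] simple_reflection_eq[OF that] that by (auto simp: restrict_def)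
  assume "w \<in> weyl_group H t \<alpha>"
  then show "\<exists>js. set js \<subseteq> N \<and> word_elt H \<alpha> js = w"
    unfolding weyl_group_def
  proof (induction rule: generate.induct)
    case one
    show ?case by (rule exI[of _ "[]"]) (simp add: word_elt_def)
  next
    case (incl h)
    then obtain i where "i \<in> N" "h = simple_reflection H (\<alpha> i)" by auto
    then show ?case using single[of i] by (intro exI[of _ "[i]"]) simp
  next
    case (inv h)
    then obtain i where i: "i \<in> N" "h = simple_reflection H (\<alpha> i)" by auto
    have "word_elt H \<alpha> [i, i] = word_elt H \<alpha> []"
      using i by (intro word_elt_eqI) (auto simp: reflect_involution \<alpha>_root)
    then have "h \<otimes>\<^bsub>?G\<^esub> h = \<one>\<^bsub>?G\<^esub>"
      using word_elt_append[of "[i]" "[i]"] single[OF i(1)] i by (simp add: word_elt_def)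
    then have "inv\<^bsub>?G\<^esub> h = h"
      using i simple_reflection_Bij
      by (intro group.inv_equality[OF group_BijGroup]) (auto simp: BijGroup_def)
    then show ?case using single[OF i(1)] i by (intro exI[of _ "[i]"]) simp
  next
    case (eng h1 h2)
    then obtain js ks where "set js \<subseteq> N" "word_elt H \<alpha> js = h1" "set ks \<subseteq> N" "word_elt H \<alpha> ks = h2"
      by blast
    then show ?case using word_elt_append[of ks js] by (intro exI[of _ "ks @ js"]) simp
  qed
next
  assume "\<exists>js. set js \<subseteq> N \<and> word_elt H \<alpha> js = w"
  then obtain js where "set js \<subseteq> N" "word_elt H \<alpha> js = w" by blast
  then show "w \<in> weyl_group H t \<alpha>"
    unfolding weyl_group_def
  proof (induction js arbitrary: w rule: rev_induct)
    case Nil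
    then show ?case by (auto simp: word_elt_def intro: generate.one)
  next
    case (snoc i js)
    have "word_elt H \<alpha> (js @ [i]) = simple_reflection H (\<alpha> i) \<otimes>\<^bsub>BijGroup \<V>\<^esub> word_elt H \<alpha> js"
      by (simp add: word_elt_def)
    moreover have "\<dots> \<in> generate (BijGroup \<V>) ((\<lambda>i. simple_reflection H (\<alpha> i)) ` N)"
      using snoc.prems(1) by (intro generate.eng generate.incl snoc.IH) auto
    ultimately show ?case using snoc.prems(2) by simp
  qed
qed

section \<open>Length, exchange and the longest element\<close>

lemma weyl_length_le:
  "set js \<subseteq> N \<Longrightarrow> word_elt H \<alpha> js = w \<Longrightarrow> weyl_length H t \<alpha> w \<le> length js"
  unfolding weyl_length_def by (rule Least_le) blast

lemma reduced_word_exists: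
  assumes "w \<in> weyl_group H t \<alpha>"
  shows "\<exists>js. reduced_word H t \<alpha> w js"
proof -
  let ?P = "\<lambda>n. \<exists>js. set js \<subseteq> N \<and> length js = n \<and> word_elt H \<alpha> js = w"
  have "\<exists>n. ?P n" using assms weyl_group_iff by blast
  then have "?P (weyl_length H t \<alpha> w)" unfolding weyl_length_def by (rule LeastI_ex)
  then show ?thesis by (auto simp: reduced_word_def)
qed

text \<open>The conjugation rule for reflections, arranged to move \<open>reflect \<beta>\<close>
  past the last letter of a word.\<close>

lemma reflect_conj:
  assumes "\<gamma> \<in> \<Phi>" "\<beta> \<in> \<Phi>" "\<mu> \<in> \<V>"
  shows "reflect \<beta> (reflect \<gamma> \<mu>) = reflect \<gamma> (reflect (reflect \<gamma> \<beta>) \<mu>)"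
proof -
  note V = root_V[OF assms(1)] root_V[OF assms(2)]
  have "reflect \<gamma> (reflect (reflect \<gamma> \<beta>) \<mu>)
      = reflect \<gamma> \<mu> - (2 * ip H \<mu> (reflect \<gamma> \<beta>) / \<Omega>\<^sup>2) *\<^sub>F reflect \<gamma> (reflect \<gamma> \<beta>)"
    unfolding reflect_def[of "reflect \<gamma> \<beta>" \<mu>] using assms V by (intro reflect_linear reflect_V)
  then show ?thesis
    using reflect_involution[OF assms(1) V(2)] reflect_adjoint[OF assms(1,3) V(2)] by (simp add: reflect_def[of \<beta>])
qed

text \<open>The exchange condition: \<open>act (rev js)\<close> is the inverse of the word, and it
  makes \<open>\<beta>\<close> negative. Passing the letters from the last one on,
  \<open>\<beta>\<close> can change sign only when it has become the simple root of the current
  letter; there its reflection cancels that letter.\<close>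

lemma exchange:
  assumes "set js \<subseteq> N" "\<beta> \<in> pos" "- act (rev js) \<beta> \<in> pos"
  shows "\<exists>ks. set ks \<subseteq> N \<and> Suc (length ks) = length js \<and> (\<forall>\<mu>\<in>\<V>. reflect \<beta> (act js \<mu>) = act ks \<mu>)"
  using assms
proof (induction js arbitrary: \<beta> rule: rev_induct)
  case Nil
  then show ?case using not_pos_and_neg by simp
next
  case (snoc j js)
  have j: "j \<in> N" and js: "set js \<subseteq> N" using snoc.prems by auto
  show ?case
  proof (cases "\<beta> = \<alpha> j")
    case True
    then show ?thesis
      using j js reflect_involution[OF \<alpha>_root[OF j] act_V[OF js]] by (intro exI[of _ js]) auto
  next
    case False
    define \<gamma> where "\<gamma> = reflect (\<alpha> j) \<beta>"
    have \<gamma>: "\<gamma> \<in> pos" using reflect_simple_pos[OF j snoc.prems(2) False] by (simp add: \<gamma>_def)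
    moreover have "- act (rev js) \<gamma> \<in> pos" using snoc.prems(3) by (simp add: \<gamma>_def)
    ultimately obtain ks where ks: "set ks \<subseteq> N" "Suc (length ks) = length js"
      "\<And>\<mu>. \<mu> \<in> \<V> \<Longrightarrow> reflect \<gamma> (act js \<mu>) = act ks \<mu>"
      using snoc.IH[OF js] by blast
    have "reflect \<beta> (act (js @ [j]) \<mu>) = act (ks @ [j]) \<mu>" if "\<mu> \<in> \<V>" for \<mu>
      using reflect_conj[OF \<alpha>_root[OF j] pos_root[OF snoc.prems(2)] act_V[OF js that]] ks(3)[OF that]
      by (simp add: \<gamma>_def)
    then show ?thesis using ks j by (intro exI[of _ "ks @ [j]"]) auto
  qed
qed

text \<open>If the pairing were positive, put \<open>w = s\<^sub>i w\<^sub>0\<close> and let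
  \<open>\<beta>\<close> be the preimage of \<open>\<alpha> i\<close> under \<open>w\<close>. Its
  pairing with the dominant \<open>lam\<close> is minus the given one, so \<open>\<beta>\<close> is
  negative, and by exchange \<open>s\<^sub>i w = w\<^sub>0\<close> is shorter than \<open>w\<close>,
  contradicting maximal length.\<close>

lemma longest_antidominant:
  assumes w0: "longest_element H t \<alpha> w0" and lam: "lam \<in> \<V>"
    and dom: "\<And>i. i \<in> N \<Longrightarrow> ip H lam (\<alpha> i) \<ge> 0" and i: "i \<in> N"
  shows "ip H (w0 lam) (\<alpha> i) \<le> 0"
proof (rule ccontr)
  assume "\<not> ?thesis"
  then have pos: "ip H (w0 lam) (\<alpha> i) > 0" by simp
  have W: "w0 \<in> weyl_group H t \<alpha>" using w0 by (simp add: longest_element_def)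
  obtain js where js: "set js \<subseteq> N" "word_elt H \<alpha> js = w0" using W weyl_group_iff by blast
  define w where "w = word_elt H \<alpha> (js @ [i])"
  have "set (js @ [i]) \<subseteq> N" using js i by auto
  then have "w \<in> weyl_group H t \<alpha>" using weyl_group_iff w_def by blast
  then obtain ks where ks: "set ks \<subseteq> N" "word_elt H \<alpha> ks = w" "length ks = weyl_length H t \<alpha> w"
    and le: "weyl_length H t \<alpha> w \<le> weyl_length H t \<alpha> w0"
    using reduced_word_exists w0 unfolding longest_element_def reduced_word_def by blast
  have eq: "act ks \<mu> = reflect (\<alpha> i) (act js \<mu>)" if "\<mu> \<in> \<V>" for \<mu>
    using word_elt_apply[OF ks(1) that] word_elt_apply[of "js @ [i]" \<mu>] js(1) i that ks(2) w_def by simp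
  have \<alpha>i: "\<alpha> i \<in> \<V>" "\<alpha> i \<in> \<Phi>" using \<alpha>_V \<alpha>_root i by auto
  define \<beta> where "\<beta> = act (rev ks) (\<alpha> i)"
  have \<beta>: "\<beta> \<in> \<Phi>" unfolding \<beta>_def using act_root ks \<alpha>i by simp
  have "ip H lam \<beta> = ip H (act ks lam) (act ks \<beta>)" using act_ip[OF ks(1) lam root_V[OF \<beta>]] ..
  also have "act ks \<beta> = \<alpha> i" unfolding \<beta>_def using act_rev ks(1) \<alpha>i by blast
  also have "ip H (act ks lam) (\<alpha> i) = ip H (act js lam) (reflect (\<alpha> i) (\<alpha> i))"
    unfolding eq[OF lam] using reflect_adjoint \<alpha>i act_V js(1) lam by simp
  also have "\<dots> = - ip H (w0 lam) (\<alpha> i)"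
    using reflect_self[OF \<alpha>i(2)] ip_linear(6)[OF \<alpha>i(1), of "act js lam" "-1"] word_elt_apply[OF js(1) lam] js(2)
    by simp
  finally have neg: "ip H lam \<beta> < 0" using pos by simp
  have "\<beta> \<notin> pos"
  proof
    assume "\<beta> \<in> pos"
    then obtain n :: "nat \<Rightarrow> nat" where n: "\<beta> = (\<Sum>j\<in>N. real (n j) *\<^sub>F \<alpha> j)"
      by (auto simp: positive_roots_def)
    have "ip H \<beta> lam = (\<Sum>j\<in>N. real (n j) * ip H (\<alpha> j) lam)"
      unfolding n using \<alpha>_V by (subst ip_sum) (auto simp: ip_linear real_dual_closed)
    also have "\<dots> \<ge> 0" using dom ip_commute by (intro sum_nonneg mult_nonneg_nonneg) auto
    finally show False using neg ip_commute[of lam \<beta>] by simp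
  qed
  then have "- act (rev ks) (\<alpha> i) \<in> pos" using pos_or_neg[OF \<beta>] by (simp add: \<beta>_def)
  then obtain ls where ls: "set ls \<subseteq> N" "Suc (length ls) = length ks"
    "\<And>\<mu>. \<mu> \<in> \<V> \<Longrightarrow> reflect (\<alpha> i) (act ks \<mu>) = act ls \<mu>"
    using exchange[OF ks(1) simple_pos[OF i]] by blast
  have "act ls \<mu> = act js \<mu>" if "\<mu> \<in> \<V>" for \<mu>
    using ls(3)[OF that] eq[OF that] reflect_involution[OF \<alpha>i(2) act_V[OF js(1) that]] by simp
  then have "word_elt H \<alpha> ls = w0" using word_elt_eqI[OF ls(1) js(1)] js(2) by simp
  then have "weyl_length H t \<alpha> w0 \<le> length ls" by (rule weyl_length_le[OF ls(1)])
  then show False using ls ks le by simp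
qed

end

section \<open>Minuscule weights\<close>

locale minuscule_rep = simply_laced_roots H t \<alpha> \<Omega>
  for H :: "'g::complex_lie_algebra set" and t \<alpha> \<Omega> +
  fixes \<rho> :: "'g \<Rightarrow> 'v::complex_vector \<Rightarrow> 'v" and lam :: "'g \<Rightarrow> complex"
  assumes minuscule: "minuscule_representation H t \<alpha> \<rho> lam"
begin

lemma rep: "lie_representation \<rho>" and fdv: "finite_dim TYPE('v)"
  using minuscule unfolding minuscule_representation_def irreducible_representation_def by blast+

lemma lam_V: "lam \<in> \<V>"
  using minuscule unfolding minuscule_representation_def dominant_def weight_lattice_def by blast

lemma lam_dominant: "i \<in> N \<Longrightarrow> 2 * ip H lam (\<alpha> i) / \<Omega>\<^sup>2 \<ge> 0"
  using minuscule ip_coroot[OF \<alpha>_root, of i lam]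
  unfolding minuscule_representation_def dominant_def by force

lemma weights_orbit: "(\<lambda>w. w lam) ` weyl_group H t \<alpha> = weights H \<rho>"
  using minuscule unfolding minuscule_representation_def has_highest_weight_def by blast

lemma weights_act: "\<mu> \<in> weights H \<rho> \<longleftrightarrow> (\<exists>js. set js \<subseteq> N \<and> \<mu> = act js lam)"
proof -
  have "\<mu> \<in> weights H \<rho> \<longleftrightarrow> (\<exists>w\<in>weyl_group H t \<alpha>. \<mu> = w lam)"
    unfolding weights_orbit[symmetric] by blast
  also have "\<dots> \<longleftrightarrow> (\<exists>js. set js \<subseteq> N \<and> \<mu> = word_elt H \<alpha> js lam)"
    unfolding Bex_def weyl_group_iff by blast
  also have "\<dots> \<longleftrightarrow> (\<exists>js. set js \<subseteq> N \<and> \<mu> = act js lam)"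
    using word_elt_apply[OF _ lam_V] by metis
  finally show ?thesis .
qed

lemma weight_V: "\<mu> \<in> weights H \<rho> \<Longrightarrow> \<mu> \<in> \<V>"
  using act_V[OF _ lam_V] unfolding weights_act by blast

lemma weight_norm: "\<mu> \<in> weights H \<rho> \<Longrightarrow> ip H \<mu> \<mu> = ip H lam lam"
  using act_ip[OF _ lam_V lam_V] unfolding weights_act by blast

text \<open>If the pairing is positive, \<open>\<mu> - \<alpha> i\<close> is again a weight, hence
  in the same orbit and of the same norm. Equality of the norms forces the pairing to be exactly
  1.\<close>

lemma weight_pairing:
  assumes \<mu>: "\<mu> \<in> weights H \<rho>" and i: "i \<in> N"
  shows "2 * ip H \<mu> (\<alpha> i) / \<Omega>\<^sup>2 \<le> 1"
proof (cases "ip H \<mu> (\<alpha> i) > 0")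
  case True
  note V = weight_V[OF \<mu>] \<alpha>_V[OF i]
  have "\<mu> - \<alpha> i \<in> weights H \<rho>"
    using weight_step(1)[OF rep fdv \<mu> V(1) \<alpha>_root[OF i]] True by blast
  then have "ip H (\<mu> - \<alpha> i) (\<mu> - \<alpha> i) = ip H \<mu> \<mu>" using weight_norm \<mu> by simp
  then have "2 * ip H \<mu> (\<alpha> i) = \<Omega>\<^sup>2"
    using V real_dual_closed root_norm_eq[OF \<alpha>_root[OF i]] ip_commute[of "\<alpha> i" \<mu>]
    by (simp add: ip_linear)
  then show ?thesis using \<Omega>_pos[OF \<alpha>_root[OF i]] by simp
next
  case False
  then have "2 * ip H \<mu> (\<alpha> i) / \<Omega>\<^sup>2 \<le> 0" by (intro divide_nonpos_nonneg) auto
  then show ?thesis by simp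
qed

text \<open>The multiple of its simple root that letter \<open>k\<close> subtracts from the weight
  reached before it.\<close>

definition "drop_at js k = 2 * ip H (act (take k js) lam) (\<alpha> (js ! k)) / \<Omega>\<^sup>2"

lemma act_take_Suc:
  assumes "k < length js"
  shows "act (take (Suc k) js) lam = act (take k js) lam - drop_at js k *\<^sub>F \<alpha> (js ! k)"
  using assms by (simp add: take_Suc_conv_app_nth reflect_def drop_at_def)

lemma act_eq_sum:
  assumes "n \<le> length js"
  shows "act (take n js) lam = lam - (\<Sum>k<n. drop_at js k *\<^sub>F \<alpha> (js ! k))"
  using assms
proof (induction n)
  case (Suc n)
  then show ?case by (simp add: act_take_Suc diff_diff_eq del: act_simps(3))
qed simp

lemma act_eq_coef:
  assumes "set js \<subseteq> N"
  shows "lam - act js lam = (\<Sum>i\<in>N. (\<Sum>k<length js. if js ! k = i then drop_at js k else 0) *\<^sub>F \<alpha> i)"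
proof -
  have "lam - act js lam = (\<Sum>k<length js. drop_at js k *\<^sub>F \<alpha> (js ! k))"
    using act_eq_sum[of "length js" js] by (simp add: algebra_simps)
  also have "\<dots> = (\<Sum>k<length js. \<Sum>i\<in>N. (if js ! k = i then drop_at js k else 0) *\<^sub>F \<alpha> i)"
  proof (rule sum.cong)
    fix k assume "k \<in> {..<length js}"
    then have "js ! k \<in> N" using nth_N[OF assms] by simp
    then show "drop_at js k *\<^sub>F \<alpha> (js ! k)
        = (\<Sum>i\<in>N. (if js ! k = i then drop_at js k else 0) *\<^sub>F \<alpha> i)"
      by (simp add: if_distrib[of "\<lambda>c. c *\<^sub>F _"] cong: if_cong)
  qed simp
  also have "\<dots> = (\<Sum>i\<in>N. (\<Sum>k<length js. if js ! k = i then drop_at js k else 0) *\<^sub>F \<alpha> i)"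
    by (subst sum.swap) (simp add: rf.scale_sum_left)
  finally show ?thesis .
qed

text \<open>The height of \<open>lam - w lam\<close> is the sum of the drops along any word for \<open>w\<close>.\<close>

lemma sum_drop_eq:
  assumes "set js \<subseteq> N" "set ks \<subseteq> N" "act js lam = act ks lam"
  shows "(\<Sum>k<length js. drop_at js k) = (\<Sum>k<length ks. drop_at ks k)"
proof -
  have total: "(\<Sum>i\<in>N. \<Sum>k<length js. if js ! k = i then drop_at js k else 0) = (\<Sum>k<length js. drop_at js k)"
    if "set js \<subseteq> N" for js
    using that by (subst sum.swap) (auto intro!: sum.cong simp: subset_iff)
  have "(\<Sum>k<length js. if js ! k = i then drop_at js k else 0)
      = (\<Sum>k<length ks. if ks ! k = i then drop_at ks k else 0)" if "i \<in> N" for i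
    by (rule coef_unique[OF _ that])
      (simp only: act_eq_coef[OF assms(1), symmetric] act_eq_coef[OF assms(2), symmetric] assms(3))
  then show ?thesis using total[OF assms(1)] total[OF assms(2)] by (metis (no_types, lifting) sum.cong)
qed

lemma drop_at_le:
  assumes "set js \<subseteq> N" "k < length js"
  shows "drop_at js k \<le> 1"
proof -
  have "set (take k js) \<subseteq> N" using assms set_take_subset by fast
  then show ?thesis
    unfolding drop_at_def using weights_act by (intro weight_pairing nth_N[OF assms]) blast
qed

text \<open>The chain of covers belongs to some reduced word \<open>ks\<close>, along which all
  drops are 1. The drops along \<open>js\<close> have the same sum, which is the common length, and
  none exceeds 1; so each equals 1.\<close>

lemma drop_at_eq_1:
  assumes w: "minuscule_element H t \<alpha> \<rho> lam w" and js: "reduced_word H t \<alpha> w js" and k: "k < length js"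
  shows "drop_at js k = 1"
proof -
  obtain ks where ks: "reduced_word H t \<alpha> w ks"
    "\<And>k. k < length ks \<Longrightarrow> weight_cover H t \<alpha> \<rho>
       (word_elt H \<alpha> (take k ks) lam) (word_elt H \<alpha> (take (Suc k) ks) lam)"
    using w unfolding minuscule_element_def by blast
  have N: "set js \<subseteq> N" "set ks \<subseteq> N" and len_eq: "length js = length ks"
    and same: "word_elt H \<alpha> js = word_elt H \<alpha> ks"
    using js ks(1) by (auto simp: reduced_word_def)
  have take: "word_elt H \<alpha> (take k ks) lam = act (take k ks) lam" for k
    using N(2) set_take_subset[of k ks] lam_V by (intro word_elt_apply) auto
  have one: "drop_at ks k = 1" if k: "k < length ks" for k
  proof -
    obtain i where i: "i \<in> N" "act (take (Suc k) ks) lam = act (take k ks) lam - \<alpha> i"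
      using ks(2)[OF k] unfolding weight_cover_def take by blast
    have kN: "ks ! k \<in> N" by (rule nth_N[OF N(2) k])
    \<comment> \<open>A cover subtracts some simple root \<open>\<alpha> i\<close>; comparing its
      coordinates with those of the drop identifies \<open>i\<close> with the letter and the drop
      with 1.\<close>
    have "(\<Sum>j\<in>N. (if j = ks ! k then drop_at ks k else 0) *\<^sub>F \<alpha> j)
        = drop_at ks k *\<^sub>F \<alpha> (ks ! k)"
      using kN by (simp add: if_distrib[of "\<lambda>c. c *\<^sub>F _"] cong: if_cong)
    also have "\<dots> = \<alpha> i" using i(2) act_take_Suc[OF k] by simp
    also have "\<dots> = (\<Sum>j\<in>N. (if j = i then 1 else 0) *\<^sub>F \<alpha> j)" by (rule \<alpha>_coef[OF i(1)])
    finally have "(\<Sum>j\<in>N. (if j = ks ! k then drop_at ks k else 0) *\<^sub>F \<alpha> j)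
        = (\<Sum>j\<in>N. (if j = i then 1 else 0) *\<^sub>F \<alpha> j)" .
    from coef_unique[OF this i(1)] show ?thesis by (simp split: if_splits)
  qed
  have "act js lam = act ks lam" using same word_elt_apply N lam_V by metis
  then have "(\<Sum>k<length js. drop_at js k) = length js"
    using sum_drop_eq[OF N] one len_eq by simp
  then have "(\<Sum>k<length js. 1 - drop_at js k) = 0" by (simp add: sum_subtractf)
  then have "1 - drop_at js k = 0"
    using drop_at_le[OF N(1)] k by (subst (asm) sum_nonneg_eq_0_iff) auto
  then show ?thesis by simp
qed

section \<open>The Cartan matrix and commuting reflections\<close>

definition "cartan_matrix i j = 2 * ip H (\<alpha> i) (\<alpha> j) / \<Omega>\<^sup>2"

lemma cartan_diag: "i \<in> N \<Longrightarrow> cartan_matrix i i = 2"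
  using root_norm_eq[OF \<alpha>_root] \<Omega>_pos[OF \<alpha>_root, of i] by (simp add: cartan_matrix_def)

lemma simple_difference_not_root:
  assumes "i \<in> N" "j \<in> N" "i \<noteq> j"
  shows "\<alpha> i - \<alpha> j \<notin> \<Phi>"
proof
  assume *: "\<alpha> i - \<alpha> j \<in> \<Phi>"
  have eq: "\<alpha> k - \<alpha> l = (\<Sum>m\<in>N. ((if m = k then 1 else 0) - (if m = l then 1 else 0)) *\<^sub>F \<alpha> m)"
    if "k \<in> N" "l \<in> N" for k l
    using \<alpha>_coef[OF that(1)] \<alpha>_coef[OF that(2)] by (simp add: rf.scale_left_diff_distrib sum_subtractf)
  have "\<alpha> k - \<alpha> l \<notin> pos" if "k \<in> N" "l \<in> N" "k \<noteq> l" for k l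
    using pos_coef[OF _ eq[OF that(1,2)] that(2)] that(3) by auto
  moreover have "- (\<alpha> i - \<alpha> j) = \<alpha> j - \<alpha> i" by simp
  ultimately show False using pos_or_neg[OF *] assms by metis
qed

text \<open>A positive inner product would make the difference of two simple roots a root, although
  its coefficients have mixed signs.\<close>

lemma cartan_off_diag:
  assumes "i \<in> N" "j \<in> N" "i \<noteq> j"
  shows "cartan_matrix i j = 0 \<or> cartan_matrix i j = -1"
proof -
  note r = \<alpha>_root[OF assms(1)] \<alpha>_root[OF assms(2)]
  have ne: "\<alpha> i \<noteq> \<alpha> j" using sr assms unfolding simple_roots_def inj_on_def by blast
  have ne': "\<alpha> i \<noteq> - \<alpha> j" using simple_pos assms not_pos_and_neg by metis
  obtain z :: int where z: "2 * ip H (\<alpha> i) (\<alpha> j) = of_int z * \<Omega>\<^sup>2" "z \<in> {-1, 0, 1}"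
    using root_pairing[OF r] ne ne' by blast
  have "\<not> ip H (\<alpha> i) (\<alpha> j) > 0"
    using root_step(1)[OF r _ ne] simple_difference_not_root[OF assms] by blast
  then have "of_int z * \<Omega>\<^sup>2 \<le> 0" using z(1) by linarith
  then have "z \<noteq> 1" using \<Omega>_pos[OF r(1)] by auto
  moreover have "cartan_matrix i j = of_int z" using z(1) \<Omega>_pos[OF r(1)] by (simp add: cartan_matrix_def)
  ultimately show ?thesis using z(2) by auto
qed

text \<open>Orthogonal reflections commute. For entry -1 the test vector is
  \<open>\<alpha> i\<close>: one order sends it to \<open>\<alpha> j\<close>, the other to
  \<open>- (\<alpha> i + \<alpha> j)\<close>, and these pair differently with
  \<open>\<alpha> j\<close>.\<close>

lemma commute_iff:
  assumes "i \<in> N" "j \<in> N"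
  shows "word_elt H \<alpha> [i, j] \<noteq> word_elt H \<alpha> [j, i] \<longleftrightarrow> cartan_matrix i j = -1"
proof (cases "i = j")
  case True
  then show ?thesis using cartan_diag[OF assms(1)] by simp
next
  case False
  note V = \<alpha>_V[OF assms(1)] \<alpha>_V[OF assms(2)]
  have sym: "cartan_matrix j i = cartan_matrix i j" by (simp add: cartan_matrix_def ip_commute)
  show ?thesis
  proof (cases "cartan_matrix i j = 0")
    case True
    then have zero: "ip H (\<alpha> i) (\<alpha> j) = 0" "ip H (\<alpha> j) (\<alpha> i) = 0"
      using \<Omega>_pos[OF \<alpha>_root[OF assms(1)]] ip_commute[of "\<alpha> i"] by (auto simp: cartan_matrix_def)
    have "act [i, j] \<mu> = act [j, i] \<mu>" if "\<mu> \<in> \<V>" for \<mu>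
      using that V zero by (simp add: reflect_def ip_linear real_dual_closed algebra_simps)
    then have "word_elt H \<alpha> [i, j] = word_elt H \<alpha> [j, i]"
      using assms by (intro word_elt_eqI) auto
    then show ?thesis using True by simp
  next
    case f: False
    then have m: "cartan_matrix i j = -1" using cartan_off_diag[OF assms False] by blast
    have "reflect (\<alpha> j) (\<alpha> i) = \<alpha> i + \<alpha> j" "reflect (\<alpha> i) (\<alpha> j) = \<alpha> j + \<alpha> i"
      using m sym by (simp_all add: reflect_def cartan_matrix_def)
    moreover have "reflect (\<alpha> i) (\<alpha> i + \<alpha> j) = \<alpha> j"
      using reflect_involution[OF \<alpha>_root[OF assms(1)] V(2)] calculation(2) by (simp add: add.commute)
    moreover have "ip H (reflect (\<alpha> j) (- \<alpha> i)) (\<alpha> j) = - ip H (\<alpha> i) (reflect (\<alpha> j) (\<alpha> j))"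
      using reflect_adjoint[OF \<alpha>_root[OF assms(2)], of "- \<alpha> i" "\<alpha> j"] V real_dual_closed
        reflect_self[OF \<alpha>_root[OF assms(2)]] uminus_root \<alpha>_root[OF assms(2)] root_V
        ip_linear(3)[OF V(1), of "-1"] by simp
    ultimately have "act [j, i] (\<alpha> i) = \<alpha> j"
      "ip H (act [i, j] (\<alpha> i)) (\<alpha> j) = ip H (\<alpha> i) (\<alpha> j)"
      using reflect_self[OF \<alpha>_root] assms ip_linear(6)[OF V(2), of "\<alpha> i" "-1"] by simp_all
    moreover have "ip H (\<alpha> j) (\<alpha> j) \<noteq> ip H (\<alpha> i) (\<alpha> j)"
      using m cartan_diag[OF assms(2)] by (auto simp: cartan_matrix_def)
    ultimately have "act [i, j] (\<alpha> i) \<noteq> act [j, i] (\<alpha> i)" by metis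
    moreover have "word_elt H \<alpha> [i, j] (\<alpha> i) = act [i, j] (\<alpha> i)"
      "word_elt H \<alpha> [j, i] (\<alpha> i) = act [j, i] (\<alpha> i)"
      using assms V word_elt_apply[of "[i, j]"] word_elt_apply[of "[j, i]"] by auto
    ultimately show ?thesis using m by metis
  qed
qed

lemma homomesy:
  assumes w0: "longest_element H t \<alpha> w0"
    and w: "minuscule_element H t \<alpha> \<rho> lam w" "w lam = w0 lam" "reduced_word H t \<alpha> w js"
  shows "homomesic (order_ideals (heap_carrier js) (heap_order H \<alpha> js))
    (fon_der_flaass (heap_carrier js) (heap_order H \<alpha> js))
    (\<lambda>I. real (card {p \<in> heap_carrier js. p \<in> I \<and>
       toggle (heap_carrier js) (heap_order H \<alpha> js) p I = I - {p}}))
    (2 * (ip H lam lam / \<Omega>\<^sup>2))"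
proof -
  define x where "x i = 2 * ip H lam (\<alpha> i) / \<Omega>\<^sup>2" for i
  have N: "set js \<subseteq> N" and we: "word_elt H \<alpha> js = w" using w(3) by (auto simp: reduced_word_def)
  note jsN = nth_N[OF N]
  \<comment> \<open>Since all drops are 1, the weight after \<open>n\<close> letters is
    \<open>lam\<close> minus their simple roots. This supplies \<open>step\<close> at the prefixes
    and \<open>stop\<close> at the whole word.\<close>
  have prefix: "2 * ip H (act (take n js) lam) (\<alpha> i) / \<Omega>\<^sup>2 = x i - (\<Sum>j<n. cartan_matrix (js ! j) i)"
    if "n \<le> length js" for n i
  proof -
    have "act (take n js) lam = lam - (\<Sum>j<n. \<alpha> (js ! j))"
      unfolding act_eq_sum[OF that] using drop_at_eq_1[OF w(1,3)] that by simp
    moreover have V: "\<alpha> (js ! j) \<in> \<V>" if "j \<in> {..<n}" for j using that \<open>n \<le> _\<close> jsN \<alpha>_V by auto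
    have "ip H (lam - (\<Sum>j<n. \<alpha> (js ! j))) (\<alpha> i) = ip H lam (\<alpha> i) - (\<Sum>j<n. ip H (\<alpha> (js ! j)) (\<alpha> i))"
      using ip_linear(2)[OF lam_V sum_V[of "{..<n}" "\<lambda>j. \<alpha> (js ! j)", OF V]]
        ip_sum[of "{..<n}" "\<lambda>j. \<alpha> (js ! j)", OF V] by simp
    ultimately show ?thesis
      by (simp add: x_def cartan_matrix_def diff_divide_distrib sum_distrib_left sum_divide_distrib
          right_diff_distrib)
  qed
  interpret word: minuscule_word N cartan_matrix x js
  proof
    show "x (js ! k) - (\<Sum>j<k. cartan_matrix (js ! j) (js ! k)) = 1" if "k < length js" for k
      using prefix[of k "js ! k"] drop_at_eq_1[OF w(1,3) that] that by (simp add: drop_at_def)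
    show "x i - (\<Sum>j<length js. cartan_matrix (js ! j) i) \<le> 0" if i: "i \<in> N" for i
    proof -
      have "ip H lam (\<alpha> j) \<ge> 0" if "j \<in> N" for j
        using lam_dominant[OF that] \<Omega>_pos[OF \<alpha>_root[OF that]] by (simp add: zero_le_divide_iff)
      then have "ip H (w0 lam) (\<alpha> i) \<le> 0" by (rule longest_antidominant[OF w0 lam_V _ i])
      moreover have "w0 lam = act js lam" using w(2) we word_elt_apply[OF N lam_V] by simp
      ultimately have "2 * ip H (act js lam) (\<alpha> i) / \<Omega>\<^sup>2 \<le> 0" by (intro divide_nonpos_nonneg) auto
      then show ?thesis using prefix[of "length js" i] by simp
    qed
    show "cartan_matrix i j = cartan_matrix j i" for i j by (simp add: cartan_matrix_def ip_commute)
    show "x i \<ge> 0" if "i \<in> N" for i using lam_dominant[OF that] by (simp add: x_def)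
    show "cartan_matrix i i = 2" if "i \<in> N" for i by (rule cartan_diag[OF that])
    show "cartan_matrix i j = 0 \<or> cartan_matrix i j = -1" if "i \<in> N" "j \<in> N" "i \<noteq> j" for i j
      by (rule cartan_off_diag[OF that])
  qed (rule finite_atLeastAtMost N)+
  have r: "word.r = heap_order H \<alpha> js"
  proof -
    have "word.base = {(j, j'). j \<in> heap_carrier js \<and> j' \<in> heap_carrier js \<and> j < j' \<and>
        word_elt H \<alpha> [heap_label js j, heap_label js j'] \<noteq>
        word_elt H \<alpha> [heap_label js j', heap_label js j]}"
      unfolding word.base_def word.P_def using commute_iff word.label_in[unfolded word.P_def] by blast
    then show ?thesis by (simp add: word.r_def heap_order_def)
  qed
  have "lam \<in> rf.span (\<alpha> ` N)"
    using lam_V sr by (simp add: simple_roots_def)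
  then obtain c where c: "lam = (\<Sum>i\<in>N. c i *\<^sub>F \<alpha> i)"
  proof -
    obtain u where "lam = (\<Sum>\<beta>\<in>\<alpha> ` N. u \<beta> *\<^sub>F \<beta>)"
      using \<open>lam \<in> _\<close> by (auto simp: rf.span_finite)
    then show thesis
      using that[of "\<lambda>i. u (\<alpha> i)"] sr by (simp add: simple_roots_def sum.reindex)
  qed
  have lam_ip: "ip H lam \<chi> = (\<Sum>j\<in>N. c j * ip H (\<alpha> j) \<chi>)" for \<chi>
    unfolding c using \<alpha>_V by (subst ip_sum) (auto simp: ip_linear real_dual_closed)
  have x: "x i = (\<Sum>j\<in>N. c j * cartan_matrix j i)" for i
    unfolding x_def lam_ip by (simp add: cartan_matrix_def sum_distrib_left sum_divide_distrib mult.left_commute)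
  \<comment> \<open>Origin of the constant: expanding one argument of \<open>ip H lam lam\<close> in
    simple roots leaves the pairings of \<open>lam\<close> with the coroots, up to the factor
    \<open>\<Omega>\<^sup>2 / 2\<close>.\<close>
  have "(\<Sum>i\<in>N. c i * x i) = 2 * (ip H lam lam / \<Omega>\<^sup>2)"
    unfolding lam_ip[of lam]
    by (simp add: x_def sum_distrib_left sum_divide_distrib mult.left_commute ip_commute[of lam])
  then show ?thesis
    using word.homomesic_rowmotion[of c, OF x] unfolding word.P_def r by simp
qed

end

theorem theorem1p4:
  fixes H :: "'g::complex_lie_algebra set"
    and t :: nat
    and \<alpha> :: "nat \<Rightarrow> 'g \<Rightarrow> complex"
    and \<rho> :: "'g \<Rightarrow> 'v::complex_vector \<Rightarrow> 'v"
    and lam :: "'g \<Rightarrow> complex"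
    and w\<^sub>0 w :: "('g \<Rightarrow> complex) \<Rightarrow> 'g \<Rightarrow> complex"
    and js :: "nat list"
    and P :: "nat set"
    and r :: "(nat \<times> nat) set"
    and \<Omega> :: real
  assumes "simple_lie_algebra TYPE('g)"
    and "cartan_subalgebra H"
    and "simple_roots H t \<alpha>"
    and "minuscule_representation H t \<alpha> \<rho> lam"
    and "simply_laced H"
    and "\<forall>\<beta>\<in>roots H. root_length H \<beta> = \<Omega>"
    and "longest_element H t \<alpha> w\<^sub>0"
    and "minuscule_element H t \<alpha> \<rho> lam w" and "w lam = w\<^sub>0 lam"
    and "reduced_word H t \<alpha> w js"
    and "P = heap_carrier js" and "r = heap_order H \<alpha> js"
  shows "homomesic (order_ideals P r) (fon_der_flaass P r)
           (\<lambda>I. real (card {p \<in> P. p \<in> I \<and> toggle P r p I = I - {p}}))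
           (2 * (ip H lam lam / \<Omega>\<^sup>2))"
proof -
  interpret minuscule_rep H t \<alpha> \<Omega> \<rho> lam
    using assms by unfold_locales
  show ?thesis
    unfolding assms(11,12) by (rule homomesy[OF assms(7-10)])
qed

end
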